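(* Let $k$ be a field, $\lambda\in k^{\times}$, and let $(G,\alpha)$ be an Artin representation on $F_n$. Then the assignment $V\mapsto \mathcal{LM}_{\lambda}(V)=I_{F_n,\lambda}\otimes_{k[F_n]}V$, $\phi\mapsto \mathrm{id}\otimes\phi$ (defined in the context) is a well-defined endofunctor $\mathcal{LM}_\lambda$ of the category of left $k[F_n\rtimes_\alpha G]$-modules, and the following hold. (1) Suppose $(G,\alpha)=(B_n,\theta)$. Then the functor $\mathrm{Res}^{k[F_n\rtimes_\alpha B_n]}_{k[B_n]}\circ\mathcal{LM}_\lambda$ is isomorphic to the Long-Moody functor $\mathcal{LM}$. (2) Suppose $G=\{e\}$ and identify $F_n\rtimes_\alpha\{e\}$ with $F_n$. Then $\mathcal{LM}_\lambda$ is isomorphic to the Dettweiler-Reiter convolution functor $C_\lambda$.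
   Context: Let $k$ be a field, $n\ge 2$ an integer, $F_n$ the free group on $x_1,\dots,x_n$, and $B_n$ the Artin braid group with standard generators $\sigma_1,\dots,\sigma_{n-1}$. The map $\theta\colon B_n\to\mathrm{Aut}(F_n)$ is the injective homomorphism with $\theta(\sigma_i)(x_i)=x_{i+1}$, $\theta(\sigma_i)(x_{i+1})=x_{i+1}^{-1}x_ix_{i+1}$, $\theta(\sigma_i)(x_j)=x_j$ for $j\neq i,i+1$. An Artin representation $(G,\alpha)$ on $F_n$ is a group $G$ with a homomorphism $\alpha\colon G\to\mathrm{Aut}(F_n)$ that factors as $\alpha=\theta\circ\alpha_{B_n}$ for some homomorphism $\alpha_{B_n}\colon G\to B_n$. In $F_n\rtimes_\alpha G$ one has $gxg^{-1}=\alpha(g)(x)$. $I_{F_n}\subset k[F_n]$ is the augmentation ideal; it is a free right $k[F_n]$-module with basis $x_1-1,\dots,x_n-1$. Hence for a left $k[F_n]$-module $V$, the map $\sum_i(x_i-1)\otimes v_i\mapsto(v_1,\dots,v_n)$ identifies $I_{F_n}\otimes_{k[F_n]}V$ with $V^{\oplus n}$. For $0\le i\le n$ and $1\le j\le n$ put $\lambda_{\ge i}(j)=\lambda$ if $j\le i$ and $\lambda_{\ge i}(j)=1$ if $j>i$. Let $\circ_\lambda$ be the left action of $F_n$ on $I_{F_n}$ by right $k[F_n]$-module automorphisms determined by $$x_i\circ_\lambda(x_j-1)=\lambda_{\ge i}(j)\,x_i(x_j-1)-(\lambda_{\ge (i-1)}(j)-1)(x_j-1)\qquad(1\le i,j\le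 n).$$ $I_{F_n,\lambda}$ denotes $I_{F_n}$ with the left action $\circ_\lambda$ of $F_n$ and the left action of $g\in G$ by (the linear extension of) $\alpha(g)$. On $\mathcal{LM}_\lambda(V)=I_{F_n,\lambda}\otimes_{k[F_n]}V$ the group $F_n\rtimes_\alpha G$ acts by $x\cdot(f\otimes v)=(x\circ_\lambda f)\otimes v$ for $x\in F_n$ and $g\cdot(f\otimes v)=\alpha(g)(f)\otimes gv$ for $g\in G$. Long-Moody functor: $\mathcal{LM}$ sends a left $k[F_n\rtimes_\alpha G]$-module $V$ to the left $k[G]$-module $I_{F_n}\otimes_{k[F_n]}V$ with $g\cdot(f\otimes v)=\alpha(g)(f)\otimes gv$, and $\phi$ to $\mathrm{id}\otimes\phi$. $\mathrm{Res}^R_P$ for rings $P\subset R$ is restriction from left $R$-modules to left $P$-modules. Dettweiler-Reiter convolution functor $C_\lambda$ (endofunctor of left $k[F_n]$-modules): if $V$ is a left $k[F_n]$-module on which $x_i$ acts by $A_i$, then $C_\lambda(V)=V^{\oplus n}$, on which $x_i$ acts by the block matrix that is the identity outside the $i$-th block row and whose $i$-th block row is $(\lambda(A_1-1),\dots,\lambda(A_{i-1}-1),\lambda A_i,A_{i+1}-1,\dots,A_n-1)$; on morphisms $C_\lambda(\phi)=\phi^{\oplus n}$. *)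

theory Defs
  imports "HOL-Algebra.Free_Abelian_Groups" "HOL-Algebra.Bij" "HOL-Algebra.Module"
begin

section \<open>Groups given by generators and relations\<close>

text \<open>The letter \<open>(a, True)\<close> stands for the generator \<open>a\<close> and \<open>(a, False)\<close> for its inverse.\<close>

type_synonym 'a word = "('a \<times> bool) list"

definition words :: "'a set \<Rightarrow> 'a word set" where
  "words X = lists (X \<times> UNIV)"

inductive word_eq :: "'a set \<Rightarrow> ('a word \<times> 'a word) set \<Rightarrow> 'a word \<Rightarrow> 'a word \<Rightarrow> bool"
  for X R where
  refl: "w \<in> words X \<Longrightarrow> word_eq X R w w"
| sym: "word_eq X R u v \<Longrightarrow> word_eq X R v u"
| trans: "word_eq X R u v \<Longrightarrow> word_eq X R v w \<Longrightarrow> word_eq X R u w"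
| append: "word_eq X R u v \<Longrightarrow> word_eq X R u' v' \<Longrightarrow> word_eq X R (u @ u') (v @ v')"
| cancel: "a \<in> X \<Longrightarrow> word_eq X R [(a, b), (a, \<not> b)] []"
| rel: "(u, v) \<in> R \<Longrightarrow> u \<in> words X \<Longrightarrow> v \<in> words X \<Longrightarrow> word_eq X R u v"

definition word_class :: "'a set \<Rightarrow> ('a word \<times> 'a word) set \<Rightarrow> 'a word \<Rightarrow> 'a word set" where
  "word_class X R w = {v. word_eq X R w v}"

definition presented_group :: "'a set \<Rightarrow> ('a word \<times> 'a word) set \<Rightarrow> 'a word set monoid" where
  "presented_group X R =
    \<lparr>carrier = word_class X R ` words X,
     mult = \<lambda>A B. \<Union>u\<in>A. \<Union>v\<in>B. word_class X R (u @ v),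
     one = word_class X R []\<rparr>"

definition free_group :: "nat \<Rightarrow> nat word set monoid" where
  "free_group n = presented_group {1..n} {}"

definition fgen :: "nat \<Rightarrow> nat \<Rightarrow> nat word set" where
  "fgen n i = word_class {1..n} {} [(i, True)]"

definition braid_rels :: "nat \<Rightarrow> (nat word \<times> nat word) set" where
  "braid_rels n =
    {([(i, True), (i + 1, True), (i, True)], [(i + 1, True), (i, True), (i + 1, True)]) | i.
       1 \<le> i \<and> i + 1 \<le> n - 1} \<union>
    {([(i, True), (j, True)], [(j, True), (i, True)]) | i j.
       1 \<le> i \<and> i + 2 \<le> j \<and> j \<le> n - 1}"

definition braid_group :: "nat \<Rightarrow> nat word set monoid" where
  "braid_group n = presented_group {1..n - 1} (braid_rels n)"

definition bgen :: "nat \<Rightarrow> nat \<Rightarrow> nat word set" where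
  "bgen n i = word_class {1..n - 1} (braid_rels n) [(i, True)]"


section \<open>Artin representations and semidirect products\<close>

text \<open>Homomorphisms are taken extensional on the carrier, so that the ones pinned down by their
  values on generators are unique as HOL functions.\<close>

definition is_artin_hom :: "nat \<Rightarrow> (nat word set \<Rightarrow> nat word set \<Rightarrow> nat word set) \<Rightarrow> bool" where
  "is_artin_hom n \<theta> \<longleftrightarrow>
     \<theta> \<in> hom (braid_group n) (AutoGroup (free_group n)) \<and>
     \<theta> \<in> extensional (carrier (braid_group n)) \<and>
     (\<forall>i\<in>{1..n - 1}.
        \<theta> (bgen n i) (fgen n i) = fgen n (i + 1) \<and>
        \<theta> (bgen n i) (fgen n (i + 1)) =
          inv\<^bsub>free_group n\<^esub> (fgen n (i + 1)) \<otimes>\<^bsub>free_group n\<^esub> fgen n i \<otimes>\<^bsub>free_group n\<^esub> fgen n (i + 1) \<and>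
        (\<forall>j\<in>{1..n} - {i, i + 1}. \<theta> (bgen n i) (fgen n j) = fgen n j))"

definition artin_hom :: "nat \<Rightarrow> nat word set \<Rightarrow> nat word set \<Rightarrow> nat word set" where
  "artin_hom n = (THE \<theta>. is_artin_hom n \<theta>)"

definition artin_representation ::
    "nat \<Rightarrow> ('g, 'm) monoid_scheme \<Rightarrow> ('g \<Rightarrow> nat word set \<Rightarrow> nat word set) \<Rightarrow> bool" where
  "artin_representation n G \<alpha> \<longleftrightarrow>
     group G \<and> \<alpha> \<in> hom G (AutoGroup (free_group n)) \<and>
     (\<exists>\<beta>\<in>hom G (braid_group n). \<forall>g\<in>carrier G. \<alpha> g = artin_hom n (\<beta> g))"

definition semidirect ::
    "('a, 'm) monoid_scheme \<Rightarrow> ('g, 'p) monoid_scheme \<Rightarrow> ('g \<Rightarrow> 'a \<Rightarrow> 'a) \<Rightarrow> ('a \<times> 'g) monoid" where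
  "semidirect N G \<alpha> =
    \<lparr>carrier = carrier N \<times> carrier G,
     mult = \<lambda>(x, g) (y, h). (x \<otimes>\<^bsub>N\<^esub> \<alpha> g y, g \<otimes>\<^bsub>G\<^esub> h),
     one = (\<one>\<^bsub>N\<^esub>, \<one>\<^bsub>G\<^esub>)\<rparr>"


section \<open>Group rings\<close>

definition group_ring :: "('g, 'm) monoid_scheme \<Rightarrow> ('g \<Rightarrow> 'k::field) ring" where
  "group_ring G =
    \<lparr>carrier = {a. finite {g. a g \<noteq> 0} \<and> {g. a g \<noteq> 0} \<subseteq> carrier G},
     mult = \<lambda>a b x. \<Sum>(g, h) | a g \<noteq> 0 \<and> b h \<noteq> 0 \<and> g \<otimes>\<^bsub>G\<^esub> h = x. a g * b h,
     one = (\<lambda>x. if x = \<one>\<^bsub>G\<^esub> then 1 else 0),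
     zero = (\<lambda>x. 0),
     add = \<lambda>a b x. a x + b x\<rparr>"

definition gr_single :: "'k::field \<Rightarrow> 'g \<Rightarrow> 'g \<Rightarrow> 'k" where
  "gr_single c g = (\<lambda>x. if x = g then c else 0)"

definition gr_scale :: "'k::field \<Rightarrow> ('g \<Rightarrow> 'k) \<Rightarrow> 'g \<Rightarrow> 'k" where
  "gr_scale c a = (\<lambda>x. c * a x)"

text \<open>The linear extension of a map of groups (\<open>f\<close> need not be injective).\<close>

definition gr_map :: "('g \<Rightarrow> 'h) \<Rightarrow> ('g \<Rightarrow> 'k::field) \<Rightarrow> 'h \<Rightarrow> 'k" where
  "gr_map f a = (\<lambda>y. \<Sum>x | a x \<noteq> 0 \<and> f x = y. a x)"

text \<open>Given scalars \<open>sc\<close> and group elements \<open>act\<close> acting on \<open>M\<close>,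
  the resulting action of elements of the group ring.\<close>

definition linear_action ::
    "('b, 'm) ring_scheme \<Rightarrow> ('k::field \<Rightarrow> 'b \<Rightarrow> 'b) \<Rightarrow> ('g \<Rightarrow> 'b \<Rightarrow> 'b) \<Rightarrow> ('g \<Rightarrow> 'k) \<Rightarrow> 'b \<Rightarrow> 'b" where
  "linear_action M sc act a t = (\<Oplus>\<^bsub>M\<^esub>h\<in>{h. a h \<noteq> 0}. sc (a h) (act h t))"


section \<open>Modules over noncommutative rings\<close>

text \<open>The record \<^typ>\<open>('r, 'b) module\<close> is used for left modules and for right modules;
  for a right module, \<open>r \<odot> m\<close> stands for \<open>m \<cdot> r\<close>. The fields \<open>mult\<close> and \<open>one\<close> play no role.\<close>

locale left_module = R?: ring + M?: abelian_group M for M (structure) +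
  assumes smult_closed:
      "\<lbrakk>a \<in> carrier R; x \<in> carrier M\<rbrakk> \<Longrightarrow> a \<odot>\<^bsub>M\<^esub> x \<in> carrier M"
    and smult_l_distr:
      "\<lbrakk>a \<in> carrier R; b \<in> carrier R; x \<in> carrier M\<rbrakk> \<Longrightarrow>
        (a \<oplus> b) \<odot>\<^bsub>M\<^esub> x = a \<odot>\<^bsub>M\<^esub> x \<oplus>\<^bsub>M\<^esub> b \<odot>\<^bsub>M\<^esub> x"
    and smult_r_distr:
      "\<lbrakk>a \<in> carrier R; x \<in> carrier M; y \<in> carrier M\<rbrakk> \<Longrightarrow>
        a \<odot>\<^bsub>M\<^esub> (x \<oplus>\<^bsub>M\<^esub> y) = a \<odot>\<^bsub>M\<^esub> x \<oplus>\<^bsub>M\<^esub> a \<odot>\<^bsub>M\<^esub> y"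
    and smult_assoc:
      "\<lbrakk>a \<in> carrier R; b \<in> carrier R; x \<in> carrier M\<rbrakk> \<Longrightarrow>
        (a \<otimes> b) \<odot>\<^bsub>M\<^esub> x = a \<odot>\<^bsub>M\<^esub> (b \<odot>\<^bsub>M\<^esub> x)"
    and smult_one:
      "x \<in> carrier M \<Longrightarrow> \<one> \<odot>\<^bsub>M\<^esub> x = x"

definition mod_hom ::
    "('r, 'm) ring_scheme \<Rightarrow> ('r, 'v) module \<Rightarrow> ('r, 'w) module \<Rightarrow> ('v \<Rightarrow> 'w) set" where
  "mod_hom R V W =
    {\<phi> \<in> carrier V \<rightarrow>\<^sub>E carrier W.
       (\<forall>x\<in>carrier V. \<forall>y\<in>carrier V. \<phi> (x \<oplus>\<^bsub>V\<^esub> y) = \<phi> x \<oplus>\<^bsub>W\<^esub> \<phi> y) \<and>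
       (\<forall>r\<in>carrier R. \<forall>x\<in>carrier V. \<phi> (r \<odot>\<^bsub>V\<^esub> x) = r \<odot>\<^bsub>W\<^esub> \<phi> x)}"

definition mod_iso ::
    "('r, 'm) ring_scheme \<Rightarrow> ('r, 'v) module \<Rightarrow> ('r, 'w) module \<Rightarrow> ('v \<Rightarrow> 'w) set" where
  "mod_iso R V W = {\<phi> \<in> mod_hom R V W. bij_betw \<phi> (carrier V) (carrier W)}"

text \<open>The group of automorphisms of a (left or right) module.\<close>

definition mod_AutoGroup ::
    "('r, 'm) ring_scheme \<Rightarrow> ('r, 'v) module \<Rightarrow> ('v \<Rightarrow> 'v) monoid" where
  "mod_AutoGroup R M = BijGroup (carrier M) \<lparr>carrier := mod_iso R M M\<rparr>"

definition restrict_scalars :: "('p \<Rightarrow> 'r) \<Rightarrow> ('r, 'v) module \<Rightarrow> ('p, 'v) module" where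
  "restrict_scalars \<iota> V =
    \<lparr>carrier = carrier V, mult = mult V, one = one V, zero = zero V, add = add V,
     smult = \<lambda>p v. \<iota> p \<odot>\<^bsub>V\<^esub> v\<rparr>"

definition with_smult :: "'v ring \<Rightarrow> ('r \<Rightarrow> 'v \<Rightarrow> 'v) \<Rightarrow> ('r, 'v) module" where
  "with_smult A s =
    \<lparr>carrier = carrier A, mult = mult A, one = one A, zero = zero A, add = add A, smult = s\<rparr>"


section \<open>Functors between module categories\<close>

text \<open>The category of left \<open>R\<close>-modules is rendered as that of all left \<open>R\<close>-modules whose carrier is
  a set of elements of the type \<open>'v\<close>. A functor may change this type. Since a HOL function does not
  determine its source and target modules, \<open>arr\<close> takes these as arguments.\<close>

record ('r, 'v, 's, 'w) mod_functor =
  obj :: "('r, 'v) module \<Rightarrow> ('s, 'w) module"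
  arr :: "('r, 'v) module \<Rightarrow> ('r, 'v) module \<Rightarrow> ('v \<Rightarrow> 'v) \<Rightarrow> 'w \<Rightarrow> 'w"

definition is_functor ::
    "('r, 'm) ring_scheme \<Rightarrow> ('s, 'p) ring_scheme \<Rightarrow> ('r, 'v, 's, 'w) mod_functor \<Rightarrow> bool" where
  "is_functor R S F \<longleftrightarrow>
     (\<forall>V. left_module R V \<longrightarrow> left_module S (obj F V)) \<and>
     (\<forall>V W. left_module R V \<longrightarrow> left_module R W \<longrightarrow>
        (\<forall>\<phi>\<in>mod_hom R V W. arr F V W \<phi> \<in> mod_hom S (obj F V) (obj F W))) \<and>
     (\<forall>V. left_module R V \<longrightarrow> arr F V V (\<lambda>v\<in>carrier V. v) = (\<lambda>w\<in>carrier (obj F V). w)) \<and>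
     (\<forall>U V W. left_module R U \<longrightarrow> left_module R V \<longrightarrow> left_module R W \<longrightarrow>
        (\<forall>\<phi>\<in>mod_hom R U V. \<forall>\<psi>\<in>mod_hom R V W.
           arr F U W (compose (carrier U) \<psi> \<phi>) =
             compose (carrier (obj F U)) (arr F V W \<psi>) (arr F U V \<phi>)))"

definition nat_isomorphic ::
    "('r, 'm) ring_scheme \<Rightarrow> ('s, 'p) ring_scheme \<Rightarrow>
     ('r, 'v, 's, 'w) mod_functor \<Rightarrow> ('r, 'v, 's, 'u) mod_functor \<Rightarrow> bool" where
  "nat_isomorphic R S F F' \<longleftrightarrow>
     is_functor R S F \<and> is_functor R S F' \<and>
     (\<exists>\<eta>. (\<forall>V. left_module R V \<longrightarrow> \<eta> V \<in> mod_iso S (obj F V) (obj F' V)) \<and>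
          (\<forall>V W. left_module R V \<longrightarrow> left_module R W \<longrightarrow>
             (\<forall>\<phi>\<in>mod_hom R V W.
                compose (carrier (obj F V)) (\<eta> W) (arr F V W \<phi>) =
                compose (carrier (obj F V)) (arr F' V W \<phi>) (\<eta> V))))"

definition functor_comp ::
    "('s, 'w, 't, 'u) mod_functor \<Rightarrow> ('r, 'v, 's, 'w) mod_functor \<Rightarrow> ('r, 'v, 't, 'u) mod_functor"
    (infixr \<open>\<circ>\<^sub>F\<close> 55) where
  "F' \<circ>\<^sub>F F =
    \<lparr>obj = \<lambda>V. obj F' (obj F V),
     arr = \<lambda>V W \<phi>. arr F' (obj F V) (obj F W) (arr F V W \<phi>)\<rparr>"

text \<open>Restriction along a ring homomorphism \<open>\<iota>\<close>.\<close>

definition Res :: "('p \<Rightarrow> 'r) \<Rightarrow> ('r, 'v, 'p, 'v) mod_functor" where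
  "Res \<iota> = \<lparr>obj = restrict_scalars \<iota>, arr = \<lambda>V W \<phi>. \<phi>\<rparr>"


section \<open>Tensor products over noncommutative rings\<close>

definition tensor_gens ::
    "('r, 'm) ring_scheme \<Rightarrow> ('r, 'a) module \<Rightarrow> ('r, 'b) module \<Rightarrow> ('a \<times> 'b \<Rightarrow>\<^sub>0 int) set" where
  "tensor_gens R M N =
    {frag_of (x \<oplus>\<^bsub>M\<^esub> y, v) - frag_of (x, v) - frag_of (y, v) | x y v.
       x \<in> carrier M \<and> y \<in> carrier M \<and> v \<in> carrier N} \<union>
    {frag_of (x, v \<oplus>\<^bsub>N\<^esub> w) - frag_of (x, v) - frag_of (x, w) | x v w.
       x \<in> carrier M \<and> v \<in> carrier N \<and> w \<in> carrier N} \<union>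
    {frag_of (r \<odot>\<^bsub>M\<^esub> x, v) - frag_of (x, r \<odot>\<^bsub>N\<^esub> v) | x r v.
       x \<in> carrier M \<and> r \<in> carrier R \<and> v \<in> carrier N}"

definition tensor_rel ::
    "('r, 'm) ring_scheme \<Rightarrow> ('r, 'a) module \<Rightarrow> ('r, 'b) module \<Rightarrow> ('a \<times> 'b \<Rightarrow>\<^sub>0 int) set" where
  "tensor_rel R M N = generate (free_Abelian_group (carrier M \<times> carrier N)) (tensor_gens R M N)"

definition tensor_class ::
    "('r, 'm) ring_scheme \<Rightarrow> ('r, 'a) module \<Rightarrow> ('r, 'b) module \<Rightarrow>
     ('a \<times> 'b \<Rightarrow>\<^sub>0 int) \<Rightarrow> ('a \<times> 'b \<Rightarrow>\<^sub>0 int) set" where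
  "tensor_class R M N z = tensor_rel R M N #>\<^bsub>free_Abelian_group (carrier M \<times> carrier N)\<^esub> z"

definition tensor_elt ::
    "('r, 'm) ring_scheme \<Rightarrow> ('r, 'a) module \<Rightarrow> ('r, 'b) module \<Rightarrow>
     'a \<Rightarrow> 'b \<Rightarrow> ('a \<times> 'b \<Rightarrow>\<^sub>0 int) set" where
  "tensor_elt R M N x v = tensor_class R M N (frag_of (x, v))"

text \<open>The tensor product of the right module \<open>M\<close> and the left module \<open>N\<close>, an abelian group
  written additively.\<close>

definition tensor_product ::
    "('r, 'm) ring_scheme \<Rightarrow> ('r, 'a) module \<Rightarrow> ('r, 'b) module \<Rightarrow>
     (('a \<times> 'b \<Rightarrow>\<^sub>0 int) set) ring" where
  "tensor_product R M N =
    (let T = free_Abelian_group (carrier M \<times> carrier N) Mod tensor_rel R M N in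
     \<lparr>carrier = carrier T, mult = undefined, one = undefined,
      zero = one T, add = mult T\<rparr>)"

text \<open>The map \<open>f \<otimes> g\<close> into the tensor product of \<open>M'\<close> and \<open>N'\<close>. If \<open>f\<close> and \<open>g\<close> induce a
  well-defined map, then the classes in the union all coincide.\<close>

definition tensor_map ::
    "('r, 'm) ring_scheme \<Rightarrow> ('r, 'c) module \<Rightarrow> ('r, 'd) module \<Rightarrow> ('a \<Rightarrow> 'c) \<Rightarrow> ('b \<Rightarrow> 'd) \<Rightarrow>
     ('a \<times> 'b \<Rightarrow>\<^sub>0 int) set \<Rightarrow> ('c \<times> 'd \<Rightarrow>\<^sub>0 int) set" where
  "tensor_map R M' N' f g X =
    (\<Union>z\<in>X. tensor_class R M' N' (frag_extend (\<lambda>(x, v). frag_of (f x, g v)) z))"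


section \<open>The augmentation ideal and its twisted action\<close>

definition aug_ideal :: "nat \<Rightarrow> (nat word set \<Rightarrow> 'k::field, nat word set \<Rightarrow> 'k) module" where
  "aug_ideal n =
    (let K = group_ring (free_group n) in
     \<lparr>carrier = {f \<in> carrier K. (\<Sum>x | f x \<noteq> 0. f x) = 0},
      mult = mult K, one = one K, zero = zero K, add = add K,
      smult = \<lambda>r f. f \<otimes>\<^bsub>K\<^esub> r\<rparr>)"

text \<open>\<open>x\<^sub>i\<close> as an element of the group ring, and \<open>x\<^sub>i - 1\<close>.\<close>

definition xel :: "nat \<Rightarrow> nat \<Rightarrow> nat word set \<Rightarrow> 'k::field" where
  "xel n i = gr_single 1 (fgen n i)"

definition xm1 :: "nat \<Rightarrow> nat \<Rightarrow> nat word set \<Rightarrow> 'k::field" where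
  "xm1 n i = xel n i \<ominus>\<^bsub>group_ring (free_group n)\<^esub> \<one>\<^bsub>group_ring (free_group n)\<^esub>"

definition lam_ge :: "'k::field \<Rightarrow> nat \<Rightarrow> nat \<Rightarrow> 'k" where
  "lam_ge lam i j = (if j \<le> i then lam else 1)"

definition is_twisted_action ::
    "nat \<Rightarrow> 'k::field \<Rightarrow> (nat word set \<Rightarrow> (nat word set \<Rightarrow> 'k) \<Rightarrow> nat word set \<Rightarrow> 'k) \<Rightarrow> bool" where
  "is_twisted_action n lam \<rho> \<longleftrightarrow>
     \<rho> \<in> hom (free_group n) (mod_AutoGroup (group_ring (free_group n)) (aug_ideal n)) \<and>
     \<rho> \<in> extensional (carrier (free_group n)) \<and>
     (\<forall>i\<in>{1..n}. \<forall>j\<in>{1..n}.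
        \<rho> (fgen n i) (xm1 n j) =
          gr_scale (lam_ge lam i j) (xel n i \<otimes>\<^bsub>group_ring (free_group n)\<^esub> xm1 n j)
          \<ominus>\<^bsub>group_ring (free_group n)\<^esub> gr_scale (lam_ge lam (i - 1) j - 1) (xm1 n j))"

definition twisted_action ::
    "nat \<Rightarrow> 'k::field \<Rightarrow> nat word set \<Rightarrow> (nat word set \<Rightarrow> 'k) \<Rightarrow> nat word set \<Rightarrow> 'k" where
  "twisted_action n lam = (THE \<rho>. is_twisted_action n lam \<rho>)"


section \<open>The Long-Moody functors\<close>

type_synonym ('k, 'v) lm_elt = "((nat word set \<Rightarrow> 'k) \<times> 'v \<Rightarrow>\<^sub>0 int) set"

text \<open>The inclusions of the two factors into the semidirect product, extended to group rings.\<close>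

definition incF ::
    "('g, 'm) monoid_scheme \<Rightarrow> (nat word set \<Rightarrow> 'k::field) \<Rightarrow> nat word set \<times> 'g \<Rightarrow> 'k" where
  "incF G = gr_map (\<lambda>x. (x, \<one>\<^bsub>G\<^esub>))"

definition incG :: "nat \<Rightarrow> ('g \<Rightarrow> 'k::field) \<Rightarrow> nat word set \<times> 'g \<Rightarrow> 'k" where
  "incG n = gr_map (\<lambda>g. (\<one>\<^bsub>free_group n\<^esub>, g))"

abbreviation kF :: "nat \<Rightarrow> (nat word set \<Rightarrow> 'k::field) ring" where
  "kF n \<equiv> group_ring (free_group n)"

abbreviation kFG ::
    "nat \<Rightarrow> ('g, 'm) monoid_scheme \<Rightarrow> ('g \<Rightarrow> nat word set \<Rightarrow> nat word set) \<Rightarrow>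
     (nat word set \<times> 'g \<Rightarrow> 'k::field) ring" where
  "kFG n G \<alpha> \<equiv> group_ring (semidirect (free_group n) G \<alpha>)"

context
  fixes n :: nat and G :: "('g, 'm) monoid_scheme"
    and \<alpha> :: "'g \<Rightarrow> nat word set \<Rightarrow> nat word set"
begin

definition LM_group ::
    "(nat word set \<times> 'g \<Rightarrow> 'k::field, 'v) module \<Rightarrow> ('k, 'v) lm_elt ring" where
  "LM_group V = tensor_product (kF n) (aug_ideal n) (restrict_scalars (incF G) V)"

definition LM_elt ::
    "(nat word set \<times> 'g \<Rightarrow> 'k::field, 'v) module \<Rightarrow> (nat word set \<Rightarrow> 'k) \<Rightarrow> 'v \<Rightarrow> ('k, 'v) lm_elt" where
  "LM_elt V f v = tensor_elt (kF n) (aug_ideal n) (restrict_scalars (incF G) V) f v"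

definition LM_tensor_map ::
    "(nat word set \<times> 'g \<Rightarrow> 'k::field, 'w) module \<Rightarrow>
     ((nat word set \<Rightarrow> 'k) \<Rightarrow> nat word set \<Rightarrow> 'k) \<Rightarrow> ('v \<Rightarrow> 'w) \<Rightarrow> ('k, 'v) lm_elt \<Rightarrow> ('k, 'w) lm_elt" where
  "LM_tensor_map W = tensor_map (kF n) (aug_ideal n) (restrict_scalars (incF G) W)"

definition LM_scalar ::
    "(nat word set \<times> 'g \<Rightarrow> 'k::field, 'v) module \<Rightarrow> 'k \<Rightarrow> ('k, 'v) lm_elt \<Rightarrow> ('k, 'v) lm_elt" where
  "LM_scalar V c = LM_tensor_map V (gr_scale c) (\<lambda>v. v)"

definition LM_actG ::
    "(nat word set \<times> 'g \<Rightarrow> 'k::field, 'v) module \<Rightarrow> 'g \<Rightarrow> ('k, 'v) lm_elt \<Rightarrow> ('k, 'v) lm_elt" where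
  "LM_actG V g =
     LM_tensor_map V (gr_map (\<alpha> g)) (\<lambda>v. gr_single 1 (\<one>\<^bsub>free_group n\<^esub>, g) \<odot>\<^bsub>V\<^esub> v)"

definition LM_actF ::
    "'k \<Rightarrow> (nat word set \<times> 'g \<Rightarrow> 'k::field, 'v) module \<Rightarrow>
     nat word set \<Rightarrow> ('k, 'v) lm_elt \<Rightarrow> ('k, 'v) lm_elt" where
  "LM_actF lam V x = LM_tensor_map V (twisted_action n lam x) (\<lambda>v. v)"

definition LM_arr ::
    "(nat word set \<times> 'g \<Rightarrow> 'k::field, 'v) module \<Rightarrow> (nat word set \<times> 'g \<Rightarrow> 'k, 'v) module \<Rightarrow>
     ('v \<Rightarrow> 'v) \<Rightarrow> ('k, 'v) lm_elt \<Rightarrow> ('k, 'v) lm_elt" where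
  "LM_arr V W \<phi> = (\<lambda>t\<in>carrier (LM_group V). LM_tensor_map W (\<lambda>f. f) \<phi> t)"

definition LM ::
    "(nat word set \<times> 'g \<Rightarrow> 'k::field, 'v, 'g \<Rightarrow> 'k, ('k, 'v) lm_elt) mod_functor" where
  "LM =
    \<lparr>obj = \<lambda>V. with_smult (LM_group V)
       (linear_action (LM_group V) (LM_scalar V) (LM_actG V)),
     arr = LM_arr\<rparr>"

text \<open>The element \<open>(x, g)\<close> of the semidirect product is the product of \<open>x\<close> and \<open>g\<close>.\<close>

definition LM_lam ::
    "'k \<Rightarrow> (nat word set \<times> 'g \<Rightarrow> 'k::field, 'v, nat word set \<times> 'g \<Rightarrow> 'k, ('k, 'v) lm_elt) mod_functor" where
  "LM_lam lam =
    \<lparr>obj = \<lambda>V. with_smult (LM_group V)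
       (linear_action (LM_group V) (LM_scalar V) (\<lambda>(x, g) t. LM_actF lam V x (LM_actG V g t))),
     arr = LM_arr\<rparr>"

end


section \<open>The Dettweiler-Reiter convolution functor\<close>

definition power_group :: "nat \<Rightarrow> ('r, 'v) module \<Rightarrow> (nat \<Rightarrow> 'v) ring" where
  "power_group n V =
    \<lparr>carrier = {1..n} \<rightarrow>\<^sub>E carrier V, mult = undefined, one = undefined,
     zero = (\<lambda>j\<in>{1..n}. \<zero>\<^bsub>V\<^esub>), add = (\<lambda>v w. \<lambda>j\<in>{1..n}. v j \<oplus>\<^bsub>V\<^esub> w j)\<rparr>"

definition power_scalar ::
    "nat \<Rightarrow> (nat word set \<Rightarrow> 'k::field, 'v) module \<Rightarrow> 'k \<Rightarrow> (nat \<Rightarrow> 'v) \<Rightarrow> nat \<Rightarrow> 'v" where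
  "power_scalar n V c v = (\<lambda>j\<in>{1..n}. gr_single c \<one>\<^bsub>free_group n\<^esub> \<odot>\<^bsub>V\<^esub> v j)"

text \<open>The entries of the \<open>i\<close>-th block row, as elements of the group ring acting on \<open>V\<close>.\<close>

definition conv_entry :: "nat \<Rightarrow> 'k::field \<Rightarrow> nat \<Rightarrow> nat \<Rightarrow> nat word set \<Rightarrow> 'k" where
  "conv_entry n lam i j =
    (if j < i then gr_scale lam (xm1 n j)
     else if j = i then gr_scale lam (xel n i)
     else xm1 n j)"

definition conv_matrix ::
    "nat \<Rightarrow> 'k \<Rightarrow> (nat word set \<Rightarrow> 'k::field, 'v) module \<Rightarrow> nat \<Rightarrow> (nat \<Rightarrow> 'v) \<Rightarrow> nat \<Rightarrow> 'v" where
  "conv_matrix n lam V i =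
    (\<lambda>v\<in>carrier (power_group n V). \<lambda>l\<in>{1..n}.
       if l = i then (\<Oplus>\<^bsub>V\<^esub>j\<in>{1..n}. conv_entry n lam i j \<odot>\<^bsub>V\<^esub> v j) else v l)"

definition conv_rep ::
    "nat \<Rightarrow> 'k \<Rightarrow> (nat word set \<Rightarrow> 'k::field, 'v) module \<Rightarrow>
     nat word set \<Rightarrow> (nat \<Rightarrow> 'v) \<Rightarrow> nat \<Rightarrow> 'v" where
  "conv_rep n lam V =
    (THE \<rho>. \<rho> \<in> hom (free_group n) (BijGroup (carrier (power_group n V))) \<and>
            \<rho> \<in> extensional (carrier (free_group n)) \<and>
            (\<forall>i\<in>{1..n}. \<rho> (fgen n i) = conv_matrix n lam V i))"

definition Conv ::
    "nat \<Rightarrow> 'k \<Rightarrow> (nat word set \<Rightarrow> 'k::field, 'v, nat word set \<Rightarrow> 'k, nat \<Rightarrow> 'v) mod_functor" where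
  "Conv n lam =
    \<lparr>obj = \<lambda>V. with_smult (power_group n V)
       (linear_action (power_group n V) (power_scalar n V) (conv_rep n lam V)),
     arr = \<lambda>V W \<phi>. \<lambda>v\<in>carrier (power_group n V). \<lambda>j\<in>{1..n}. \<phi> (v j)\<rparr>"

end

theory Submission
  imports Defs
begin

text \<open>
  The augmentation ideal \<open>I\<close> is a free right module over the group ring \<open>k[F\<^sub>n]\<close> on the elements
  \<open>Y k = x\<^sub>k - 1\<close>: right linear maps with prescribed values on them exist, as linear extensions of
  derivations \<open>d (x y) = d x \<cdot> y + d y\<close> (\<open>right_linear_exists\<close>), and are unique
  (\<open>semilinear_eq\<close>). Everything below is decided on this basis.

  In the twisted action \<open>x\<^sub>i\<close> acts by \<open>T i f = f + Y i \<cdot> E i f\<close> with a right linear map \<open>E i\<close> for which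
  \<open>1 + E i (Y i) = lam * x\<^sub>i\<close> is a unit of the group ring. Hence \<open>T i\<close> is invertible (\<open>T_T_inv\<close>), and
  since \<open>F\<^sub>n\<close> is free this defines an action (\<open>ex1_twisted_action\<close>).

  For the functor, the actions of \<open>F\<^sub>n\<close> and \<open>G\<close> on \<open>I \<otimes> V\<close> must satisfy the relation
  \<open>g x g\<^sup>-\<^sup>1 = \<alpha> g x\<close> of the semidirect product. This amounts to the identity
  \<open>\<alpha> g (x \<circ> f) = (\<alpha> g x) \<circ> \<alpha> g f\<close> in \<open>I\<close>, where \<open>\<circ>\<close> is the twisted action. The \<open>g\<close> with this property
  form a group, and \<open>\<alpha>\<close> factors through the braid group, so it is enough to prove the identity for
  \<open>g = \<sigma>\<^sub>i\<close> and \<open>x = x\<^sub>j\<close> (\<open>intertwines_generator\<close>). There the formulas for the Artin representation enter.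

  (1) holds because restriction to \<open>G\<close> forgets the twisted action, which is all that \<open>lam\<close>
  influences: the identity maps are an isomorphism. (2) holds because the basis identifies
  \<open>I \<otimes> V\<close> with \<open>V\<^sup>n\<close>, and there \<open>T i\<close> becomes the matrix whose only nontrivial block row, the
  \<open>i\<close>-th, is that of the convolution (\<open>conv_entry_eq\<close>, \<open>coords_actF_fgen\<close>).

  The groups, group rings and tensor products in question are concrete quotients and function
  spaces, so that the first part of the development establishes their universal properties, by
  which all maps are then constructed and compared.
\<close>

section \<open>Groups given by generators and relations\<close>

lemma words_Nil [simp]: "[] \<in> words X"
  and words_Cons [simp]: "p # w \<in> words X \<longleftrightarrow> fst p \<in> X \<and> w \<in> words X"
  and words_append [simp]: "u @ v \<in> words X \<longleftrightarrow> u \<in> words X \<and> v \<in> words X"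
  by (cases p; auto simp: words_def)+

lemma word_eq_words: "word_eq X R u v \<Longrightarrow> u \<in> words X \<and> v \<in> words X"
  by (induction rule: word_eq.induct) auto

lemma word_class_eq_iff:
  "v \<in> words X \<Longrightarrow> word_class X R u = word_class X R v \<longleftrightarrow> word_eq X R u v"
  unfolding word_class_def by (blast intro: word_eq.intros)

lemma word_class_self: "u \<in> words X \<Longrightarrow> u \<in> word_class X R u"
  unfolding word_class_def by (blast intro: word_eq.intros)

definition inv_word :: "'a word \<Rightarrow> 'a word" where
  "inv_word w = rev (map (\<lambda>(a, b). (a, \<not> b)) w)"

lemma inv_word_words [simp]: "inv_word w \<in> words X \<longleftrightarrow> w \<in> words X"
  by (induction w) (auto simp: inv_word_def)

lemma inv_word_cancel: "w \<in> words X \<Longrightarrow> word_eq X R (inv_word w @ w) []"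
proof (induction w)
  case Nil
  then show ?case by (simp add: inv_word_def word_eq.refl)
next
  case (Cons p w)
  have "word_eq X R [(fst p, \<not> snd p), (fst p, \<not> \<not> snd p)] []"
    using Cons.prems by (intro word_eq.cancel) auto
  then have "word_eq X R ([(fst p, \<not> snd p), p] @ w) ([] @ w)"
    using Cons.prems by (intro word_eq.append) (auto intro: word_eq.refl)
  then have "word_eq X R (inv_word w @ [(fst p, \<not> snd p), p] @ w) (inv_word w @ w)"
    using Cons.prems by (intro word_eq.append) (auto intro: word_eq.refl)
  then have "word_eq X R (inv_word w @ [(fst p, \<not> snd p), p] @ w) []"
    using Cons by (auto intro: word_eq.trans)
  then show ?case by (simp add: inv_word_def case_prod_beta)
qed

lemma presented_group_simps:
  "carrier (presented_group X R) = word_class X R ` words X"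
  "\<one>\<^bsub>presented_group X R\<^esub> = word_class X R []"
  by (auto simp: presented_group_def)

lemma presented_group_mult:
  assumes "u \<in> words X" "v \<in> words X"
  shows "word_class X R u \<otimes>\<^bsub>presented_group X R\<^esub> word_class X R v = word_class X R (u @ v)"
proof -
  have eq: "word_class X R (u' @ v') = word_class X R (u @ v)"
    if "u' \<in> word_class X R u" "v' \<in> word_class X R v" for u' v'
    using that assms
    by (subst word_class_eq_iff) (auto simp: word_class_def intro: word_eq.append word_eq.sym)
  have "(\<Union>v'\<in>word_class X R v. word_class X R (u' @ v')) = word_class X R (u @ v)"
    if "u' \<in> word_class X R u" for u'
    by (rule UN_constant_eq[OF word_class_self[OF assms(2)]]) (use eq[OF that] in blast)
  then have "(\<Union>u'\<in>word_class X R u. \<Union>v'\<in>word_class X R v. word_class X R (u' @ v'))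
      = word_class X R (u @ v)"
    by (intro UN_constant_eq[OF word_class_self[OF assms(1)]] ballI)
  then show ?thesis by (simp add: presented_group_def)
qed

lemma group_presented_group: "group (presented_group X R)"
proof (rule groupI)
  fix A assume "A \<in> carrier (presented_group X R)"
  then obtain w where w: "w \<in> words X" "A = word_class X R w"
    by (auto simp: presented_group_simps)
  have "word_class X R (inv_word w) \<otimes>\<^bsub>presented_group X R\<^esub> A = \<one>\<^bsub>presented_group X R\<^esub>"
    using w by (simp add: presented_group_mult presented_group_simps word_class_eq_iff inv_word_cancel)
  then show "\<exists>B\<in>carrier (presented_group X R). B \<otimes>\<^bsub>presented_group X R\<^esub> A = \<one>\<^bsub>presented_group X R\<^esub>"
    using w by (auto simp: presented_group_simps)
qed (auto simp: presented_group_mult presented_group_simps)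

lemma word_class_generator_carrier [simp]:
  "a \<in> X \<Longrightarrow> word_class X R [(a, True)] \<in> carrier (presented_group X R)"
  by (auto simp: presented_group_simps)

lemma word_class_inverse_generator:
  assumes "a \<in> X"
  shows "word_class X R [(a, False)] = inv\<^bsub>presented_group X R\<^esub> (word_class X R [(a, True)])"
proof -
  interpret group "presented_group X R" by (rule group_presented_group)
  have "word_class X R [(a, False)] \<otimes>\<^bsub>presented_group X R\<^esub> word_class X R [(a, True)]
      = \<one>\<^bsub>presented_group X R\<^esub>"
    using assms word_eq.cancel[OF assms, of R False]
    by (simp add: presented_group_mult presented_group_simps word_class_eq_iff)
  then show ?thesis
    using assms by (intro inv_equality[symmetric]) (auto simp: presented_group_simps)
qed

lemma presented_group_induct [consumes 1, case_names one gen inv]: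
  assumes "A \<in> carrier (presented_group X R)"
    and "P \<one>\<^bsub>presented_group X R\<^esub>"
    and "\<And>a B. a \<in> X \<Longrightarrow> B \<in> carrier (presented_group X R) \<Longrightarrow> P B \<Longrightarrow>
           P (word_class X R [(a, True)] \<otimes>\<^bsub>presented_group X R\<^esub> B)"
    and "\<And>a B. a \<in> X \<Longrightarrow> B \<in> carrier (presented_group X R) \<Longrightarrow> P B \<Longrightarrow>
           P (inv\<^bsub>presented_group X R\<^esub> (word_class X R [(a, True)]) \<otimes>\<^bsub>presented_group X R\<^esub> B)"
  shows "P A"
proof -
  have "P (word_class X R w)" if "w \<in> words X" for w
    using that
  proof (induction w)
    case Nil
    then show ?case using assms(2) by (simp add: presented_group_simps)
  next
    case (Cons p w)
    obtain a b where p: "p = (a, b)" by force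
    have eq: "word_class X R (p # w) =
        word_class X R [(a, b)] \<otimes>\<^bsub>presented_group X R\<^esub> word_class X R w"
      using Cons.prems by (subst presented_group_mult) (auto simp: p)
    have "word_class X R w \<in> carrier (presented_group X R)" "a \<in> X" "P (word_class X R w)"
      using Cons by (auto simp: presented_group_simps p)
    then show ?case
      unfolding eq using assms(3,4)
      by (cases b) (auto simp: word_class_inverse_generator)
  qed
  then show ?thesis using assms(1) by (auto simp: presented_group_simps)
qed

lemma presented_group_hom_eq:
  assumes "group H" "\<phi> \<in> hom (presented_group X R) H" "\<psi> \<in> hom (presented_group X R) H"
    and "\<And>a. a \<in> X \<Longrightarrow> \<phi> (word_class X R [(a, True)]) = \<psi> (word_class X R [(a, True)])"
    and "A \<in> carrier (presented_group X R)"
  shows "\<phi> A = \<psi> A"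
proof -
  interpret \<phi>: group_hom "presented_group X R" H \<phi>
    using assms group_presented_group by (auto simp: group_hom_def group_hom_axioms_def)
  interpret \<psi>: group_hom "presented_group X R" H \<psi>
    using assms group_presented_group by (auto simp: group_hom_def group_hom_axioms_def)
  from assms(5) show ?thesis
    by (induction rule: presented_group_induct) (auto simp: assms(4))
qed

definition word_val :: "('b, 'm) monoid_scheme \<Rightarrow> ('a \<Rightarrow> 'b) \<Rightarrow> 'a word \<Rightarrow> 'b" where
  "word_val H h w = foldr (\<lambda>(a, b) y. (if b then h a else inv\<^bsub>H\<^esub> (h a)) \<otimes>\<^bsub>H\<^esub> y) w \<one>\<^bsub>H\<^esub>"

lemma word_val_simps [simp]:
  "word_val H h [] = \<one>\<^bsub>H\<^esub>"
  "word_val H h ((a, True) # w) = h a \<otimes>\<^bsub>H\<^esub> word_val H h w"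
  "word_val H h ((a, False) # w) = inv\<^bsub>H\<^esub> (h a) \<otimes>\<^bsub>H\<^esub> word_val H h w"
  by (simp_all add: word_val_def)

text \<open>Substituting \<open>h\<close> into words turns concatenation into multiplication and respects the
  cancellation of letters in every group. So it is constant on the classes of words once it
  respects the defining relations.\<close>

lemma presented_group_universal:
  assumes "group H" and h: "\<And>a. a \<in> X \<Longrightarrow> h a \<in> carrier H"
    and rels: "\<And>u v. (u, v) \<in> R \<Longrightarrow> u \<in> words X \<Longrightarrow> v \<in> words X \<Longrightarrow> word_val H h u = word_val H h v"
  obtains \<phi> where "\<phi> \<in> hom (presented_group X R) H"
    "\<phi> \<in> extensional (carrier (presented_group X R))"
    "\<And>a. a \<in> X \<Longrightarrow> \<phi> (word_class X R [(a, True)]) = h a"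
proof -
  interpret H: group H by fact
  have closed: "word_val H h w \<in> carrier H" if "w \<in> words X" for w
    using that
  proof (induction w)
    case (Cons p w)
    then show ?case by (cases p; cases "snd p") (auto simp: h)
  qed auto
  have app: "word_val H h (u @ v) = word_val H h u \<otimes>\<^bsub>H\<^esub> word_val H h v"
    if "u \<in> words X" "v \<in> words X" for u v
    using that
  proof (induction u)
    case (Cons p u)
    then show ?case by (cases p; cases "snd p") (auto simp: h closed H.m_assoc)
  qed (auto simp: closed)
  have eq: "word_val H h u = word_val H h v" if "word_eq X R u v" for u v
    using that
  proof (induction rule: word_eq.induct)
    case (append u v u' v')
    then show ?case by (auto simp: app dest!: word_eq_words)
  next
    case (cancel a b)
    then show ?case by (cases b) (auto simp: h)
  qed (auto simp: rels)
  define \<phi> where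
    "\<phi> = (\<lambda>A\<in>carrier (presented_group X R). word_val H h (SOME w. w \<in> A))"
  have val: "\<phi> (word_class X R w) = word_val H h w" if "w \<in> words X" for w
  proof -
    have "(SOME v. v \<in> word_class X R w) \<in> word_class X R w"
      using word_class_self[OF that] by (rule someI)
    then show ?thesis
      using that by (auto simp: \<phi>_def presented_group_simps word_class_def dest!: eq)
  qed
  show thesis
  proof
    show "\<phi> \<in> hom (presented_group X R) H"
      by (auto simp: hom_def presented_group_simps val closed presented_group_mult app)
    show "\<phi> \<in> extensional (carrier (presented_group X R))" by (simp add: \<phi>_def)
    show "\<phi> (word_class X R [(a, True)]) = h a" if "a \<in> X" for a
      using that by (simp add: val h)
  qed
qed

lemma group_free_group: "group (free_group n)"
  unfolding free_group_def by (rule group_presented_group)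

lemma group_braid_group: "group (braid_group n)"
  unfolding braid_group_def by (rule group_presented_group)

lemma fgen_carrier [simp]: "i \<in> {1..n} \<Longrightarrow> fgen n i \<in> carrier (free_group n)"
  unfolding free_group_def fgen_def by simp

lemma bgen_carrier [simp]: "i \<in> {1..n - 1} \<Longrightarrow> bgen n i \<in> carrier (braid_group n)"
  unfolding braid_group_def bgen_def by (rule word_class_generator_carrier)

lemmas free_group_induct [consumes 1, case_names one gen inv] =
  presented_group_induct[of _ "{1..n::nat}" "{}", folded free_group_def fgen_def] for n

lemmas free_group_hom_eq =
  presented_group_hom_eq[of _ _ "{1..n::nat}" "{}", folded free_group_def fgen_def] for n

lemmas braid_group_induct [consumes 1, case_names one gen inv] =
  presented_group_induct[of _ "{1..n - 1::nat}" "braid_rels n", folded braid_group_def bgen_def] for n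

lemmas braid_group_hom_eq =
  presented_group_hom_eq[of _ _ "{1..n - 1::nat}" "braid_rels n", folded braid_group_def bgen_def] for n

lemma free_group_universal:
  assumes "group H" "\<And>i. i \<in> {1..n} \<Longrightarrow> h i \<in> carrier H"
  obtains \<phi> where "\<phi> \<in> hom (free_group n) H" "\<phi> \<in> extensional (carrier (free_group n))"
    "\<And>i. i \<in> {1..n} \<Longrightarrow> \<phi> (fgen n i) = h i"
  using presented_group_universal[of H "{1..n}" h "{}"] assms
  unfolding free_group_def fgen_def by auto

section \<open>The braid group acting on the free group\<close>

lemma (in group) inv_cancel_left [simp]:
  "x \<in> carrier G \<Longrightarrow> y \<in> carrier G \<Longrightarrow> inv x \<otimes> (x \<otimes> y) = y"
  "x \<in> carrier G \<Longrightarrow> y \<in> carrier G \<Longrightarrow> x \<otimes> (inv x \<otimes> y) = y"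
  by (simp_all flip: m_assoc)

lemma auto_iff_bij:
  "s \<in> auto (free_group n) \<longleftrightarrow> s \<in> hom (free_group n) (free_group n) \<and>
     s \<in> extensional (carrier (free_group n)) \<and>
     bij_betw s (carrier (free_group n)) (carrier (free_group n))"
  by (auto simp: auto_def Bij_def)

text \<open>The endomorphism of the free group that is prescribed on the generators is invertible
  because \<open>x\<^sub>i \<mapsto> x\<^sub>i x\<^sub>i\<^sub>+\<^sub>1 x\<^sub>i\<^sup>-\<^sup>1\<close> and \<open>x\<^sub>i\<^sub>+\<^sub>1 \<mapsto> x\<^sub>i\<close> defines an inverse on generators.\<close>

lemma ex_artin_generator:
  assumes i: "i \<in> {1..n - 1}"
  shows "\<exists>s\<in>auto (free_group n).
    s (fgen n i) = fgen n (i + 1) \<and>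
    s (fgen n (i + 1)) =
      inv\<^bsub>free_group n\<^esub> (fgen n (i + 1)) \<otimes>\<^bsub>free_group n\<^esub> fgen n i \<otimes>\<^bsub>free_group n\<^esub> fgen n (i + 1) \<and>
    (\<forall>j\<in>{1..n} - {i, i + 1}. s (fgen n j) = fgen n j)"
proof -
  let ?F = "free_group n" and ?a = "fgen n i" and ?b = "fgen n (i + 1)"
  interpret group ?F by (rule group_free_group)
  have ab: "?a \<in> carrier ?F" "?b \<in> carrier ?F" using i by auto
  obtain s where s: "s \<in> hom ?F ?F" "s \<in> extensional (carrier ?F)"
    "\<And>j. j \<in> {1..n} \<Longrightarrow> s (fgen n j) =
       (if j = i then ?b else if j = i + 1 then inv\<^bsub>?F\<^esub> ?b \<otimes>\<^bsub>?F\<^esub> ?a \<otimes>\<^bsub>?F\<^esub> ?b else fgen n j)"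
    by (rule free_group_universal[of ?F n "\<lambda>j. if j = i then ?b
          else if j = i + 1 then inv\<^bsub>?F\<^esub> ?b \<otimes>\<^bsub>?F\<^esub> ?a \<otimes>\<^bsub>?F\<^esub> ?b else fgen n j"])
      (use ab is_group in auto)
  obtain t where t: "t \<in> hom ?F ?F" "t \<in> extensional (carrier ?F)"
    "\<And>j. j \<in> {1..n} \<Longrightarrow> t (fgen n j) =
       (if j = i then ?a \<otimes>\<^bsub>?F\<^esub> ?b \<otimes>\<^bsub>?F\<^esub> inv\<^bsub>?F\<^esub> ?a else if j = i + 1 then ?a else fgen n j)"
    by (rule free_group_universal[of ?F n "\<lambda>j. if j = i then ?a \<otimes>\<^bsub>?F\<^esub> ?b \<otimes>\<^bsub>?F\<^esub> inv\<^bsub>?F\<^esub> ?a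
          else if j = i + 1 then ?a else fgen n j"])
      (use ab is_group in auto)
  interpret s: group_hom ?F ?F s using s by (unfold_locales) auto
  interpret t: group_hom ?F ?F t using t by (unfold_locales) auto
  have i1: "i \<in> {1..n}" "i + 1 \<in> {1..n}" using i by auto
  note v = s(3)[OF i1(1)] s(3)[OF i1(2)] t(3)[OF i1(1)] t(3)[OF i1(2)]
  have gens: "s (t (fgen n j)) = fgen n j \<and> t (s (fgen n j)) = fgen n j" if "j \<in> {1..n}" for j
    using v ab that by (auto simp: s(3) t(3) m_assoc inv_mult_group)
  have "s (t x) = x" if "x \<in> carrier ?F" for x
    using free_group_hom_eq[OF is_group Group.hom_compose[OF t(1) s(1), unfolded comp_def], of "\<lambda>x. x" x] that gens
    by (auto simp: hom_def)
  moreover have "t (s x) = x" if "x \<in> carrier ?F" for x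
    using free_group_hom_eq[OF is_group Group.hom_compose[OF s(1) t(1), unfolded comp_def], of "\<lambda>x. x" x] that gens
    by (auto simp: hom_def)
  ultimately have "bij_betw s (carrier ?F) (carrier ?F)"
    by (intro bij_betw_byWitness[of _ t]) auto
  then have "s \<in> auto ?F" using s by (simp add: auto_iff_bij)
  then show ?thesis using i by (intro bexI[of _ s]) (auto simp: s(3))
qed

text \<open>An automorphism of the free group is determined by its values on the generators. Hence the
  braid relations, which are what existence requires, are verified there, and uniqueness follows
  as well.\<close>

lemma ex1_artin_hom: "\<exists>!\<theta>. is_artin_hom n \<theta>"
proof (rule ex_ex1I)
  let ?F = "free_group n" and ?A = "AutoGroup (free_group n)" and ?x = "fgen n"
  interpret group ?F by (rule group_free_group)
  interpret A: group ?A by (rule AutoGroup)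
  obtain s where s: "\<And>i. i \<in> {1..n - 1} \<Longrightarrow> s i \<in> auto ?F"
    "\<And>i. i \<in> {1..n - 1} \<Longrightarrow> s i (?x i) = ?x (i + 1)"
    "\<And>i. i \<in> {1..n - 1} \<Longrightarrow> s i (?x (i + 1)) = inv\<^bsub>?F\<^esub> ?x (i + 1) \<otimes>\<^bsub>?F\<^esub> ?x i \<otimes>\<^bsub>?F\<^esub> ?x (i + 1)"
    "\<And>i j. i \<in> {1..n - 1} \<Longrightarrow> j \<in> {1..n} - {i, i + 1} \<Longrightarrow> s i (?x j) = ?x j"
    using ex_artin_generator[of _ n] by metis
  have carrier_A: "carrier ?A = auto ?F" by (simp add: AutoGroup_def)
  have mult_A: "f \<otimes>\<^bsub>?A\<^esub> g = compose (carrier ?F) f g" if "f \<in> auto ?F" "g \<in> auto ?F" for f g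
    using that by (auto simp: AutoGroup_def BijGroup_def auto_def)
  have hom_s: "group_hom ?F ?F (s i)" if "i \<in> {1..n - 1}" for i
    using s(1)[OF that] by unfold_locales (auto simp: auto_def)
  have s_closed: "s i x \<in> carrier ?F" if "i \<in> {1..n - 1}" "x \<in> carrier ?F" for i x
    using hom_s[OF that(1)] that(2) by (rule group_hom.hom_closed)
  have s_mult: "s i (x \<otimes>\<^bsub>?F\<^esub> y) = s i x \<otimes>\<^bsub>?F\<^esub> s i y"
    if "i \<in> {1..n - 1}" "x \<in> carrier ?F" "y \<in> carrier ?F" for i x y
    using hom_s[OF that(1)] that(2,3) by (rule group_hom.hom_mult)
  have s_inv: "s i (inv\<^bsub>?F\<^esub> x) = inv\<^bsub>?F\<^esub> s i x" if "i \<in> {1..n - 1}" "x \<in> carrier ?F" for i x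
    using hom_s[OF that(1)] that(2) by (rule group_hom.hom_inv)
  have auto_eqI: "f = g" if "f \<in> auto ?F" "g \<in> auto ?F" "\<And>j. j \<in> {1..n} \<Longrightarrow> f (?x j) = g (?x j)" for f g
  proof (rule extensionalityI[of _ "carrier ?F"])
    show "f x = g x" if "x \<in> carrier ?F" for x
      using that \<open>f \<in> auto ?F\<close> \<open>g \<in> auto ?F\<close> \<open>\<And>j. j \<in> {1..n} \<Longrightarrow> f (?x j) = g (?x j)\<close>
      by (intro free_group_hom_eq[OF is_group, of f n g x]) (auto simp: auto_def)
  qed (use that in \<open>auto simp: auto_def Bij_def\<close>)
  have rels: "word_val ?A s u = word_val ?A s v"
    if uv: "(u, v) \<in> braid_rels n" for u v
    using uv[unfolded braid_rels_def]
  proof (elim UnE CollectE exE conjE)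
    fix i assume uv: "(u, v) = ([(i, True), (i + 1, True), (i, True)],
        [(i + 1, True), (i, True), (i + 1, True)])" and i: "1 \<le> i" "i + 1 \<le> n - 1"
    have ii: "i \<in> {1..n - 1}" "i + 1 \<in> {1..n - 1}" "Suc i \<in> {1..n - 1}" using i by auto
    have xs: "?x i \<in> carrier ?F" "?x (Suc i) \<in> carrier ?F" "?x (Suc (Suc i)) \<in> carrier ?F"
      using i by (auto intro!: fgen_carrier)
    have "s i \<otimes>\<^bsub>?A\<^esub> (s (Suc i) \<otimes>\<^bsub>?A\<^esub> s i) = s (Suc i) \<otimes>\<^bsub>?A\<^esub> (s i \<otimes>\<^bsub>?A\<^esub> s (Suc i))"
    proof (rule auto_eqI)
      have cl: "s (Suc i) \<otimes>\<^bsub>?A\<^esub> s i \<in> auto ?F" "s i \<otimes>\<^bsub>?A\<^esub> s (Suc i) \<in> auto ?F"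
        using A.m_closed[of "s (Suc i)" "s i"] A.m_closed[of "s i" "s (Suc i)"] s(1) ii
        by (auto simp: carrier_A)
      fix j assume j: "j \<in> {1..n}"
      have e: "(s i \<otimes>\<^bsub>?A\<^esub> (s (Suc i) \<otimes>\<^bsub>?A\<^esub> s i)) (?x j) = s i (s (Suc i) (s i (?x j)))"
           "(s (Suc i) \<otimes>\<^bsub>?A\<^esub> (s i \<otimes>\<^bsub>?A\<^esub> s (Suc i))) (?x j) = s (Suc i) (s i (s (Suc i) (?x j)))"
        using j cl s(1) ii by (auto simp: mult_A compose_def s_closed)
      have v: "s i (?x i) = ?x (Suc i)" "s (Suc i) (?x (Suc i)) = ?x (Suc (Suc i))"
        "s i (?x (Suc i)) = inv\<^bsub>?F\<^esub> ?x (Suc i) \<otimes>\<^bsub>?F\<^esub> ?x i \<otimes>\<^bsub>?F\<^esub> ?x (Suc i)"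
        "s (Suc i) (?x (Suc (Suc i))) = inv\<^bsub>?F\<^esub> ?x (Suc (Suc i)) \<otimes>\<^bsub>?F\<^esub> ?x (Suc i) \<otimes>\<^bsub>?F\<^esub> ?x (Suc (Suc i))"
        "s i (?x (Suc (Suc i))) = ?x (Suc (Suc i))" "s (Suc i) (?x i) = ?x i"
        using s(2)[OF ii(1)] s(2)[OF ii(2)] s(3)[OF ii(1)] s(3)[OF ii(2)]
          s(4)[OF ii(1), of "Suc (Suc i)"] s(4)[OF ii(2), of i] i by auto
      consider "j = i" | "j = Suc i" | "j = Suc (Suc i)" | "j \<notin> {i, Suc i, Suc (Suc i)}" by auto
      then show "(s i \<otimes>\<^bsub>?A\<^esub> (s (Suc i) \<otimes>\<^bsub>?A\<^esub> s i)) (?x j) =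
          (s (Suc i) \<otimes>\<^bsub>?A\<^esub> (s i \<otimes>\<^bsub>?A\<^esub> s (Suc i))) (?x j)"
      proof cases
        case 4
        then show ?thesis unfolding e using s(4)[OF ii(1), of j] s(4)[OF ii(2), of j] j by auto
      qed (unfold e, use xs ii in \<open>simp_all add: v s_mult s_inv s_closed m_assoc inv_mult_group\<close>)
    next
      show "s i \<otimes>\<^bsub>?A\<^esub> (s (Suc i) \<otimes>\<^bsub>?A\<^esub> s i) \<in> auto ?F"
        "s (Suc i) \<otimes>\<^bsub>?A\<^esub> (s i \<otimes>\<^bsub>?A\<^esub> s (Suc i)) \<in> auto ?F"
        using A.m_closed s(1) ii unfolding carrier_A by (meson)+
    qed
    then show ?thesis using uv s(1) ii by (auto simp: carrier_A)
  next
    fix i j assume uv: "(u, v) = ([(i, True), (j, True)], [(j, True), (i, True)])"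
      and ij: "1 \<le> i" "i + 2 \<le> j" "j \<le> n - 1"
    have ii: "i \<in> {1..n - 1}" "j \<in> {1..n - 1}" using ij by auto
    have xs: "?x i \<in> carrier ?F" "?x (Suc i) \<in> carrier ?F" "?x j \<in> carrier ?F" "?x (Suc j) \<in> carrier ?F"
      using ij by (auto intro!: fgen_carrier)
    have "s i \<otimes>\<^bsub>?A\<^esub> s j = s j \<otimes>\<^bsub>?A\<^esub> s i"
    proof (rule auto_eqI)
      fix k assume k: "k \<in> {1..n}"
      have v: "s i (?x i) = ?x (Suc i)" "s j (?x j) = ?x (Suc j)"
        "s i (?x (Suc i)) = inv\<^bsub>?F\<^esub> ?x (Suc i) \<otimes>\<^bsub>?F\<^esub> ?x i \<otimes>\<^bsub>?F\<^esub> ?x (Suc i)"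
        "s j (?x (Suc j)) = inv\<^bsub>?F\<^esub> ?x (Suc j) \<otimes>\<^bsub>?F\<^esub> ?x j \<otimes>\<^bsub>?F\<^esub> ?x (Suc j)"
        "s i (?x j) = ?x j" "s i (?x (Suc j)) = ?x (Suc j)"
        "s j (?x i) = ?x i" "s j (?x (Suc i)) = ?x (Suc i)"
        using s(2)[OF ii(1)] s(2)[OF ii(2)] s(3)[OF ii(1)] s(3)[OF ii(2)]
          s(4)[OF ii(1), of j] s(4)[OF ii(1), of "Suc j"]
          s(4)[OF ii(2), of i] s(4)[OF ii(2), of "Suc i"] ij by auto
      have e: "(s i \<otimes>\<^bsub>?A\<^esub> s j) (?x k) = s i (s j (?x k))" "(s j \<otimes>\<^bsub>?A\<^esub> s i) (?x k) = s j (s i (?x k))"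
        using k s(1) ii by (auto simp: mult_A compose_def)
      consider "k = i" | "k = Suc i" | "k = j" | "k = Suc j" | "k \<notin> {i, Suc i, j, Suc j}" by auto
      then show "(s i \<otimes>\<^bsub>?A\<^esub> s j) (?x k) = (s j \<otimes>\<^bsub>?A\<^esub> s i) (?x k)"
      proof cases
        case 5
        then show ?thesis unfolding e using s(4)[OF ii(1), of k] s(4)[OF ii(2), of k] k by auto
      qed (unfold e, use xs ii in \<open>simp_all add: v s_mult s_inv s_closed m_assoc inv_mult_group\<close>)
    qed (use A.m_closed s(1) ii in \<open>auto simp: carrier_A\<close>)
    then show ?thesis using uv s(1) ii by (auto simp: carrier_A)
  qed
  obtain \<theta> where "\<theta> \<in> hom (braid_group n) ?A" "\<theta> \<in> extensional (carrier (braid_group n))"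
    "\<And>i. i \<in> {1..n - 1} \<Longrightarrow> \<theta> (bgen n i) = s i"
    by (rule presented_group_universal[OF A.is_group, of "{1..n - 1}" s "braid_rels n",
          folded braid_group_def bgen_def]) (use s(1) rels in \<open>auto simp: carrier_A\<close>)
  then show "\<exists>\<theta>. is_artin_hom n \<theta>"
    using s(2,3,4) by (intro exI[of _ \<theta>]) (simp add: is_artin_hom_def)
  fix \<theta> \<theta>' assume t: "is_artin_hom n \<theta>" "is_artin_hom n \<theta>'"
  have gen: "\<theta> (bgen n i) = \<theta>' (bgen n i)" if i: "i \<in> {1..n - 1}" for i
  proof (rule auto_eqI)
    show "\<theta> (bgen n i) \<in> auto ?F" "\<theta>' (bgen n i) \<in> auto ?F"
      using t bgen_carrier[OF i] unfolding is_artin_hom_def by (auto simp: carrier_A dest: hom_in_carrier)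
    fix j assume "j \<in> {1..n}"
    then consider "j = i" | "j = i + 1" | "j \<in> {1..n} - {i, i + 1}" by blast
    then show "\<theta> (bgen n i) (?x j) = \<theta>' (bgen n i) (?x j)"
      using t i unfolding is_artin_hom_def by cases (simp_all only:)
  qed
  have hom: "\<theta> \<in> hom (braid_group n) ?A" "\<theta>' \<in> hom (braid_group n) ?A"
    and ext: "\<theta> \<in> extensional (carrier (braid_group n))" "\<theta>' \<in> extensional (carrier (braid_group n))"
    using t unfolding is_artin_hom_def by blast+
  show "\<theta> = \<theta>'"
  proof (rule extensionalityI[OF ext])
    show "\<theta> b = \<theta>' b" if "b \<in> carrier (braid_group n)" for b
      by (rule braid_group_hom_eq[OF A.is_group hom gen that])
  qed
qed

lemma is_artin_hom_artin_hom: "is_artin_hom n (artin_hom n)"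
  unfolding artin_hom_def using ex1_artin_hom by (rule theI')

lemma artin_representation_braid_group: "artin_representation n (braid_group n) (artin_hom n)"
  using is_artin_hom_artin_hom[of n] group_braid_group
  by (auto simp: artin_representation_def is_artin_hom_def hom_def intro!: bexI[of _ "\<lambda>x. x"])

section \<open>Group rings\<close>

text \<open>The value at \<open>a\<close> of the linear extension of \<open>F\<close>. Elements of the group ring are compared by
  means of these functionals: a product \<open>a b\<close> is sent to an iterated sum over \<open>a\<close> and \<open>b\<close>, so that
  associativity of the group passes to the group ring without rearranging convolutions.\<close>

definition gr_sum :: "('g \<Rightarrow> 'k::field) \<Rightarrow> ('g \<Rightarrow> 'k) \<Rightarrow> 'k" where
  "gr_sum a F = (\<Sum>g | a g \<noteq> 0. a g * F g)"

abbreviation finsupp :: "('g \<Rightarrow> 'k::field) \<Rightarrow> bool" where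
  "finsupp a \<equiv> finite {g. a g \<noteq> 0}"

lemma gr_sum_superset:
  "finite S \<Longrightarrow> {g. a g \<noteq> 0} \<subseteq> S \<Longrightarrow> gr_sum a F = (\<Sum>g\<in>S. a g * F g)"
  unfolding gr_sum_def by (rule sum.mono_neutral_left) auto

text \<open>Indicator functions of points recover the coefficients.\<close>

lemma gr_eqI:
  fixes a b :: "'g \<Rightarrow> 'k::field"
  assumes "finsupp a" "finsupp b" "\<And>F. gr_sum a F = gr_sum b F"
  shows "a = b"
proof
  fix x :: 'g
  let ?F = "\<lambda>y. if y = x then 1 else 0"
  have *: "gr_sum c ?F = c x" if "finsupp c" for c :: "'g \<Rightarrow> 'k"
  proof -
    have "gr_sum c ?F = (\<Sum>g | c g \<noteq> 0. if g = x then c g else 0)"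
      unfolding gr_sum_def by (rule sum.cong) auto
    then show ?thesis using that by (simp add: sum.delta)
  qed
  show "a x = b x" using assms(3)[of ?F] by (simp add: * assms(1,2))
qed

lemma gr_sum_cong: "(\<And>g. a g \<noteq> 0 \<Longrightarrow> F g = F' g) \<Longrightarrow> gr_sum a F = gr_sum a F'"
  unfolding gr_sum_def by (rule sum.cong) auto

lemma gr_sum_cmult [simp]: "gr_sum a (\<lambda>x. c * F x) = c * gr_sum a F"
  and gr_sum_multc [simp]: "gr_sum a (\<lambda>x. F x * c) = gr_sum a F * c"
  and gr_sum_addF [simp]: "gr_sum a (\<lambda>x. F x + F' x) = gr_sum a F + gr_sum a F'"
  and gr_sum_zeroF [simp]: "gr_sum a (\<lambda>x. 0) = 0"
  unfolding gr_sum_def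
  by (simp_all add: sum_distrib_left sum_distrib_right sum.distrib algebra_simps)

lemma gr_sum_swap:
  "gr_sum a (\<lambda>x. gr_sum b (\<lambda>y. F x y)) = gr_sum b (\<lambda>y. gr_sum a (\<lambda>x. F x y))"
  unfolding gr_sum_def sum_distrib_left
  by (subst sum.swap) (simp add: mult.left_commute)

lemma finsupp_add [simp]: "finsupp a \<Longrightarrow> finsupp b \<Longrightarrow> finsupp (\<lambda>x. a x + b x)"
  by (rule finite_subset[of _ "{x. a x \<noteq> 0} \<union> {x. b x \<noteq> 0}"]) auto

lemma finsupp_scale [simp]: "finsupp a \<Longrightarrow> finsupp (gr_scale c a)"
  unfolding gr_scale_def by (rule finite_subset[of _ "{x. a x \<noteq> 0}"]) auto

lemma finsupp_single [simp]: "finsupp (gr_single c g)"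
  unfolding gr_single_def by (rule finite_subset[of _ "{g}"]) auto

lemma gr_sum_add [simp]:
  assumes "finsupp a" "finsupp b"
  shows "gr_sum (\<lambda>x. a x + b x) F = gr_sum a F + gr_sum b F"
proof -
  let ?S = "{x. a x \<noteq> 0} \<union> {x. b x \<noteq> 0}"
  have "gr_sum c F = (\<Sum>g\<in>?S. c g * F g)" if "{x. c x \<noteq> 0} \<subseteq> ?S" for c
    using that assms by (intro gr_sum_superset) auto
  note this[of a] this[of b] this[of "\<lambda>x. a x + b x"]
  moreover have "{x. a x + b x \<noteq> 0} \<subseteq> ?S" by auto
  ultimately show ?thesis by (simp add: sum.distrib algebra_simps)
qed

lemma gr_sum_scale [simp]:
  assumes "finsupp a"
  shows "gr_sum (gr_scale c a) F = c * gr_sum a F"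
  using assms gr_sum_superset[of "{x. a x \<noteq> 0}" "gr_scale c a" F]
  by (simp add: gr_scale_def gr_sum_def sum_distrib_left mult.assoc) (auto simp: Collect_mono_iff)

lemma gr_sum_single [simp]: "gr_sum (gr_single c g) F = c * F g"
proof -
  have "{x. gr_single c g x \<noteq> 0} \<subseteq> {g}" by (auto simp: gr_single_def)
  then show ?thesis using gr_sum_superset[of "{g}" "gr_single c g" F] by (simp add: gr_single_def)
qed

lemma gr_sum_0 [simp]: "gr_sum (\<lambda>x. 0) F = 0"
  by (simp add: gr_sum_def)

lemma
  shows gr_carrier: "a \<in> carrier (group_ring G) \<longleftrightarrow> finsupp a \<and> {g. a g \<noteq> 0} \<subseteq> carrier G"
    and gr_add: "a \<oplus>\<^bsub>group_ring G\<^esub> b = (\<lambda>x. a x + b x)"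
    and gr_zero: "\<zero>\<^bsub>group_ring G\<^esub> = (\<lambda>x. 0)"
    and gr_one: "\<one>\<^bsub>group_ring G\<^esub> = gr_single 1 \<one>\<^bsub>G\<^esub>"
  by (auto simp: group_ring_def gr_single_def)

lemma gr_finsupp: "a \<in> carrier (group_ring G) \<Longrightarrow> finsupp a"
  by (simp add: gr_carrier)

lemma gr_single_carrier [simp]: "g \<in> carrier G \<Longrightarrow> gr_single c g \<in> carrier (group_ring G)"
  unfolding gr_carrier by (auto simp: gr_single_def split: if_splits)

lemma gr_scale_carrier [simp]: "a \<in> carrier (group_ring G) \<Longrightarrow> gr_scale c a \<in> carrier (group_ring G)"
  unfolding gr_carrier using finsupp_scale[of a c] by (auto simp: gr_scale_def)

lemma gr_add_carrier:
  "a \<in> carrier (group_ring G) \<Longrightarrow> b \<in> carrier (group_ring G) \<Longrightarrow>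
   (\<lambda>x. a x + b x) \<in> carrier (group_ring G)" (is "_ \<Longrightarrow> _ \<Longrightarrow> ?thesis")
proof -
  assume "a \<in> carrier (group_ring G)" "b \<in> carrier (group_ring G)"
  then have ab: "finsupp a" "finsupp b" "{g. a g \<noteq> 0} \<subseteq> carrier G" "{g. b g \<noteq> 0} \<subseteq> carrier G"
    by (simp_all add: gr_carrier)
  have "{g. a g + b g \<noteq> 0} \<subseteq> {g. a g \<noteq> 0} \<union> {g. b g \<noteq> 0}" by auto
  then show ?thesis using ab finsupp_add[OF ab(1,2)] unfolding gr_carrier by blast
qed

lemma
  assumes "finsupp a" "finsupp b"
  shows finsupp_mult: "finsupp (a \<otimes>\<^bsub>group_ring G\<^esub> b)"
    and gr_mult_supp: "(a \<otimes>\<^bsub>group_ring G\<^esub> b) x \<noteq> 0 \<Longrightarrow> \<exists>g h. a g \<noteq> 0 \<and> b h \<noteq> 0 \<and> x = g \<otimes>\<^bsub>G\<^esub> h"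
    and gr_sum_mult: "gr_sum (a \<otimes>\<^bsub>group_ring G\<^esub> b) F = gr_sum a (\<lambda>g. gr_sum b (\<lambda>h. F (g \<otimes>\<^bsub>G\<^esub> h)))"
proof -
  let ?A = "{g. a g \<noteq> 0}" and ?B = "{h. b h \<noteq> 0}" and ?m = "\<lambda>(g, h). g \<otimes>\<^bsub>G\<^esub> h"
  have ab: "(a \<otimes>\<^bsub>group_ring G\<^esub> b) x = (\<Sum>p | p \<in> ?A \<times> ?B \<and> ?m p = x. a (fst p) * b (snd p))" for x
    by (auto simp: group_ring_def case_prod_beta intro!: sum.cong)
  show *: "\<exists>g h. a g \<noteq> 0 \<and> b h \<noteq> 0 \<and> x = g \<otimes>\<^bsub>G\<^esub> h" if "(a \<otimes>\<^bsub>group_ring G\<^esub> b) x \<noteq> 0" for x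
    by (rule sum.not_neutral_contains_not_neutral[OF that[unfolded ab]]) auto
  have sub: "{x. (a \<otimes>\<^bsub>group_ring G\<^esub> b) x \<noteq> 0} \<subseteq> ?m ` (?A \<times> ?B)"
    using * by (auto simp: image_iff)
  then show "finsupp (a \<otimes>\<^bsub>group_ring G\<^esub> b)"
    using assms by (auto intro: finite_subset)
  have "gr_sum (a \<otimes>\<^bsub>group_ring G\<^esub> b) F =
      (\<Sum>x\<in>?m ` (?A \<times> ?B). (a \<otimes>\<^bsub>group_ring G\<^esub> b) x * F x)"
    using assms sub by (intro gr_sum_superset) auto
  also have "\<dots> = (\<Sum>x\<in>?m ` (?A \<times> ?B). \<Sum>p | p \<in> ?A \<times> ?B \<and> ?m p = x. a (fst p) * b (snd p) * F (?m p))"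
    unfolding ab sum_distrib_right by (intro sum.cong) auto
  also have "\<dots> = (\<Sum>p\<in>?A \<times> ?B. a (fst p) * b (snd p) * F (?m p))"
    using assms by (subst sum.group[of "?A \<times> ?B" "?m ` (?A \<times> ?B)" ?m]) auto
  also have "\<dots> = gr_sum a (\<lambda>g. gr_sum b (\<lambda>h. F (g \<otimes>\<^bsub>G\<^esub> h)))"
    by (simp add: gr_sum_def sum.cartesian_product sum_distrib_left case_prod_beta mult.assoc)
  finally show "gr_sum (a \<otimes>\<^bsub>group_ring G\<^esub> b) F = gr_sum a (\<lambda>g. gr_sum b (\<lambda>h. F (g \<otimes>\<^bsub>G\<^esub> h)))" .
qed

lemma gr_mult_carrier:
  assumes "group G" "a \<in> carrier (group_ring G)" "b \<in> carrier (group_ring G)"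
  shows "a \<otimes>\<^bsub>group_ring G\<^esub> b \<in> carrier (group_ring G)"
  using assms finsupp_mult[of a b G] gr_mult_supp[of a b G]
  by (auto simp: gr_carrier) (metis (mono_tags, lifting) mem_Collect_eq subsetD group.is_monoid monoid.m_closed)

lemma ring_group_ring:
  assumes "group G"
  shows "ring (group_ring G :: ('g \<Rightarrow> 'k::field) ring)"
proof -
  interpret group G by fact
  let ?R = "group_ring G :: ('g \<Rightarrow> 'k) ring"
  have supp: "a g \<noteq> 0 \<Longrightarrow> g \<in> carrier G" if "a \<in> carrier ?R" for a g
    using that by (auto simp: gr_carrier)
  show ?thesis
  proof (rule ringI)
    show "abelian_group ?R"
    proof (rule abelian_groupI)
      fix a assume "a \<in> carrier ?R"
      then show "\<exists>b\<in>carrier ?R. b \<oplus>\<^bsub>?R\<^esub> a = \<zero>\<^bsub>?R\<^esub>"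
        by (intro bexI[of _ "gr_scale (- 1) a"] gr_scale_carrier) (auto simp: gr_add gr_zero gr_scale_def)
    next
      show "\<zero>\<^bsub>?R\<^esub> \<in> carrier ?R" by (simp add: gr_zero gr_carrier)
    qed (auto simp: gr_add gr_zero gr_add_carrier algebra_simps)
    show "monoid ?R"
    proof (rule monoidI)
      fix a b c assume abc: "a \<in> carrier ?R" "b \<in> carrier ?R" "c \<in> carrier ?R"
      then have "finsupp a" "finsupp b" "finsupp c" by (auto simp: gr_carrier)
      with abc show "a \<otimes>\<^bsub>?R\<^esub> b \<otimes>\<^bsub>?R\<^esub> c = a \<otimes>\<^bsub>?R\<^esub> (b \<otimes>\<^bsub>?R\<^esub> c)"
        by (intro gr_eqI finsupp_mult)
          (auto simp: gr_sum_mult finsupp_mult supp m_assoc intro!: gr_sum_cong)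
    next
      fix a assume a: "a \<in> carrier ?R"
      show "\<one>\<^bsub>?R\<^esub> \<otimes>\<^bsub>?R\<^esub> a = a" "a \<otimes>\<^bsub>?R\<^esub> \<one>\<^bsub>?R\<^esub> = a"
        using gr_finsupp[OF a] a unfolding gr_one
        by (auto intro!: gr_eqI finsupp_mult gr_sum_cong simp: gr_sum_mult supp)
    qed (auto simp: gr_mult_carrier gr_one assms)
    fix a b c assume abc: "a \<in> carrier ?R" "b \<in> carrier ?R" "c \<in> carrier ?R"
    then have "finsupp a" "finsupp b" "finsupp c" by (auto simp: gr_carrier)
    with abc show "(a \<oplus>\<^bsub>?R\<^esub> b) \<otimes>\<^bsub>?R\<^esub> c = a \<otimes>\<^bsub>?R\<^esub> c \<oplus>\<^bsub>?R\<^esub> b \<otimes>\<^bsub>?R\<^esub> c"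
      "c \<otimes>\<^bsub>?R\<^esub> (a \<oplus>\<^bsub>?R\<^esub> b) = c \<otimes>\<^bsub>?R\<^esub> a \<oplus>\<^bsub>?R\<^esub> c \<otimes>\<^bsub>?R\<^esub> b"
      unfolding gr_add
      by (auto intro!: gr_eqI finsupp_mult finsupp_add simp: gr_sum_mult finsupp_mult)
  qed
qed

lemma gr_minus:
  assumes "group G" "b \<in> carrier (group_ring G)"
  shows "a \<ominus>\<^bsub>group_ring G\<^esub> b = (\<lambda>x. a x - b x)"
    and "\<ominus>\<^bsub>group_ring G\<^esub> b = gr_scale (- 1) b"
proof -
  interpret ring "group_ring G" using ring_group_ring[OF assms(1)] .
  show *: "\<ominus>\<^bsub>group_ring G\<^esub> b = gr_scale (- 1) b"
    using assms(2) by (intro minus_equality) (simp_all, auto simp: gr_add gr_zero gr_scale_def)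
  show "a \<ominus>\<^bsub>group_ring G\<^esub> b = (\<lambda>x. a x - b x)"
    unfolding a_minus_def * by (auto simp: gr_add gr_scale_def)
qed

lemma gr_single_mult [simp]:
  "gr_single c g \<otimes>\<^bsub>group_ring G\<^esub> gr_single d h = gr_single (c * d) (g \<otimes>\<^bsub>G\<^esub> h)"
  by (intro gr_eqI finsupp_mult finsupp_single) (simp add: gr_sum_mult)

lemma gr_scale_single [simp]: "gr_scale c (gr_single d g) = gr_single (c * d) g"
  by (auto simp: gr_scale_def gr_single_def)

lemma gr_scale_scale [simp]: "gr_scale c (gr_scale d a) = gr_scale (c * d) a"
  by (auto simp: gr_scale_def)

lemma gr_scale_one [simp]: "gr_scale 1 a = a"
  by (auto simp: gr_scale_def)

lemma gr_scale_mult: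
  assumes "finsupp a" "finsupp b"
  shows "gr_scale c a \<otimes>\<^bsub>group_ring G\<^esub> b = gr_scale c (a \<otimes>\<^bsub>group_ring G\<^esub> b)"
    and "a \<otimes>\<^bsub>group_ring G\<^esub> gr_scale c b = gr_scale c (a \<otimes>\<^bsub>group_ring G\<^esub> b)"
  using assms by (auto intro!: gr_eqI finsupp_mult finsupp_scale simp: gr_sum_mult finsupp_mult)

lemma gr_scale_eq_mult:
  assumes "group G" "a \<in> carrier (group_ring G)"
  shows "a \<otimes>\<^bsub>group_ring G\<^esub> gr_single c \<one>\<^bsub>G\<^esub> = gr_scale c a"
    and "gr_single c \<one>\<^bsub>G\<^esub> \<otimes>\<^bsub>group_ring G\<^esub> a = gr_scale c a"
proof -
  interpret group G by fact
  have fs: "finsupp a" and supp: "\<And>g. a g \<noteq> 0 \<Longrightarrow> g \<in> carrier G"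
    using assms by (auto simp: gr_carrier)
  show "a \<otimes>\<^bsub>group_ring G\<^esub> gr_single c \<one>\<^bsub>G\<^esub> = gr_scale c a"
    "gr_single c \<one>\<^bsub>G\<^esub> \<otimes>\<^bsub>group_ring G\<^esub> a = gr_scale c a"
    using fs by (auto intro!: gr_eqI finsupp_mult finsupp_scale simp: gr_sum_mult mult.commute)
      (auto intro!: gr_sum_cong simp: supp)
qed

lemma group_ring_induct [consumes 1, case_names zero single add]:
  assumes "a \<in> carrier (group_ring G)"
    and zero: "P (\<lambda>x. 0)"
    and single: "\<And>c g. c \<noteq> 0 \<Longrightarrow> g \<in> carrier G \<Longrightarrow> P (gr_single c g)"
    and add: "\<And>a b. a \<in> carrier (group_ring G) \<Longrightarrow> b \<in> carrier (group_ring G) \<Longrightarrow> P a \<Longrightarrow> P b \<Longrightarrow>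
      P (\<lambda>x. a x + b x)"
  shows "P a"
proof -
  have "finite S \<Longrightarrow> a \<in> carrier (group_ring G) \<Longrightarrow> {g. a g \<noteq> 0} \<subseteq> S \<Longrightarrow> P a" for S
  proof (induction S arbitrary: a rule: finite_induct)
    case empty
    then have "a = (\<lambda>x. 0)" by auto
    then show ?case using zero by simp
  next
    case (insert g S)
    let ?b = "\<lambda>x. if x = g then 0 else a x"
    have b: "?b \<in> carrier (group_ring G)" "{x. ?b x \<noteq> 0} \<subseteq> S"
      using insert.prems by (auto simp: gr_carrier elim!: rev_finite_subset)
    have Pb: "P ?b" using b by (rule insert.IH)
    show ?case
    proof (cases "a g = 0")
      case True
      then have "?b = a" by auto
      then show ?thesis using Pb by simp
    next
      case False
      then have g: "g \<in> carrier G" using insert.prems by (auto simp: gr_carrier)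
      have "a = (\<lambda>x. gr_single (a g) g x + ?b x)" by (auto simp: gr_single_def)
      then show ?thesis using add[OF _ b(1) single[OF False g] Pb] g by simp
    qed
  qed
  from this[of "{g. a g \<noteq> 0}"] show ?thesis using assms(1) by (auto simp: gr_carrier)
qed

lemma
  assumes "finsupp a"
  shows finsupp_gr_map [simp]: "finsupp (gr_map f a)"
    and gr_sum_map [simp]: "gr_sum (gr_map f a) F = gr_sum a (\<lambda>x. F (f x))"
    and gr_map_supp: "gr_map f a y \<noteq> 0 \<Longrightarrow> \<exists>x. a x \<noteq> 0 \<and> y = f x"
proof -
  let ?A = "{g. a g \<noteq> 0}"
  show *: "\<exists>x. a x \<noteq> 0 \<and> y = f x" if "gr_map f a y \<noteq> 0" for y
    by (rule sum.not_neutral_contains_not_neutral[OF that[unfolded gr_map_def]]) auto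
  then have sub: "{y. gr_map f a y \<noteq> 0} \<subseteq> f ` ?A" by blast
  then show "finsupp (gr_map f a)" using assms by (auto intro: finite_subset)
  have "gr_sum (gr_map f a) F = (\<Sum>y\<in>f ` ?A. gr_map f a y * F y)"
    using assms sub by (intro gr_sum_superset) auto
  also have "\<dots> = (\<Sum>y\<in>f ` ?A. \<Sum>x | x \<in> ?A \<and> f x = y. a x * F (f x))"
    unfolding gr_map_def sum_distrib_right by (intro sum.cong) auto
  also have "\<dots> = gr_sum a (\<lambda>x. F (f x))"
    unfolding gr_sum_def using assms by (subst sum.group) auto
  finally show "gr_sum (gr_map f a) F = gr_sum a (\<lambda>x. F (f x))" .
qed

lemma gr_map_single [simp]: "gr_map f (gr_single c g) = gr_single c (f g)"
  by (intro gr_eqI) auto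

lemma gr_map_add:
  "finsupp a \<Longrightarrow> finsupp b \<Longrightarrow> gr_map f (\<lambda>x. a x + b x) = (\<lambda>x. gr_map f a x + gr_map f b x)"
  by (intro gr_eqI) (auto intro!: finsupp_gr_map)

lemma gr_map_scale: "finsupp a \<Longrightarrow> gr_map f (gr_scale c a) = gr_scale c (gr_map f a)"
  by (intro gr_eqI) auto

lemma gr_map_carrier [simp]:
  "f \<in> carrier G \<rightarrow> carrier H \<Longrightarrow> a \<in> carrier (group_ring G) \<Longrightarrow> gr_map f a \<in> carrier (group_ring H)"
  using finsupp_gr_map[of a f] gr_map_supp[of a f] by (fastforce simp: gr_carrier)

lemma gr_map_comp:
  assumes "finsupp a" "\<And>g. a g \<noteq> 0 \<Longrightarrow> h g = f' (f g)"
  shows "gr_map f' (gr_map f a) = gr_map h a"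
  using assms by (intro gr_eqI) (auto intro!: gr_sum_cong)

lemma gr_map_ident: "finsupp a \<Longrightarrow> (\<And>g. a g \<noteq> 0 \<Longrightarrow> f g = g) \<Longrightarrow> gr_map f a = a"
  by (intro gr_eqI) (auto intro!: gr_sum_cong)

lemma gr_map_mult:
  assumes "f \<in> hom G H" "a \<in> carrier (group_ring G)" "b \<in> carrier (group_ring G)"
  shows "gr_map f (a \<otimes>\<^bsub>group_ring G\<^esub> b) = gr_map f a \<otimes>\<^bsub>group_ring H\<^esub> gr_map f b"
proof -
  have "finsupp a" "finsupp b" "\<And>g. a g \<noteq> 0 \<Longrightarrow> g \<in> carrier G" "\<And>g. b g \<noteq> 0 \<Longrightarrow> g \<in> carrier G"
    using assms by (auto simp: gr_carrier)
  then show ?thesis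
    using assms(1) by (intro gr_eqI finsupp_mult finsupp_gr_map)
      (auto intro!: gr_sum_cong simp: gr_sum_mult finsupp_mult hom_def)
qed

section \<open>Modules over group rings\<close>

lemma abelian_group_cong:
  assumes "abelian_group A" "carrier B = carrier A" "add B = add A" "zero B = zero A"
  shows "abelian_group B"
proof -
  interpret A: abelian_group A by fact
  show ?thesis
  proof (rule abelian_groupI)
    show "\<exists>y\<in>carrier B. y \<oplus>\<^bsub>B\<^esub> x = \<zero>\<^bsub>B\<^esub>" if "x \<in> carrier B" for x
      using that by (intro bexI[of _ "\<ominus>\<^bsub>A\<^esub> x"]) (simp_all add: assms(2-) A.l_neg)
  qed (simp_all add: assms(2-) A.a_ac)
qed

lemma with_smult_simps [simp]:
  "carrier (with_smult A s) = carrier A" "add (with_smult A s) = add A"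
  "zero (with_smult A s) = zero A" "smult (with_smult A s) = s"
  by (simp_all add: with_smult_def)

lemma restrict_scalars_simps [simp]:
  "carrier (restrict_scalars i V) = carrier V" "add (restrict_scalars i V) = add V"
  "zero (restrict_scalars i V) = zero V" "smult (restrict_scalars i V) = (\<lambda>p v. i p \<odot>\<^bsub>V\<^esub> v)"
  by (simp_all add: restrict_scalars_def)

context left_module
begin

lemma smult_zero_left: "x \<in> carrier M \<Longrightarrow> \<zero> \<odot>\<^bsub>M\<^esub> x = \<zero>\<^bsub>M\<^esub>"
  using smult_l_distr[of "\<zero>" "\<zero>" x] smult_closed[of "\<zero>" x] by simp

lemma smult_zero_right: "a \<in> carrier R \<Longrightarrow> a \<odot>\<^bsub>M\<^esub> \<zero>\<^bsub>M\<^esub> = \<zero>\<^bsub>M\<^esub>"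
  using smult_r_distr[of a "\<zero>\<^bsub>M\<^esub>" "\<zero>\<^bsub>M\<^esub>"] smult_closed[of a "\<zero>\<^bsub>M\<^esub>"] by simp

end

text \<open>The data from which \<^const>\<open>linear_action\<close> makes a module over the group ring: a linear
  representation of \<open>G\<close> whose vector space structure is the separate map \<open>sc\<close>.\<close>

locale linear_rep = group G + M: abelian_group M
  for G :: "('g, 'm) monoid_scheme" (structure) and M :: "'b ring" +
  fixes sc :: "'k::field \<Rightarrow> 'b \<Rightarrow> 'b" and act :: "'g \<Rightarrow> 'b \<Rightarrow> 'b"
  assumes sc_closed: "t \<in> carrier M \<Longrightarrow> sc c t \<in> carrier M"
    and sc_add: "t \<in> carrier M \<Longrightarrow> u \<in> carrier M \<Longrightarrow> sc c (t \<oplus>\<^bsub>M\<^esub> u) = sc c t \<oplus>\<^bsub>M\<^esub> sc c u"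
    and sc_plus: "t \<in> carrier M \<Longrightarrow> sc (c + d) t = sc c t \<oplus>\<^bsub>M\<^esub> sc d t"
    and sc_mult: "t \<in> carrier M \<Longrightarrow> sc (c * d) t = sc c (sc d t)"
    and sc_one: "t \<in> carrier M \<Longrightarrow> sc 1 t = t"
    and act_closed: "g \<in> carrier G \<Longrightarrow> t \<in> carrier M \<Longrightarrow> act g t \<in> carrier M"
    and act_add: "g \<in> carrier G \<Longrightarrow> t \<in> carrier M \<Longrightarrow> u \<in> carrier M \<Longrightarrow>
       act g (t \<oplus>\<^bsub>M\<^esub> u) = act g t \<oplus>\<^bsub>M\<^esub> act g u"
    and act_sc: "g \<in> carrier G \<Longrightarrow> t \<in> carrier M \<Longrightarrow> act g (sc c t) = sc c (act g t)"
    and act_mult: "g \<in> carrier G \<Longrightarrow> h \<in> carrier G \<Longrightarrow> t \<in> carrier M \<Longrightarrow>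
       act (g \<otimes> h) t = act g (act h t)"
    and act_one: "t \<in> carrier M \<Longrightarrow> act \<one> t = t"
begin

abbreviation lact :: "('g \<Rightarrow> 'k) \<Rightarrow> 'b \<Rightarrow> 'b" where
  "lact \<equiv> linear_action M sc act"

lemma sc_zero: "t \<in> carrier M \<Longrightarrow> sc 0 t = \<zero>\<^bsub>M\<^esub>"
  using sc_plus[of t 0 0] sc_closed[of t 0] by simp

lemma lact_superset:
  assumes "finite S" "S \<subseteq> carrier G" "{g. a g \<noteq> 0} \<subseteq> S" "t \<in> carrier M"
  shows "lact a t = (\<Oplus>\<^bsub>M\<^esub>h\<in>S. sc (a h) (act h t))"
  unfolding linear_action_def
  by (rule M.add.finprod_mono_neutral_cong_left)
    (use assms in \<open>auto intro!: sc_zero act_closed sc_closed\<close>)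

lemma lact_closed: "a \<in> carrier (group_ring G) \<Longrightarrow> t \<in> carrier M \<Longrightarrow> lact a t \<in> carrier M"
  unfolding linear_action_def
  by (rule M.finsum_closed) (auto simp: gr_carrier intro!: sc_closed act_closed)

lemma lact_single: "g \<in> carrier G \<Longrightarrow> t \<in> carrier M \<Longrightarrow> lact (gr_single c g) t = sc c (act g t)"
  by (subst lact_superset[of "{g}"])
    (auto simp: gr_single_def sc_closed act_closed split: if_splits)

lemma lact_add_left:
  assumes "a \<in> carrier (group_ring G)" "b \<in> carrier (group_ring G)" "t \<in> carrier M"
  shows "lact (\<lambda>x. a x + b x) t = lact a t \<oplus>\<^bsub>M\<^esub> lact b t"
proof -
  let ?S = "{g. a g \<noteq> 0} \<union> {g. b g \<noteq> 0}"
  have S: "finite ?S" "?S \<subseteq> carrier G" using assms by (auto simp: gr_carrier)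
  have "lact (\<lambda>x. a x + b x) t = (\<Oplus>\<^bsub>M\<^esub>h\<in>?S. sc (a h + b h) (act h t))"
    using S assms(3) by (intro lact_superset) auto
  also have "\<dots> = (\<Oplus>\<^bsub>M\<^esub>h\<in>?S. sc (a h) (act h t) \<oplus>\<^bsub>M\<^esub> sc (b h) (act h t))"
    using S assms(3) by (intro M.finsum_cong') (auto intro!: sc_plus act_closed sc_closed M.a_closed)
  also have "\<dots> = lact a t \<oplus>\<^bsub>M\<^esub> lact b t"
    using S assms(3) by (subst M.finsum_addf) (auto intro!: act_closed sc_closed simp: lact_superset[of ?S a t] lact_superset[of ?S b t])
  finally show ?thesis .
qed

lemma lact_add_right:
  assumes "a \<in> carrier (group_ring G)" "t \<in> carrier M" "u \<in> carrier M"
  shows "lact a (t \<oplus>\<^bsub>M\<^esub> u) = lact a t \<oplus>\<^bsub>M\<^esub> lact a u"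
proof -
  let ?S = "{g. a g \<noteq> 0}"
  have S: "finite ?S" "?S \<subseteq> carrier G" using assms by (auto simp: gr_carrier)
  have "lact a (t \<oplus>\<^bsub>M\<^esub> u) = (\<Oplus>\<^bsub>M\<^esub>h\<in>?S. sc (a h) (act h t) \<oplus>\<^bsub>M\<^esub> sc (a h) (act h u))"
    unfolding linear_action_def using S assms
    by (intro M.finsum_cong') (auto simp: act_add sc_add act_closed subset_iff intro!: sc_closed)
  also have "\<dots> = lact a t \<oplus>\<^bsub>M\<^esub> lact a u"
    unfolding linear_action_def
    using S assms by (subst M.finsum_addf) (auto intro!: act_closed sc_closed)
  finally show ?thesis .
qed

text \<open>Both sides of the associative law are additive in each of the two elements of the group ring,
  so the law is reduced to elements with one coefficient. There it is \<open>act_mult\<close>.\<close>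

lemma left_module_lact: "left_module (group_ring G) (with_smult M lact)"
proof -
  let ?R = "group_ring G :: ('g \<Rightarrow> 'k) ring"
  interpret R: ring ?R by (rule ring_group_ring) (rule is_group)
  have zero: "lact (\<lambda>x. 0) t = \<zero>\<^bsub>M\<^esub>" for t by (simp add: linear_action_def)
  have lact_zero: "lact a \<zero>\<^bsub>M\<^esub> = \<zero>\<^bsub>M\<^esub>" if "a \<in> carrier ?R" for a
    using lact_add_right[OF that M.zero_closed M.zero_closed] lact_closed[OF that M.zero_closed] by simp
  have single_mult: "lact (gr_single c g \<otimes>\<^bsub>?R\<^esub> b) t = lact (gr_single c g) (lact b t)"
    if "b \<in> carrier ?R" "g \<in> carrier G" "t \<in> carrier M" for b c g t
    using that(1)
  proof (induction rule: group_ring_induct)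
    case zero
    then show ?case using that R.r_null[of "gr_single c g"]
      by (simp add: gr_zero \<open>\<And>t. lact (\<lambda>x. 0) t = \<zero>\<^bsub>M\<^esub>\<close> lact_zero)
  next
    case (single d h)
    then show ?case using that by (simp add: lact_single act_mult act_sc sc_mult act_closed sc_closed)
  next
    case (add a b)
    then show ?case using that R.r_distr[of a b "gr_single c g"]
      by (simp add: gr_add lact_add_left lact_add_right lact_closed gr_mult_carrier[OF is_group])
  qed
  have mult: "lact (a \<otimes>\<^bsub>?R\<^esub> b) t = lact a (lact b t)"
    if "a \<in> carrier ?R" "b \<in> carrier ?R" "t \<in> carrier M" for a b t
    using that(1)
  proof (induction rule: group_ring_induct)
    case zero
    then show ?case using that R.l_null[of b] by (simp add: gr_zero \<open>\<And>t. lact (\<lambda>x. 0) t = \<zero>\<^bsub>M\<^esub>\<close>)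
  next
    case (single c g)
    then show ?case using single_mult that by simp
  next
    case (add a a')
    then show ?case using that R.l_distr[of a a' b]
      by (simp add: gr_add lact_add_left lact_closed gr_mult_carrier[OF is_group])
  qed
  show ?thesis
  proof (rule left_module.intro)
    show "ring ?R" ..
    show "abelian_group (with_smult M lact)"
      by (rule abelian_group_cong[OF M.abelian_group_axioms]) simp_all
    show "left_module_axioms ?R (with_smult M lact)"
      by unfold_locales
        (simp_all add: lact_closed lact_add_left lact_add_right gr_add mult gr_one lact_single
          act_one sc_one)
  qed
qed

end

text \<open>Every element of the group ring is a sum of elements with one coefficient, so linearity is
  only checked on those.\<close>

lemma mod_hom_group_ringI:
  assumes "left_module (group_ring G) V" "left_module (group_ring G) W"
    and phi: "\<phi> \<in> carrier V \<rightarrow>\<^sub>E carrier W"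
    and add: "\<And>x y. x \<in> carrier V \<Longrightarrow> y \<in> carrier V \<Longrightarrow> \<phi> (x \<oplus>\<^bsub>V\<^esub> y) = \<phi> x \<oplus>\<^bsub>W\<^esub> \<phi> y"
    and single: "\<And>c g x. g \<in> carrier G \<Longrightarrow> x \<in> carrier V \<Longrightarrow>
      \<phi> (gr_single c g \<odot>\<^bsub>V\<^esub> x) = gr_single c g \<odot>\<^bsub>W\<^esub> \<phi> x"
  shows "\<phi> \<in> mod_hom (group_ring G) V W"
proof -
  interpret V: left_module "group_ring G" V by fact
  interpret W: left_module "group_ring G" W by fact
  have phi_closed: "\<phi> x \<in> carrier W" if "x \<in> carrier V" for x using phi that by auto
  have zero: "\<phi> \<zero>\<^bsub>V\<^esub> = \<zero>\<^bsub>W\<^esub>"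
    using add[of "\<zero>\<^bsub>V\<^esub>" "\<zero>\<^bsub>V\<^esub>"] phi_closed[of "\<zero>\<^bsub>V\<^esub>"] by simp
  have "\<phi> (r \<odot>\<^bsub>V\<^esub> x) = r \<odot>\<^bsub>W\<^esub> \<phi> x" if "r \<in> carrier (group_ring G)" "x \<in> carrier V" for r x
    using that(1)
  proof (induction rule: group_ring_induct)
    case zero
    then show ?case
      using V.smult_zero_left[OF that(2)] W.smult_zero_left[OF phi_closed[OF that(2)]] \<open>\<phi> \<zero>\<^bsub>V\<^esub> = \<zero>\<^bsub>W\<^esub>\<close>
      by (simp add: gr_zero)
  next
    case (add a b)
    then show ?case
      using V.smult_l_distr[of a b x] W.smult_l_distr[of a b "\<phi> x"] that(2) phi_closed
      by (simp add: gr_add assms(4) V.smult_closed)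
  qed (simp add: assms(5) that(2))
  then show ?thesis using phi add by (simp add: mod_hom_def)
qed

lemma gr_map_ring_hom:
  assumes "group G" "group H" "f \<in> hom G H"
  shows "gr_map f \<in> ring_hom (group_ring G) (group_ring H)"
proof -
  have f: "f \<in> carrier G \<rightarrow> carrier H" using assms(3) by (auto simp: hom_def)
  have "f \<one>\<^bsub>G\<^esub> = \<one>\<^bsub>H\<^esub>" using hom_one[OF assms(3,1,2)] .
  then show ?thesis
    unfolding ring_hom_def using f assms
    by (auto simp: gr_map_mult gr_add gr_one gr_map_add gr_finsupp)
qed

lemma left_module_restrict_scalars:
  assumes "left_module R V" "ring P" "\<iota> \<in> ring_hom P R"
  shows "left_module P (restrict_scalars \<iota> V)"
proof -
  interpret V: left_module R V by fact
  interpret P: ring P by fact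
  show ?thesis
  proof (rule left_module.intro)
    show "abelian_group (restrict_scalars \<iota> V)"
      by (rule abelian_group_cong[OF V.M.abelian_group_axioms]) simp_all
    show "left_module_axioms P (restrict_scalars \<iota> V)"
      using assms(3) unfolding ring_hom_def
      by unfold_locales
        (auto simp: V.smult_closed V.smult_l_distr V.smult_r_distr V.smult_assoc V.smult_one Pi_iff)
  qed fact
qed

section \<open>Functors between module categories\<close>

lemma mod_homD:
  assumes "\<phi> \<in> mod_hom R V W"
  shows "\<phi> \<in> carrier V \<rightarrow>\<^sub>E carrier W"
    and "x \<in> carrier V \<Longrightarrow> \<phi> x \<in> carrier W"
    and "x \<in> carrier V \<Longrightarrow> y \<in> carrier V \<Longrightarrow> \<phi> (x \<oplus>\<^bsub>V\<^esub> y) = \<phi> x \<oplus>\<^bsub>W\<^esub> \<phi> y"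
    and "r \<in> carrier R \<Longrightarrow> x \<in> carrier V \<Longrightarrow> \<phi> (r \<odot>\<^bsub>V\<^esub> x) = r \<odot>\<^bsub>W\<^esub> \<phi> x"
  using assms by (auto simp: mod_hom_def)

lemma mod_hom_ident: "left_module S V \<Longrightarrow> (\<lambda>v\<in>carrier V. v) \<in> mod_hom S V V"
  unfolding mod_hom_def
  by (auto simp: left_module.smult_closed abelian_group.axioms left_module_def
      abelian_monoid.a_closed)

lemma mod_hom_compose:
  assumes "left_module S U" "\<phi> \<in> mod_hom S U V" "\<psi> \<in> mod_hom S V W"
  shows "compose (carrier U) \<psi> \<phi> \<in> mod_hom S U W"
proof -
  interpret U: left_module S U by fact
  show ?thesis
    using mod_homD[OF assms(2)] mod_homD[OF assms(3)]
    by (auto simp: mod_hom_def compose_def U.smult_closed)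
qed

lemma is_functor_Res:
  assumes "ring P" "\<iota> \<in> ring_hom P R"
  shows "is_functor R P (Res \<iota>)"
proof -
  have "\<iota> r \<in> carrier R" if "r \<in> carrier P" for r using assms(2) that by (auto simp: ring_hom_def)
  then show ?thesis
    unfolding is_functor_def Res_def
    using left_module_restrict_scalars[OF _ assms] by (auto simp: mod_hom_def)
qed

lemma is_functor_comp:
  assumes F: "is_functor R S F" and F': "is_functor S T F'"
  shows "is_functor R T (F' \<circ>\<^sub>F F)"
  using assms unfolding is_functor_def functor_comp_def by simp

section \<open>Tensor products\<close>

text \<open>\<open>R\<close> acts on \<open>M\<close> from the right and on \<open>N\<close> from the left; the two sides are told apart by the
  balancing relation alone.\<close>

locale tensor_pair = M: abelian_group M + N: abelian_group N
  for R :: "('r, 'm) ring_scheme" and M :: "('r, 'a) module" and N :: "('r, 'b) module" +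
  assumes M_smult: "r \<in> carrier R \<Longrightarrow> x \<in> carrier M \<Longrightarrow> r \<odot>\<^bsub>M\<^esub> x \<in> carrier M"
    and N_smult: "r \<in> carrier R \<Longrightarrow> v \<in> carrier N \<Longrightarrow> r \<odot>\<^bsub>N\<^esub> v \<in> carrier N"
begin

abbreviation "formal \<equiv> free_Abelian_group (carrier M \<times> carrier N)"
abbreviation "T \<equiv> tensor_product R M N"
abbreviation "cls \<equiv> tensor_class R M N"
abbreviation "rel \<equiv> tensor_rel R M N"
abbreviation tensor (infixl \<open>\<otimes>\<^sub>T\<close> 70) where "x \<otimes>\<^sub>T v \<equiv> tensor_elt R M N x v"

lemma frag_of_formal: "x \<in> carrier M \<Longrightarrow> v \<in> carrier N \<Longrightarrow> frag_of (x, v) \<in> carrier formal"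
  by simp

lemma formal_add: "z \<in> carrier formal \<Longrightarrow> w \<in> carrier formal \<Longrightarrow> z + w \<in> carrier formal"
  and formal_diff: "z \<in> carrier formal \<Longrightarrow> w \<in> carrier formal \<Longrightarrow> z - w \<in> carrier formal"
  unfolding carrier_free_Abelian_group_iff
  using Poly_Mapping.keys_add[of z w] keys_diff[of z w] by blast+

lemma tensor_gens_formal: "tensor_gens R M N \<subseteq> carrier formal"
  unfolding tensor_gens_def
  by (auto intro!: formal_diff frag_of_formal M_smult N_smult simp del: carrier_free_Abelian_group_iff)

lemma subgroup_rel: "subgroup rel formal"
  unfolding tensor_rel_def
  by (rule group.generate_is_subgroup[OF group_free_Abelian_group tensor_gens_formal])

lemma rel_gen: "z \<in> tensor_gens R M N \<Longrightarrow> z \<in> rel"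
  unfolding tensor_rel_def by (rule generate.incl)

lemma rel_formal: "z \<in> rel \<Longrightarrow> z \<in> carrier formal"
  using subgroup.subset[OF subgroup_rel] by blast

lemma rel_zero: "0 \<in> rel"
  and rel_add: "z \<in> rel \<Longrightarrow> w \<in> rel \<Longrightarrow> z + w \<in> rel"
  and rel_minus: "z \<in> rel \<Longrightarrow> - z \<in> rel"
  using subgroup.one_closed[OF subgroup_rel] subgroup.m_closed[OF subgroup_rel, of z w]
    subgroup.m_inv_closed[OF subgroup_rel, of z] rel_formal[of z]
  by (auto simp del: group_free_Abelian_group)

lemma cls_def: "cls z = {h + z | h. h \<in> rel}"
  by (auto simp: tensor_class_def r_coset_def)

lemma cls_eq_iff: "cls z = cls w \<longleftrightarrow> z - w \<in> rel"
proof
  assume "cls z = cls w"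
  then have "0 + z \<in> cls w" using rel_zero unfolding cls_def by blast
  then show "z - w \<in> rel" by (auto simp: cls_def)
next
  assume zw: "z - w \<in> rel"
  have "h + z \<in> cls w" if "h \<in> rel" for h
    using rel_add[OF that zw] by (auto simp: cls_def intro!: exI[of _ "h + (z - w)"])
  moreover have "h + w \<in> cls z" if "h \<in> rel" for h
    using rel_add[OF that rel_minus[OF zw]] by (auto simp: cls_def intro!: exI[of _ "h + (w - z)"])
  ultimately show "cls z = cls w" by (auto simp: cls_def[of z] cls_def[of w])
qed

lemma cls_self: "z \<in> cls z"
  using rel_zero by (force simp: cls_def)

lemma carrier_T: "carrier T = cls ` carrier formal"
  by (auto simp: tensor_product_def FactGroup_def RCOSETS_def tensor_class_def Let_def)

lemma zero_T: "\<zero>\<^bsub>T\<^esub> = cls 0"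
  by (simp add: tensor_product_def FactGroup_def Let_def cls_def)

lemma add_T:
  assumes "z \<in> carrier formal" "w \<in> carrier formal"
  shows "cls z \<oplus>\<^bsub>T\<^esub> cls w = cls (z + w)"
proof -
  have "rel \<lhd> formal"
    by (rule comm_group.subgroup_imp_normal[OF abelian_free_Abelian_group subgroup_rel])
  from normal.rcos_sum[OF this assms] show ?thesis
    by (simp add: tensor_product_def FactGroup_def Let_def tensor_class_def)
qed

lemma abelian_group_T: "abelian_group T"
proof (rule abelian_groupI)
  fix X assume "X \<in> carrier T"
  then obtain z where z: "z \<in> carrier formal" "X = cls z" by (auto simp: carrier_T)
  have "cls (- z) \<oplus>\<^bsub>T\<^esub> X = \<zero>\<^bsub>T\<^esub>" using z by (simp add: add_T zero_T)
  moreover have "cls (- z) \<in> carrier T" unfolding carrier_T using z by (intro imageI) simp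
  ultimately show "\<exists>Y\<in>carrier T. Y \<oplus>\<^bsub>T\<^esub> X = \<zero>\<^bsub>T\<^esub>" by blast
next
  show "\<zero>\<^bsub>T\<^esub> \<in> carrier T" by (auto simp: carrier_T zero_T)
qed (auto simp: carrier_T add_T zero_T formal_add add_ac simp del: carrier_free_Abelian_group_iff,
     auto simp: add_T)

sublocale T: abelian_group T by (rule abelian_group_T)

lemma tensor_closed [simp]: "x \<in> carrier M \<Longrightarrow> v \<in> carrier N \<Longrightarrow> x \<otimes>\<^sub>T v \<in> carrier T"
  by (auto simp: tensor_elt_def carrier_T)

lemma tensor_add_left:
  assumes "x \<in> carrier M" "y \<in> carrier M" "v \<in> carrier N"
  shows "(x \<oplus>\<^bsub>M\<^esub> y) \<otimes>\<^sub>T v = x \<otimes>\<^sub>T v \<oplus>\<^bsub>T\<^esub> y \<otimes>\<^sub>T v"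
proof -
  have "frag_of (x \<oplus>\<^bsub>M\<^esub> y, v) - frag_of (x, v) - frag_of (y, v) \<in> rel"
    using assms by (intro rel_gen) (auto simp: tensor_gens_def)
  then show ?thesis using assms by (simp add: tensor_elt_def add_T cls_eq_iff diff_diff_eq)
qed

lemma tensor_add_right:
  assumes "x \<in> carrier M" "v \<in> carrier N" "w \<in> carrier N"
  shows "x \<otimes>\<^sub>T (v \<oplus>\<^bsub>N\<^esub> w) = x \<otimes>\<^sub>T v \<oplus>\<^bsub>T\<^esub> x \<otimes>\<^sub>T w"
proof -
  have "frag_of (x, v \<oplus>\<^bsub>N\<^esub> w) - frag_of (x, v) - frag_of (x, w) \<in> rel"
    using assms by (intro rel_gen) (unfold tensor_gens_def, blast)
  then show ?thesis using assms by (simp add: tensor_elt_def add_T cls_eq_iff diff_diff_eq)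
qed

lemma tensor_balanced:
  assumes "x \<in> carrier M" "r \<in> carrier R" "v \<in> carrier N"
  shows "(r \<odot>\<^bsub>M\<^esub> x) \<otimes>\<^sub>T v = x \<otimes>\<^sub>T (r \<odot>\<^bsub>N\<^esub> v)"
proof -
  have "frag_of (r \<odot>\<^bsub>M\<^esub> x, v) - frag_of (x, r \<odot>\<^bsub>N\<^esub> v) \<in> rel"
    using assms by (intro rel_gen) (unfold tensor_gens_def, blast)
  then show ?thesis by (simp add: tensor_elt_def cls_eq_iff)
qed

lemma tensor_zero_left: "v \<in> carrier N \<Longrightarrow> \<zero>\<^bsub>M\<^esub> \<otimes>\<^sub>T v = \<zero>\<^bsub>T\<^esub>"
  using tensor_add_left[of "\<zero>\<^bsub>M\<^esub>" "\<zero>\<^bsub>M\<^esub>" v] tensor_closed[of "\<zero>\<^bsub>M\<^esub>" v] by simp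

lemma tensor_zero_right: "x \<in> carrier M \<Longrightarrow> x \<otimes>\<^sub>T \<zero>\<^bsub>N\<^esub> = \<zero>\<^bsub>T\<^esub>"
  using tensor_add_right[of x "\<zero>\<^bsub>N\<^esub>" "\<zero>\<^bsub>N\<^esub>"] tensor_closed[of x "\<zero>\<^bsub>N\<^esub>"] by simp

lemma tensor_minus_left:
  assumes "x \<in> carrier M" "v \<in> carrier N"
  shows "(\<ominus>\<^bsub>M\<^esub> x) \<otimes>\<^sub>T v = \<ominus>\<^bsub>T\<^esub> (x \<otimes>\<^sub>T v)"
  using assms tensor_add_left[of "\<ominus>\<^bsub>M\<^esub> x" x v] tensor_zero_left[of v]
  by (intro T.minus_equality[symmetric]) (auto simp: M.l_neg)

text \<open>Negatives are covered by \<open>- (x \<otimes> v) = (- x) \<otimes> v\<close>.\<close>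

lemma tensor_induct [consumes 1, case_names tensor add]:
  assumes "t \<in> carrier T"
    and tensor: "\<And>x v. x \<in> carrier M \<Longrightarrow> v \<in> carrier N \<Longrightarrow> P (x \<otimes>\<^sub>T v)"
    and add: "\<And>t u. t \<in> carrier T \<Longrightarrow> u \<in> carrier T \<Longrightarrow> P t \<Longrightarrow> P u \<Longrightarrow> P (t \<oplus>\<^bsub>T\<^esub> u)"
  shows "P t"
proof -
  have "cls z \<in> carrier T \<and> P (cls z) \<and> P (\<ominus>\<^bsub>T\<^esub> cls z)"
    if "Poly_Mapping.keys z \<subseteq> carrier M \<times> carrier N" for z
    using that
  proof (rule free_Abelian_group_induct, goal_cases)
    case 1
    have "P \<zero>\<^bsub>T\<^esub>" using tensor[of "\<zero>\<^bsub>M\<^esub>" "\<zero>\<^bsub>N\<^esub>"] by (simp add: tensor_zero_left)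
    moreover have "\<ominus>\<^bsub>T\<^esub> \<zero>\<^bsub>T\<^esub> = \<zero>\<^bsub>T\<^esub>" by (rule T.minus_equality) simp_all
    ultimately show ?case unfolding zero_T[symmetric] by (simp only: T.zero_closed simp_thms)
  next
    case (2 z w)
    have zw: "cls (z - w) = cls z \<oplus>\<^bsub>T\<^esub> \<ominus>\<^bsub>T\<^esub> cls w"
    proof -
      have "cls (z - w) \<in> carrier T"
        unfolding carrier_T using formal_diff[of z w] 2 by auto
      moreover have "cls z = cls (z - w) \<oplus>\<^bsub>T\<^esub> cls w"
        using formal_diff[of z w] 2 by (subst add_T) auto
      ultimately show ?thesis using 2 by (simp add: T.a_assoc T.r_neg)
    qed
    have "\<ominus>\<^bsub>T\<^esub> cls (z - w) = \<ominus>\<^bsub>T\<^esub> cls z \<oplus>\<^bsub>T\<^esub> cls w"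
      unfolding zw using 2 by (simp add: T.minus_add)
    then show ?case unfolding zw using 2 by (auto intro!: add)
  next
    case (3 p)
    then obtain x v where p: "p = (x, v)" "x \<in> carrier M" "v \<in> carrier N" by auto
    have "P (\<ominus>\<^bsub>T\<^esub> (x \<otimes>\<^sub>T v))"
      using tensor[of "\<ominus>\<^bsub>M\<^esub> x" v] tensor_minus_left[of x v] p by simp
    then show ?case using tensor[OF p(2,3)] tensor_closed[OF p(2,3)] by (simp add: p tensor_elt_def)
  qed
  then show ?thesis using assms(1) by (auto simp: carrier_T)
qed

lemma tensor_hom_eq:
  assumes "t \<in> carrier T"
    and "\<And>t u. t \<in> carrier T \<Longrightarrow> u \<in> carrier T \<Longrightarrow> f (t \<oplus>\<^bsub>T\<^esub> u) = f t \<oplus>\<^bsub>A\<^esub> f u"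
    and "\<And>t u. t \<in> carrier T \<Longrightarrow> u \<in> carrier T \<Longrightarrow> g (t \<oplus>\<^bsub>T\<^esub> u) = g t \<oplus>\<^bsub>A\<^esub> g u"
    and "\<And>x v. x \<in> carrier M \<Longrightarrow> v \<in> carrier N \<Longrightarrow> f (x \<otimes>\<^sub>T v) = g (x \<otimes>\<^sub>T v)"
  shows "f t = g t"
  using assms(1) by (induction rule: tensor_induct) (simp_all add: assms(2-))

text \<open>The universal property: the extension of \<open>b\<close> to formal sums kills the defining relations,
  hence their span, and so it is constant on classes.\<close>

lemma tensor_lift:
  assumes "abelian_group A"
    and closed: "\<And>x v. x \<in> carrier M \<Longrightarrow> v \<in> carrier N \<Longrightarrow> b x v \<in> carrier A"
    and left: "\<And>x y v. x \<in> carrier M \<Longrightarrow> y \<in> carrier M \<Longrightarrow> v \<in> carrier N \<Longrightarrow>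
      b (x \<oplus>\<^bsub>M\<^esub> y) v = b x v \<oplus>\<^bsub>A\<^esub> b y v"
    and right: "\<And>x v w. x \<in> carrier M \<Longrightarrow> v \<in> carrier N \<Longrightarrow> w \<in> carrier N \<Longrightarrow>
      b x (v \<oplus>\<^bsub>N\<^esub> w) = b x v \<oplus>\<^bsub>A\<^esub> b x w"
    and balanced: "\<And>x r v. x \<in> carrier M \<Longrightarrow> r \<in> carrier R \<Longrightarrow> v \<in> carrier N \<Longrightarrow>
      b (r \<odot>\<^bsub>M\<^esub> x) v = b x (r \<odot>\<^bsub>N\<^esub> v)"
  obtains h where "\<And>t. t \<in> carrier T \<Longrightarrow> h t \<in> carrier A"
    "\<And>t u. t \<in> carrier T \<Longrightarrow> u \<in> carrier T \<Longrightarrow> h (t \<oplus>\<^bsub>T\<^esub> u) = h t \<oplus>\<^bsub>A\<^esub> h u"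
    "\<And>x v. x \<in> carrier M \<Longrightarrow> v \<in> carrier N \<Longrightarrow> h (x \<otimes>\<^sub>T v) = b x v"
proof -
  interpret A: abelian_group A by fact
  obtain h' where h': "h' \<in> hom formal (add_monoid A)"
    and frag: "\<And>p. p \<in> carrier M \<times> carrier N \<Longrightarrow> h' (frag_of p) = b (fst p) (snd p)"
    by (rule comm_group.free_Abelian_group_universal[OF A.a_comm_group,
          of "\<lambda>p. b (fst p) (snd p)" "carrier M \<times> carrier N"])
      (use closed in auto)
  interpret h': group_hom formal "add_monoid A" h'
    by (simp add: group_hom_def group_hom_axioms_def h' A.a_group)
  have h'_closed: "h' z \<in> carrier A" if "z \<in> carrier formal" for z
    using h'.hom_closed[OF that] by simp
  have h'_add: "h' (z + w) = h' z \<oplus>\<^bsub>A\<^esub> h' w" if "z \<in> carrier formal" "w \<in> carrier formal" for z w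
    using h'.hom_mult[OF that] by simp
  have h'_diff: "h' (z - w) = h' z \<ominus>\<^bsub>A\<^esub> h' w" if "z \<in> carrier formal" "w \<in> carrier formal" for z w
  proof -
    have "h' z = h' (z - w) \<oplus>\<^bsub>A\<^esub> h' w" using h'_add[OF formal_diff[OF that] that(2)] by simp
    then show ?thesis
      using h'_closed[OF formal_diff[OF that]] h'_closed[OF that(2)]
      by (simp add: a_minus_def A.a_assoc A.r_neg)
  qed
  note fd = formal_diff frag_of_formal
  have cancel: "(p \<oplus>\<^bsub>A\<^esub> q) \<ominus>\<^bsub>A\<^esub> p \<ominus>\<^bsub>A\<^esub> q = \<zero>\<^bsub>A\<^esub>" if "p \<in> carrier A" "q \<in> carrier A" for p q
    using that A.a_comm[of p q] by (simp add: a_minus_def A.a_assoc A.r_neg)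
  have gens: "h' z = \<zero>\<^bsub>A\<^esub>" if "z \<in> tensor_gens R M N" for z
    using that unfolding tensor_gens_def
  proof (elim UnE CollectE exE conjE)
    fix x y v assume "z = frag_of (x \<oplus>\<^bsub>M\<^esub> y, v) - frag_of (x, v) - frag_of (y, v)"
      and "x \<in> carrier M" "y \<in> carrier M" "v \<in> carrier N"
    then show ?thesis
      by (simp add: h'_diff fd frag left closed cancel
          del: carrier_free_Abelian_group_iff)
  next
    fix x v w assume "z = frag_of (x, v \<oplus>\<^bsub>N\<^esub> w) - frag_of (x, v) - frag_of (x, w)"
      and "x \<in> carrier M" "v \<in> carrier N" "w \<in> carrier N"
    then show ?thesis
      by (simp add: h'_diff fd frag right closed cancel
          del: carrier_free_Abelian_group_iff)
  next
    fix x r v assume "z = frag_of (r \<odot>\<^bsub>M\<^esub> x, v) - frag_of (x, r \<odot>\<^bsub>N\<^esub> v)"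
      and "x \<in> carrier M" "r \<in> carrier R" "v \<in> carrier N"
    then show ?thesis
      by (simp add: h'_diff fd frag balanced closed a_minus_def A.r_neg M_smult N_smult
          del: carrier_free_Abelian_group_iff)
  qed
  have rel: "h' z = \<zero>\<^bsub>A\<^esub>" if "z \<in> rel" for z
    using that unfolding tensor_rel_def
  proof (induction rule: generate.induct)
    case (eng z w)
    then have "z \<in> carrier formal" "w \<in> carrier formal"
      using rel_formal unfolding tensor_rel_def by auto
    then show ?case using eng by (simp add: h'_add del: carrier_free_Abelian_group_iff)
  next
    case (inv z)
    then have "z \<in> carrier formal" using tensor_gens_formal by blast
    then show ?case using gens[OF inv] h'.hom_inv[of z] A.add.inv_one by (simp add: a_inv_def)
  qed (use h'.hom_one gens in simp_all)
  define h where "h X = h' (SOME z. z \<in> carrier formal \<and> X = cls z)" for X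
  have h: "h (cls z) = h' z" if z: "z \<in> carrier formal" for z
  proof -
    define w where "w = (SOME w. w \<in> carrier formal \<and> cls z = cls w)"
    have w: "w \<in> carrier formal \<and> cls z = cls w"
      unfolding w_def by (rule someI[of _ z]) (use z in simp)
    then have "h' (z - w) = \<zero>\<^bsub>A\<^esub>" using rel by (simp add: cls_eq_iff)
    then have "h' z = h' w"
      using h'_add[OF formal_diff[OF z conjunct1[OF w]] conjunct1[OF w]] h'_closed w by simp
    then show ?thesis by (simp add: h_def w_def)
  qed
  show thesis
  proof
    show "h t \<in> carrier A" if "t \<in> carrier T" for t
      using that h h'_closed unfolding carrier_T by force
    show "h (t \<oplus>\<^bsub>T\<^esub> u) = h t \<oplus>\<^bsub>A\<^esub> h u" if "t \<in> carrier T" "u \<in> carrier T" for t u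
      using that unfolding carrier_T
      by (auto simp: add_T h h'_add formal_add simp del: carrier_free_Abelian_group_iff)
    show "h (x \<otimes>\<^sub>T v) = b x v" if "x \<in> carrier M" "v \<in> carrier N" for x v
      using that by (simp add: tensor_elt_def h frag)
  qed
qed

end

text \<open>Balancedness is stated in the target, as an equality of classes. It holds for any two maps that
  are semilinear along the same endomorphism of \<open>R\<close>, and thus for the maps by which \<open>G\<close> acts.\<close>

lemma tensor_map_well_defined:
  assumes "tensor_pair R M N" "tensor_pair R M' N'"
    and f: "\<And>x. x \<in> carrier M \<Longrightarrow> f x \<in> carrier M'"
    and g: "\<And>v. v \<in> carrier N \<Longrightarrow> g v \<in> carrier N'"
    and f_add: "\<And>x y. x \<in> carrier M \<Longrightarrow> y \<in> carrier M \<Longrightarrow> f (x \<oplus>\<^bsub>M\<^esub> y) = f x \<oplus>\<^bsub>M'\<^esub> f y"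
    and g_add: "\<And>v w. v \<in> carrier N \<Longrightarrow> w \<in> carrier N \<Longrightarrow> g (v \<oplus>\<^bsub>N\<^esub> w) = g v \<oplus>\<^bsub>N'\<^esub> g w"
    and balanced: "\<And>x r v. x \<in> carrier M \<Longrightarrow> r \<in> carrier R \<Longrightarrow> v \<in> carrier N \<Longrightarrow>
      tensor_elt R M' N' (f (r \<odot>\<^bsub>M\<^esub> x)) (g v) = tensor_elt R M' N' (f x) (g (r \<odot>\<^bsub>N\<^esub> v))"
  shows "x \<in> carrier M \<Longrightarrow> v \<in> carrier N \<Longrightarrow>
      tensor_map R M' N' f g (tensor_elt R M N x v) = tensor_elt R M' N' (f x) (g v)"
    and "t \<in> carrier (tensor_product R M N) \<Longrightarrow>
      tensor_map R M' N' f g t \<in> carrier (tensor_product R M' N')"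
    and "t \<in> carrier (tensor_product R M N) \<Longrightarrow> u \<in> carrier (tensor_product R M N) \<Longrightarrow>
      tensor_map R M' N' f g (t \<oplus>\<^bsub>tensor_product R M N\<^esub> u) =
      tensor_map R M' N' f g t \<oplus>\<^bsub>tensor_product R M' N'\<^esub> tensor_map R M' N' f g u"
proof -
  interpret P: tensor_pair R M N by fact
  interpret P': tensor_pair R M' N' by fact
  define h where "h = frag_extend (\<lambda>(x, v). frag_of (f x, g v))"
  have h_simps: "h 0 = 0" "h (z + w) = h z + h w" "h (- z) = - h z" "h (z - w) = h z - h w"
    "h (frag_of (x, v)) = frag_of (f x, g v)" for z w x v
    by (simp_all add: h_def frag_extend_add frag_extend_diff frag_extend_minus)
  have h_formal: "h z \<in> carrier P'.formal" if "z \<in> carrier P.formal" for z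
  proof -
    have "Poly_Mapping.keys (h z) \<subseteq>
        (\<Union>p\<in>Poly_Mapping.keys z. Poly_Mapping.keys (case p of (x, v) \<Rightarrow> frag_of (f x, g v)))"
      unfolding h_def by (rule keys_frag_extend)
    also have "\<dots> \<subseteq> carrier M' \<times> carrier N'"
      using that f g by (intro UN_least) (auto simp: keys_frag_of)
    finally show ?thesis by simp
  qed
  have gens: "h z \<in> P'.rel" if "z \<in> tensor_gens R M N" for z
    using that unfolding tensor_gens_def
  proof (elim UnE CollectE exE conjE)
    fix x y v assume "z = frag_of (x \<oplus>\<^bsub>M\<^esub> y, v) - frag_of (x, v) - frag_of (y, v)"
      and "x \<in> carrier M" "y \<in> carrier M" "v \<in> carrier N"
    then show ?thesis
      using f g by (intro P'.rel_gen) (simp add: h_simps f_add, unfold tensor_gens_def, blast)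
  next
    fix x v w assume "z = frag_of (x, v \<oplus>\<^bsub>N\<^esub> w) - frag_of (x, v) - frag_of (x, w)"
      and "x \<in> carrier M" "v \<in> carrier N" "w \<in> carrier N"
    then show ?thesis
      using f g by (intro P'.rel_gen) (simp add: h_simps g_add, unfold tensor_gens_def, blast)
  next
    fix x r v assume "z = frag_of (r \<odot>\<^bsub>M\<^esub> x, v) - frag_of (x, r \<odot>\<^bsub>N\<^esub> v)"
      and "x \<in> carrier M" "r \<in> carrier R" "v \<in> carrier N"
    then show ?thesis
      using balanced[of x r v] by (simp add: h_simps tensor_elt_def P'.cls_eq_iff)
  qed
  have rel: "h z \<in> P'.rel" if "z \<in> P.rel" for z
    using that unfolding tensor_rel_def[of R M N]
  proof (induction rule: generate.induct)
    case (inv z)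
    then have "z \<in> carrier P.formal" using P.tensor_gens_formal by blast
    then show ?case using gens[OF inv] by (simp add: h_simps P'.rel_minus)
  qed (auto simp: h_simps P'.rel_zero P'.rel_add gens)
  have tm: "tensor_map R M' N' f g (P.cls z) = P'.cls (h z)" for z
    unfolding tensor_map_def h_def[symmetric]
  proof (rule UN_constant_eq[OF P.cls_self], intro ballI)
    fix w assume "w \<in> P.cls z"
    then have "w - z \<in> P.rel" by (auto simp: P.cls_def)
    then show "P'.cls (h w) = P'.cls (h z)" using rel by (simp add: P'.cls_eq_iff flip: h_simps)
  qed
  show "tensor_map R M' N' f g (tensor_elt R M N x v) = tensor_elt R M' N' (f x) (g v)"
    if "x \<in> carrier M" "v \<in> carrier N"
    by (simp add: tensor_elt_def tm h_simps)
  show "tensor_map R M' N' f g t \<in> carrier (tensor_product R M' N')"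
    if "t \<in> carrier (tensor_product R M N)"
    using that h_formal unfolding P.carrier_T P'.carrier_T
    by (auto simp: tm simp del: carrier_free_Abelian_group_iff)
  show "tensor_map R M' N' f g (t \<oplus>\<^bsub>tensor_product R M N\<^esub> u) =
      tensor_map R M' N' f g t \<oplus>\<^bsub>tensor_product R M' N'\<^esub> tensor_map R M' N' f g u"
    if "t \<in> carrier (tensor_product R M N)" "u \<in> carrier (tensor_product R M N)"
    using that h_formal unfolding P.carrier_T
    by (auto simp: P.add_T P'.add_T tm h_simps simp del: carrier_free_Abelian_group_iff)
qed

section \<open>The augmentation ideal as a free right module\<close>

locale twisted =
  fixes n :: nat and lam :: "'k::field"
  assumes lam_nonzero: "lam \<noteq> 0"
begin

abbreviation "F \<equiv> free_group n"
abbreviation R :: "(nat word set \<Rightarrow> 'k) ring" where "R \<equiv> kF n"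
abbreviation I :: "(nat word set \<Rightarrow> 'k, nat word set \<Rightarrow> 'k) module" where "I \<equiv> aug_ideal n"
abbreviation X :: "nat \<Rightarrow> nat word set \<Rightarrow> 'k" where "X \<equiv> xel n"
abbreviation Y :: "nat \<Rightarrow> nat word set \<Rightarrow> 'k" where "Y \<equiv> xm1 n"

abbreviation mul (infixl \<open>\<cdot>\<close> 70) where "a \<cdot> b \<equiv> a \<otimes>\<^bsub>R\<^esub> b"
abbreviation plus_F (infixl \<open>+\<^sub>F\<close> 65) where "a +\<^sub>F b \<equiv> a \<oplus>\<^bsub>R\<^esub> b"
abbreviation minus_F (infixl \<open>-\<^sub>F\<close> 65) where "a -\<^sub>F b \<equiv> a \<ominus>\<^bsub>R\<^esub> b"
abbreviation scale_F :: "'k \<Rightarrow> (nat word set \<Rightarrow> 'k) \<Rightarrow> nat word set \<Rightarrow> 'k" (infixr \<open>*\<^sub>F\<close> 75) where "c *\<^sub>F a \<equiv> gr_scale c a"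
abbreviation sing :: "'k \<Rightarrow> nat word set \<Rightarrow> nat word set \<Rightarrow> 'k" where "sing \<equiv> gr_single"

sublocale F: group F by (rule group_free_group)
sublocale R: ring R by (rule ring_group_ring) (rule group_free_group)

lemma zero_fun [simp]: "(\<lambda>x. 0) \<in> carrier R"
  using R.zero_closed by (simp add: gr_zero)

definition aug :: "(nat word set \<Rightarrow> 'k) \<Rightarrow> 'k" where "aug f = gr_sum f (\<lambda>x. 1)"

lemma X_carrier [simp]: "k \<in> {1..n} \<Longrightarrow> X k \<in> carrier R"
  by (simp only: xel_def gr_single_carrier fgen_carrier)

lemma Y_alt: "Y k = X k -\<^sub>F \<one>\<^bsub>R\<^esub>"
  by (simp add: xm1_def)

lemma Y_carrier [simp]: "k \<in> {1..n} \<Longrightarrow> Y k \<in> carrier R"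
  by (simp only: Y_alt R.minus_closed X_carrier R.one_closed)

lemma diff_fun: "b \<in> carrier R \<Longrightarrow> a -\<^sub>F b = (\<lambda>x. a x - b x)"
  by (rule gr_minus[OF group_free_group])

lemma diff_scale: "b \<in> carrier R \<Longrightarrow> a -\<^sub>F b = a +\<^sub>F (- 1) *\<^sub>F b"
  by (simp add: a_minus_def gr_minus(2)[OF group_free_group])

lemma I_carrier: "f \<in> carrier I \<longleftrightarrow> f \<in> carrier R \<and> aug f = 0"
  by (simp add: aug_ideal_def aug_def gr_sum_def Let_def)

lemma I_simps [simp]:
  "a \<oplus>\<^bsub>I\<^esub> b = a +\<^sub>F b" "\<zero>\<^bsub>I\<^esub> = \<zero>\<^bsub>R\<^esub>" "r \<odot>\<^bsub>I\<^esub> f = f \<cdot> r"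
  by (simp_all add: aug_ideal_def Let_def)

lemma I_R: "f \<in> carrier I \<Longrightarrow> f \<in> carrier R"
  by (simp add: I_carrier)

lemma aug_simps [simp]:
  assumes "f \<in> carrier R" "g \<in> carrier R"
  shows "aug (f +\<^sub>F g) = aug f + aug g" "aug (f \<cdot> g) = aug f * aug g"
  using assms[THEN gr_finsupp] gr_sum_multc[of f "\<lambda>x. 1" "aug g"]
  by (simp_all add: aug_def gr_add gr_sum_mult)

lemma aug_scale [simp]: "f \<in> carrier R \<Longrightarrow> aug (c *\<^sub>F f) = c * aug f"
  by (simp add: aug_def gr_finsupp)

lemma aug_sing [simp]: "aug (sing c x) = c"
  by (simp add: aug_def)

lemma aug_diff [simp]: "f \<in> carrier R \<Longrightarrow> g \<in> carrier R \<Longrightarrow> aug (f -\<^sub>F g) = aug f - aug g"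
  by (simp add: diff_scale)

lemma Y_I [simp]: "k \<in> {1..n} \<Longrightarrow> Y k \<in> carrier I"
  by (simp add: I_carrier Y_alt del: atLeastAtMost_iff) (simp add: xel_def gr_one)

lemma I_closed [simp]:
  assumes "f \<in> carrier I"
  shows "g \<in> carrier I \<Longrightarrow> f +\<^sub>F g \<in> carrier I" "g \<in> carrier I \<Longrightarrow> f -\<^sub>F g \<in> carrier I"
    "r \<in> carrier R \<Longrightarrow> f \<cdot> r \<in> carrier I" "r \<in> carrier R \<Longrightarrow> r \<cdot> f \<in> carrier I"
    "c *\<^sub>F f \<in> carrier I"
  using assms by (simp_all add: I_carrier)

lemma zero_I [simp]: "\<zero>\<^bsub>R\<^esub> \<in> carrier I"
  by (simp add: I_carrier) (simp add: gr_zero aug_def)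

lemma abelian_group_I: "abelian_group I"
proof (rule abelian_groupI)
  show "\<exists>y\<in>carrier I. y \<oplus>\<^bsub>I\<^esub> f = \<zero>\<^bsub>I\<^esub>" if "f \<in> carrier I" for f
    using that by (intro bexI[of _ "(- 1) *\<^sub>F f"]) (simp_all, simp add: gr_add gr_zero gr_scale_def)
qed (auto simp: I_R R.a_ac)

lemma l_diff: "a \<in> carrier R \<Longrightarrow> b \<in> carrier R \<Longrightarrow> c \<in> carrier R \<Longrightarrow> (a -\<^sub>F b) \<cdot> c = a \<cdot> c -\<^sub>F b \<cdot> c"
  and r_diff: "a \<in> carrier R \<Longrightarrow> b \<in> carrier R \<Longrightarrow> c \<in> carrier R \<Longrightarrow> c \<cdot> (a -\<^sub>F b) = c \<cdot> a -\<^sub>F c \<cdot> b"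
  by (simp_all add: a_minus_def R.l_distr R.r_distr R.l_minus R.r_minus)

lemma scale_mul:
  assumes "a \<in> carrier R" "b \<in> carrier R"
  shows "c *\<^sub>F a \<cdot> b = c *\<^sub>F (a \<cdot> b)" "a \<cdot> c *\<^sub>F b = c *\<^sub>F (a \<cdot> b)"
  using gr_scale_mult[OF gr_finsupp gr_finsupp, OF assms] by auto

text \<open>Generation rests on \<open>x\<^sub>k z - 1 = (x\<^sub>k - 1) z + (z - 1)\<close> and
  \<open>x\<^sub>k\<^sup>-\<^sup>1 z - 1 = - (x\<^sub>k - 1) x\<^sub>k\<^sup>-\<^sup>1 z + (z - 1)\<close>.\<close>

lemma aug_ideal_induct [consumes 1, case_names zero gen add]:
  assumes "f \<in> carrier I"
    and zero: "P \<zero>\<^bsub>R\<^esub>"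
    and gen: "\<And>k r. k \<in> {1..n} \<Longrightarrow> r \<in> carrier R \<Longrightarrow> P (Y k \<cdot> r)"
    and add: "\<And>f g. f \<in> carrier I \<Longrightarrow> g \<in> carrier I \<Longrightarrow> P f \<Longrightarrow> P g \<Longrightarrow> P (f +\<^sub>F g)"
  shows "P f"
proof -
  have diff_I: "sing c x -\<^sub>F sing c \<one>\<^bsub>F\<^esub> \<in> carrier I" if "x \<in> carrier F" for c x
    using that by (simp add: I_carrier)
  have P_single: "P (sing c x -\<^sub>F sing c \<one>\<^bsub>F\<^esub>)" if "x \<in> carrier F" for c x
    using that
  proof (induction rule: free_group_induct)
    case one
    then show ?case using zero by (simp add: diff_fun gr_zero)
  next
    case (gen k z)
    let ?x = "fgen n k"
    have x: "?x \<in> carrier F" using gen by (intro fgen_carrier)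
    have "sing c (?x \<otimes>\<^bsub>F\<^esub> z) -\<^sub>F sing c \<one>\<^bsub>F\<^esub>
        = Y k \<cdot> sing c z +\<^sub>F (sing c z -\<^sub>F sing c \<one>\<^bsub>F\<^esub>)"
      using gen x by (simp add: Y_alt l_diff xel_def gr_one) (simp add: diff_fun gr_add)
    then show ?case using gen assms(3)[of k "sing c z"] diff_I by (simp add: add)
  next
    case (inv k z)
    let ?x = "fgen n k"
    have x: "?x \<in> carrier F" using inv by (intro fgen_carrier)
    have "sing c (inv\<^bsub>F\<^esub> ?x \<otimes>\<^bsub>F\<^esub> z) -\<^sub>F sing c \<one>\<^bsub>F\<^esub>
        = Y k \<cdot> sing (- c) (inv\<^bsub>F\<^esub> ?x \<otimes>\<^bsub>F\<^esub> z) +\<^sub>F (sing c z -\<^sub>F sing c \<one>\<^bsub>F\<^esub>)"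
      using inv x by (simp add: Y_alt l_diff xel_def gr_one)
        (simp add: diff_fun gr_add, auto simp: gr_single_def)
    then show ?case
      using inv x assms(3)[of k "sing (- c) (inv\<^bsub>F\<^esub> ?x \<otimes>\<^bsub>F\<^esub> z)"] diff_I by (simp add: add)
  qed
  have "g -\<^sub>F sing (aug g) \<one>\<^bsub>F\<^esub> \<in> carrier I \<and> P (g -\<^sub>F sing (aug g) \<one>\<^bsub>F\<^esub>)" if "g \<in> carrier R" for g
    using that
  proof (induction rule: group_ring_induct)
    case zero
    have "(\<lambda>x. 0) -\<^sub>F sing (aug (\<lambda>x. 0)) \<one>\<^bsub>F\<^esub> = \<zero>\<^bsub>R\<^esub>"
      by (auto simp: diff_fun aug_def gr_zero gr_single_def)
    then show ?case using assms(2) by simp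
  next
    case (single c g)
    then show ?case using P_single diff_I by simp
  next
    case (add a b)
    have "(\<lambda>x. a x + b x) -\<^sub>F sing (aug (\<lambda>x. a x + b x)) \<one>\<^bsub>F\<^esub>
       = (a -\<^sub>F sing (aug a) \<one>\<^bsub>F\<^esub>) +\<^sub>F (b -\<^sub>F sing (aug b) \<one>\<^bsub>F\<^esub>)"
      using aug_simps(1)[OF add(1,2)]
      by (simp add: diff_fun gr_add) (auto simp: gr_single_def)
    then show ?case using add assms(4) by simp
  qed
  moreover have "f -\<^sub>F sing 0 \<one>\<^bsub>F\<^esub> = f" by (simp add: diff_fun) (simp add: gr_single_def)
  ultimately show ?thesis
    using assms(1) by (metis I_carrier)
qed

text \<open>Semilinearity along \<open>\<tau>\<close> covers both right linear maps and their composites with the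
  ring automorphisms induced by automorphisms of the free group.\<close>

definition semilinear :: "((nat word set \<Rightarrow> 'k) \<Rightarrow> nat word set \<Rightarrow> 'k) \<Rightarrow>
    ((nat word set \<Rightarrow> 'k) \<Rightarrow> nat word set \<Rightarrow> 'k) \<Rightarrow> bool" where
  "semilinear \<tau> D \<longleftrightarrow> (\<forall>f\<in>carrier I. D f \<in> carrier R) \<and>
     (\<forall>f\<in>carrier I. \<forall>g\<in>carrier I. D (f +\<^sub>F g) = D f +\<^sub>F D g) \<and>
     (\<forall>f\<in>carrier I. \<forall>r\<in>carrier R. D (f \<cdot> r) = D f \<cdot> \<tau> r)"

abbreviation "right_linear \<equiv> semilinear (\<lambda>r. r)"

lemma semilinearD:
  assumes "semilinear \<tau> D" "f \<in> carrier I"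
  shows "D f \<in> carrier R" "g \<in> carrier I \<Longrightarrow> D (f +\<^sub>F g) = D f +\<^sub>F D g"
    "r \<in> carrier R \<Longrightarrow> D (f \<cdot> r) = D f \<cdot> \<tau> r"
  using assms by (auto simp: semilinear_def)

text \<open>Together with \<open>right_linear_exists\<close> below, this is the freeness of the augmentation ideal on
  the elements \<open>Y k\<close>.\<close>

lemma semilinear_eq:
  assumes D: "semilinear \<tau> D" and D': "semilinear \<tau> D'"
    and "\<And>k. k \<in> {1..n} \<Longrightarrow> D (Y k) = D' (Y k)" and "f \<in> carrier I"
  shows "D f = D' f"
proof -
  have zero: "D \<zero>\<^bsub>R\<^esub> = \<zero>\<^bsub>R\<^esub>" if "semilinear \<tau> D" for D
    using semilinearD(2)[OF that zero_I zero_I] semilinearD(1)[OF that zero_I] by simp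
  from \<open>f \<in> carrier I\<close> show ?thesis
  proof (induction rule: aug_ideal_induct)
    case (gen k r)
    then show ?case
      using semilinearD(3)[OF D Y_I] semilinearD(3)[OF D' Y_I] assms(3) by simp
  qed (simp_all add: zero[OF D] zero[OF D'] semilinearD(2)[OF D] semilinearD(2)[OF D'])
qed

lemma right_linear_scale:
  assumes "right_linear D" "f \<in> carrier I"
  shows "D (c *\<^sub>F f) = c *\<^sub>F D f"
  using semilinearD(1)[OF assms] semilinearD(3)[OF assms, of "sing c \<one>\<^bsub>F\<^esub>"] assms(2)
  by (simp add: gr_scale_eq_mult[OF group_free_group] I_R)

lemma right_linear_diff:
  assumes "right_linear D" "f \<in> carrier I" "g \<in> carrier I"
  shows "D (f -\<^sub>F g) = D f -\<^sub>F D g"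
  using assms semilinearD[OF assms(1)] by (simp add: diff_scale I_R right_linear_scale)

text \<open>The group \<open>R \<rtimes> F\<close>, whose homomorphic sections over \<open>F\<close> are the derivations \<open>d\<close> with
  \<open>d (x y) = d x \<cdot> y + d y\<close>.\<close>

definition derivation_group :: "((nat word set \<Rightarrow> 'k) \<times> nat word set) monoid" where
  "derivation_group = \<lparr>carrier = carrier R \<times> carrier F,
     mult = \<lambda>(p, x) (q, y). (p \<cdot> sing 1 y +\<^sub>F q, x \<otimes>\<^bsub>F\<^esub> y), one = (\<zero>\<^bsub>R\<^esub>, \<one>\<^bsub>F\<^esub>)\<rparr>"

lemma group_derivation_group: "group derivation_group"
proof (rule groupI)
  fix p assume "p \<in> carrier derivation_group"
  then obtain a x where p: "p = (a, x)" "a \<in> carrier R" "x \<in> carrier F"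
    by (auto simp: derivation_group_def)
  have "(\<ominus>\<^bsub>R\<^esub> (a \<cdot> sing 1 (inv\<^bsub>F\<^esub> x)), inv\<^bsub>F\<^esub> x) \<otimes>\<^bsub>derivation_group\<^esub> p = \<one>\<^bsub>derivation_group\<^esub>"
    using p by (simp add: derivation_group_def R.l_minus R.m_assoc R.l_neg flip: gr_one)
  then show "\<exists>q\<in>carrier derivation_group. q \<otimes>\<^bsub>derivation_group\<^esub> p = \<one>\<^bsub>derivation_group\<^esub>"
    using p by (intro bexI[of _ "(\<ominus>\<^bsub>R\<^esub> (a \<cdot> sing 1 (inv\<^bsub>F\<^esub> x)), inv\<^bsub>F\<^esub> x)"])
      (auto simp: derivation_group_def)
qed (auto simp: derivation_group_def R.l_distr R.m_assoc F.m_assoc R.a_assoc)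

lemma derivation_exists:
  assumes "\<And>k. k \<in> {1..n} \<Longrightarrow> m k \<in> carrier R"
  shows "\<exists>d. (\<forall>x\<in>carrier F. d x \<in> carrier R) \<and>
    (\<forall>x\<in>carrier F. \<forall>y\<in>carrier F. d (x \<otimes>\<^bsub>F\<^esub> y) = d x \<cdot> sing 1 y +\<^sub>F d y) \<and>
    (\<forall>k\<in>{1..n}. d (fgen n k) = m k)"
proof -
  obtain \<phi> where phi: "\<phi> \<in> hom F derivation_group" "\<And>k. k \<in> {1..n} \<Longrightarrow> \<phi> (fgen n k) = (m k, fgen n k)"
    by (rule free_group_universal[OF group_derivation_group, of n "\<lambda>k. (m k, fgen n k)"])
      (use assms in \<open>auto simp: derivation_group_def simp del: atLeastAtMost_iff\<close>)
  have closed: "\<phi> x \<in> carrier R \<times> carrier F" if "x \<in> carrier F" for x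
    using hom_in_carrier[OF phi(1) that] by (simp add: derivation_group_def)
  have "(snd \<circ> \<phi>) x = x" if "x \<in> carrier F" for x
  proof (rule free_group_hom_eq[OF group_free_group, where \<psi> = "\<lambda>x. x", OF _ _ _ that])
    show "snd \<circ> \<phi> \<in> hom F F"
      by (rule Group.hom_compose[OF phi(1)]) (auto simp: hom_def derivation_group_def)
  qed (auto simp: hom_def phi(2) simp del: atLeastAtMost_iff)
  then have snd: "snd (\<phi> x) = x" if "x \<in> carrier F" for x using that by simp
  show ?thesis
  proof (intro exI[of _ "\<lambda>x. fst (\<phi> x)"] conjI ballI)
    show "fst (\<phi> x) \<in> carrier R" if "x \<in> carrier F" for x
      using closed[OF that] by auto
    show "fst (\<phi> (x \<otimes>\<^bsub>F\<^esub> y)) = fst (\<phi> x) \<cdot> sing 1 y +\<^sub>F fst (\<phi> y)"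
      if "x \<in> carrier F" "y \<in> carrier F" for x y
      using hom_mult[OF phi(1) that] snd[OF that(2)]
      by (simp add: derivation_group_def case_prod_beta)
  qed (simp add: phi(2) del: atLeastAtMost_iff)
qed

text \<open>The right linear map is the linear extension of a derivation \<open>d\<close> to the group ring. The
  extension satisfies \<open>D (f r) = D f \<cdot> r + aug f * D r\<close>, which is right linearity where
  \<open>aug\<close> vanishes.\<close>

lemma right_linear_exists:
  assumes "\<And>k. k \<in> {1..n} \<Longrightarrow> m k \<in> carrier R"
  shows "\<exists>D. right_linear D \<and> (\<forall>k\<in>{1..n}. D (Y k) = m k)"
proof -
  obtain d where d: "\<And>x. x \<in> carrier F \<Longrightarrow> d x \<in> carrier R"
    "\<And>x y. x \<in> carrier F \<Longrightarrow> y \<in> carrier F \<Longrightarrow> d (x \<otimes>\<^bsub>F\<^esub> y) = d x \<cdot> sing 1 y +\<^sub>F d y"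
    "\<And>k. k \<in> {1..n} \<Longrightarrow> d (fgen n k) = m k"
    using derivation_exists[of m] assms by metis
  define D where "D f = (\<lambda>w. gr_sum f (\<lambda>x. d x w))" for f
  have D_add: "D (f +\<^sub>F g) = D f +\<^sub>F D g" if "f \<in> carrier R" "g \<in> carrier R" for f g
    using that[THEN gr_finsupp] by (simp add: D_def gr_add)
  have D_single: "D (sing c x) = c *\<^sub>F d x" for c x
    by (simp add: D_def gr_scale_def)
  have D_closed_sum: "D f \<in> carrier R \<and> (\<forall>G. gr_sum (D f) G = gr_sum f (\<lambda>x. gr_sum (d x) G))"
    if "f \<in> carrier R" for f
    using that
  proof (induction rule: group_ring_induct)
    case zero
    have "D (\<lambda>x. 0) = \<zero>\<^bsub>R\<^esub>" by (simp add: D_def gr_zero)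
    then show ?case by (simp add: gr_zero)
  next
    case (single c g)
    then show ?case using d(1) gr_finsupp[OF d(1)] by (simp add: D_single)
  next
    case (add a b)
    have eq: "D (\<lambda>x. a x + b x) = (\<lambda>x. D a x + D b x)"
      using D_add[OF add(1,2)] by (simp add: gr_add)
    show ?case
      unfolding eq using add gr_finsupp[of "D a"] gr_finsupp[of "D b"]
      by (auto simp: gr_finsupp gr_add_carrier)
  qed
  note fs = gr_finsupp[of _ F]
  have D_mult: "D (f \<cdot> r) = D f \<cdot> r" if f: "f \<in> carrier I" and r: "r \<in> carrier R" for f r
  proof (rule gr_eqI)
    have fR: "f \<in> carrier R" using f by (rule I_R)
    have supp: "f x \<noteq> 0 \<Longrightarrow> x \<in> carrier F" "r x \<noteq> 0 \<Longrightarrow> x \<in> carrier F" for x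
      using fR r by (auto simp: gr_carrier)
    show "finsupp (D (f \<cdot> r))" "finsupp (D f \<cdot> r)"
      using D_closed_sum fR r by (auto intro!: fs)
    fix G
    have "gr_sum (D (f \<cdot> r)) G = gr_sum f (\<lambda>x. gr_sum r (\<lambda>y. gr_sum (d (x \<otimes>\<^bsub>F\<^esub> y)) G))"
      using D_closed_sum[of "f \<cdot> r"] fR r by (simp add: gr_sum_mult fs)
    also have "\<dots> = gr_sum f (\<lambda>x. gr_sum r (\<lambda>y.
        gr_sum (d x) (\<lambda>u. G (u \<otimes>\<^bsub>F\<^esub> y)) + gr_sum (d y) G))"
    proof (intro gr_sum_cong)
      fix x y assume "f x \<noteq> 0" "r y \<noteq> 0"
      then have xy: "x \<in> carrier F" "y \<in> carrier F" by (auto simp: supp)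
      then show "gr_sum (d (x \<otimes>\<^bsub>F\<^esub> y)) G = gr_sum (d x) (\<lambda>u. G (u \<otimes>\<^bsub>F\<^esub> y)) + gr_sum (d y) G"
        using fs[OF d(1)[OF xy(1)]] fs[OF d(1)[OF xy(2)]] finsupp_mult[of "d x" "sing 1 y" F]
        by (simp add: d(2) gr_add gr_sum_mult)
    qed
    also have "\<dots> = gr_sum f (\<lambda>x. gr_sum (d x) (\<lambda>u. gr_sum r (\<lambda>y. G (u \<otimes>\<^bsub>F\<^esub> y))))
        + aug f * gr_sum r (\<lambda>y. gr_sum (d y) G)"
      using gr_sum_multc[of f "\<lambda>x. 1" "gr_sum r (\<lambda>y. gr_sum (d y) G)"]
      by (simp add: aug_def) (intro gr_sum_cong gr_sum_swap)
    also have "\<dots> = gr_sum (D f \<cdot> r) G"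
      using D_closed_sum[OF fR] fR r f by (simp add: gr_sum_mult fs I_carrier)
    finally show "gr_sum (D (f \<cdot> r)) G = gr_sum (D f \<cdot> r) G" .
  qed
  have "d \<one>\<^bsub>F\<^esub> = \<zero>\<^bsub>R\<^esub>"
    using d(2)[of "\<one>\<^bsub>F\<^esub>" "\<one>\<^bsub>F\<^esub>"] d(1)[of "\<one>\<^bsub>F\<^esub>"] by (simp flip: gr_one)
  then have "D (Y k) = m k" if "k \<in> {1..n}" for k
    using that d(1)[OF fgen_carrier[OF that]] fgen_carrier[OF that]
    by (simp add: Y_alt xel_def gr_one diff_scale D_add D_single d(3) del: atLeastAtMost_iff)
       (simp add: gr_scale_def gr_add gr_zero)
  moreover have "right_linear D"
    using D_closed_sum D_add D_mult by (auto simp: semilinear_def I_R)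
  ultimately show ?thesis by blast
qed

text \<open>On the augmentation ideal the choice is unique, by \<open>semilinear_eq\<close>.\<close>

definition extend_gens :: "(nat \<Rightarrow> nat word set \<Rightarrow> 'k) \<Rightarrow> (nat word set \<Rightarrow> 'k) \<Rightarrow> nat word set \<Rightarrow> 'k" where
  "extend_gens m = (SOME D. right_linear D \<and> (\<forall>k\<in>{1..n}. D (Y k) = m k))"

lemma extend_gens:
  assumes "\<And>k. k \<in> {1..n} \<Longrightarrow> m k \<in> carrier R"
  shows "right_linear (extend_gens m)" "k \<in> {1..n} \<Longrightarrow> extend_gens m (Y k) = m k"
  using someI_ex[OF right_linear_exists[OF assms]] unfolding extend_gens_def by auto

end

section \<open>The twisted action on the augmentation ideal\<close>

lemma Bij_if_mod_iso: "D \<in> mod_iso S M M \<Longrightarrow> D \<in> Bij (carrier M)"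
  by (auto simp: mod_iso_def mod_hom_def Bij_def PiE_def)

text \<open>Inverses and composites of bijections that commute with the operations commute with them as
  well. The scalars are mere operators on \<open>M\<close>, so that the lemma applies to the augmentation ideal,
  which is a right module.\<close>

lemma group_mod_AutoGroup:
  assumes "abelian_group M"
    and smult: "\<And>r x. r \<in> carrier S \<Longrightarrow> x \<in> carrier M \<Longrightarrow> r \<odot>\<^bsub>M\<^esub> x \<in> carrier M"
  shows "group (mod_AutoGroup S M)"
proof -
  interpret M: abelian_group M by fact
  interpret B: group "BijGroup (carrier M)" by (rule group_BijGroup)
  have iso_iff: "D \<in> mod_iso S M M \<longleftrightarrow> D \<in> Bij (carrier M) \<and>
      (\<forall>x\<in>carrier M. \<forall>y\<in>carrier M. D (x \<oplus>\<^bsub>M\<^esub> y) = D x \<oplus>\<^bsub>M\<^esub> D y) \<and>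
      (\<forall>r\<in>carrier S. \<forall>x\<in>carrier M. D (r \<odot>\<^bsub>M\<^esub> x) = r \<odot>\<^bsub>M\<^esub> D x)" for D
    by (auto simp: mod_iso_def mod_hom_def Bij_def PiE_def dest: bij_betwE)
  have closed: "D x \<in> carrier M" if "D \<in> Bij (carrier M)" "x \<in> carrier M" for D x
    using Bij_imp_funcset[OF that(1)] that(2) by auto
  have "subgroup (mod_iso S M M) (BijGroup (carrier M))"
  proof (rule subgroup.intro)
    show "mod_iso S M M \<subseteq> carrier (BijGroup (carrier M))"
      by (auto simp: BijGroup_def Bij_if_mod_iso)
    show "\<one>\<^bsub>BijGroup (carrier M)\<^esub> \<in> mod_iso S M M"
      by (simp add: iso_iff BijGroup_def id_Bij smult)
    show "D \<otimes>\<^bsub>BijGroup (carrier M)\<^esub> E \<in> mod_iso S M M"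
      if "D \<in> mod_iso S M M" "E \<in> mod_iso S M M" for D E
      using that closed unfolding iso_iff
      by (auto simp: BijGroup_def compose_Bij compose_def smult)
         (metis compose_Bij compose_def)
    show "inv\<^bsub>BijGroup (carrier M)\<^esub> D \<in> mod_iso S M M" if D: "D \<in> mod_iso S M M" for D
    proof -
      let ?E = "\<lambda>x\<in>carrier M. inv_into (carrier M) D x"
      have B: "D \<in> Bij (carrier M)" and bij: "bij_betw D (carrier M) (carrier M)"
        using Bij_if_mod_iso[OF D] by (auto simp: Bij_def)
      have D_simps: "D (x \<oplus>\<^bsub>M\<^esub> y) = D x \<oplus>\<^bsub>M\<^esub> D y" "r \<in> carrier S \<Longrightarrow> D (r \<odot>\<^bsub>M\<^esub> x) = r \<odot>\<^bsub>M\<^esub> D x"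
        if "x \<in> carrier M" "y \<in> carrier M" for r x y
        using D that by (auto simp: iso_iff)
      have E: "inv_into (carrier M) D x \<in> carrier M" "D (inv_into (carrier M) D x) = x"
        if "x \<in> carrier M" for x
        using bij that by (auto simp: Bij_inv_into_mem[OF B] bij_betw_inv_into_right)
      have eqI: "inv_into (carrier M) D x = y" if "y \<in> carrier M" "D y = x" for x y
        using bij that by (auto simp: bij_betw_def)
      have "?E \<in> mod_iso S M M"
        unfolding iso_iff
        by (intro conjI ballI restrict_inv_into_Bij[OF B])
          (auto simp: E D_simps smult intro!: eqI)
      then show ?thesis using B by (simp add: inv_BijGroup)
    qed
  qed
  then show ?thesis
    unfolding mod_AutoGroup_def by (rule B.subgroup_imp_group)
qed

context twisted
begin

text \<open>On the basis, \<open>x\<^sub>i\<close> acts by \<open>Y k \<mapsto> Y k + Y i \<cdot> E i (Y k)\<close>, where \<open>E i (Y k)\<close> is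
  \<open>lam * Y k\<close> for \<open>k < i\<close>, \<open>lam * x\<^sub>i - 1\<close> for \<open>k = i\<close>, and \<open>Y k\<close> for \<open>k > i\<close>. So only the coefficient of
  \<open>Y i\<close> changes. The map \<open>Q i\<close> is the part of \<open>E i\<close> that comes with the factor \<open>lam - 1\<close>; it does
  not depend on \<open>lam\<close>, and this makes its behaviour under braids simple.\<close>

definition Q :: "nat \<Rightarrow> (nat word set \<Rightarrow> 'k) \<Rightarrow> nat word set \<Rightarrow> 'k" where
  "Q i = extend_gens (\<lambda>k. if k < i then Y k else if k = i then X i else \<zero>\<^bsub>R\<^esub>)"

definition E :: "nat \<Rightarrow> (nat word set \<Rightarrow> 'k) \<Rightarrow> nat word set \<Rightarrow> 'k" where
  "E i f = f +\<^sub>F (lam - 1) *\<^sub>F Q i f"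

definition T :: "nat \<Rightarrow> (nat word set \<Rightarrow> 'k) \<Rightarrow> nat word set \<Rightarrow> 'k" where
  "T i f = f +\<^sub>F Y i \<cdot> E i f"

definition T_inv :: "nat \<Rightarrow> (nat word set \<Rightarrow> 'k) \<Rightarrow> nat word set \<Rightarrow> 'k" where
  "T_inv i f = f -\<^sub>F Y i \<cdot> (sing (inverse lam) (inv\<^bsub>F\<^esub> (fgen n i)) \<cdot> E i f)"

lemma Q_right_linear: "i \<in> {1..n} \<Longrightarrow> right_linear (Q i)"
  and Q_Y: "i \<in> {1..n} \<Longrightarrow> k \<in> {1..n} \<Longrightarrow>
    Q i (Y k) = (if k < i then Y k else if k = i then X i else \<zero>\<^bsub>R\<^esub>)"
  unfolding Q_def by (rule extend_gens; simp del: atLeastAtMost_iff)+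

lemmas Q_simps = semilinearD[OF Q_right_linear]

lemma E_right_linear: "i \<in> {1..n} \<Longrightarrow> right_linear (E i)"
  unfolding semilinear_def E_def
  by (auto simp: Q_simps I_R R.l_distr scale_mul simp del: atLeastAtMost_iff)
    (simp add: gr_add gr_scale_def algebra_simps)

lemmas E_simps = semilinearD[OF E_right_linear]

lemma T_right_linear: "i \<in> {1..n} \<Longrightarrow> right_linear (T i)"
  unfolding semilinear_def T_def
  by (auto simp: E_simps I_R R.l_distr R.r_distr R.m_assoc R.a_ac simp del: atLeastAtMost_iff)

lemmas T_simps = semilinearD[OF T_right_linear]

lemma T_I: "i \<in> {1..n} \<Longrightarrow> f \<in> carrier I \<Longrightarrow> T i f \<in> carrier I"
  by (simp add: T_def E_simps del: atLeastAtMost_iff)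

lemma T_inv_I: "i \<in> {1..n} \<Longrightarrow> f \<in> carrier I \<Longrightarrow> T_inv i f \<in> carrier I"
  by (simp add: T_inv_def E_simps del: atLeastAtMost_iff)

lemma E_Y:
  assumes "i \<in> {1..n}"
  shows "E i (Y i) = lam *\<^sub>F X i -\<^sub>F \<one>\<^bsub>R\<^esub>"
  using assms
  by (simp add: E_def Q_Y del: atLeastAtMost_iff)
    (auto simp: Y_alt diff_fun gr_add gr_scale_def algebra_simps)

lemma scaled_generator_inverse:
  assumes "i \<in> {1..n}"
  shows "lam *\<^sub>F X i \<cdot> sing (inverse lam) (inv\<^bsub>F\<^esub> (fgen n i)) = \<one>\<^bsub>R\<^esub>"
    "sing (inverse lam) (inv\<^bsub>F\<^esub> (fgen n i)) \<cdot> lam *\<^sub>F X i = \<one>\<^bsub>R\<^esub>"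
  using lam_nonzero fgen_carrier[OF assms] by (simp_all add: xel_def gr_one)

lemma diff_diff_cancel [simp]:
  assumes "a \<in> carrier R" "b \<in> carrier R"
  shows "a -\<^sub>F (a -\<^sub>F b) = b"
proof -
  have "a -\<^sub>F (a -\<^sub>F b) = (\<lambda>x. a x - (a -\<^sub>F b) x)"
    by (rule diff_fun[OF R.minus_closed[OF assms]])
  then show ?thesis using assms(2) by (simp add: diff_fun)
qed

text \<open>Since \<open>E i (Y i) = u - 1\<close> with the unit \<open>u = lam * x\<^sub>i\<close>, the map \<open>f \<mapsto> f + Y i \<cdot> E i f\<close> is
  inverted by \<open>f \<mapsto> f - Y i \<cdot> u\<^sup>-\<^sup>1 \<cdot> E i f\<close>: it follows that \<open>E i (T i f) = u \<cdot> E i f\<close>.\<close>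

lemma T_T_inv:
  assumes i: "i \<in> {1..n}" and f: "f \<in> carrier I"
  shows "T_inv i (T i f) = f" "T i (T_inv i f) = f"
proof -
  let ?u = "lam *\<^sub>F X i" and ?v = "sing (inverse lam) (inv\<^bsub>F\<^esub> (fgen n i))"
  have uv: "?u \<in> carrier R" "?v \<in> carrier R"
    using i fgen_carrier[OF i] by (simp_all del: atLeastAtMost_iff)
  have Ef: "E i f \<in> carrier R" "Y i \<in> carrier I" "Y i \<in> carrier R"
    using i f by (simp_all add: E_simps del: atLeastAtMost_iff)
  have "E i (T i f) = E i f +\<^sub>F (?u -\<^sub>F \<one>\<^bsub>R\<^esub>) \<cdot> E i f"
    using i f Ef by (simp add: T_def E_simps E_Y del: atLeastAtMost_iff)
  also have "\<dots> = ?u \<cdot> E i f"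
    using Ef uv by (simp add: l_diff) (simp add: diff_fun gr_add)
  finally have "?v \<cdot> E i (T i f) = E i f"
    using Ef uv scaled_generator_inverse(2)[OF i] by (simp flip: R.m_assoc)
  then show "T_inv i (T i f) = f"
    using Ef f by (simp add: T_inv_def) (simp add: T_def diff_fun gr_add)
  let ?w = "?v \<cdot> E i f"
  have w: "?w \<in> carrier R" "Y i \<cdot> ?w \<in> carrier I" using Ef uv by simp_all
  have "E i (T_inv i f) = E i f -\<^sub>F (?u -\<^sub>F \<one>\<^bsub>R\<^esub>) \<cdot> ?w"
    using i f Ef w
    by (simp add: T_inv_def right_linear_diff[OF E_right_linear] E_simps E_Y del: atLeastAtMost_iff)
  also have "\<dots> = ?w"
    using Ef uv w scaled_generator_inverse(1)[OF i]
    by (simp add: l_diff flip: R.m_assoc[of ?u ?v])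
  finally show "T i (T_inv i f) = f"
    using Ef f w by (simp add: T_def) (simp add: T_inv_def diff_fun gr_add)
qed

text \<open>This is the formula by which the twisted action is specified. For \<open>k = i\<close> it uses that \<open>X i\<close> and
  \<open>Y i\<close> commute.\<close>

lemma T_Y:
  assumes "i \<in> {1..n}" "k \<in> {1..n}"
  shows "T i (Y k) = lam_ge lam i k *\<^sub>F (X i \<cdot> Y k) -\<^sub>F (lam_ge lam (i - 1) k - 1) *\<^sub>F Y k"
proof -
  note [simp del] = atLeastAtMost_iff One_nat_def
  have XY: "X i \<cdot> Y j = Y j +\<^sub>F Y i \<cdot> Y j" if "j \<in> {1..n}" for j
    using assms that by (simp add: Y_alt[of i] l_diff) (simp add: diff_fun gr_add)
  have YX: "Y i \<cdot> X i = X i \<cdot> Y i"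
    using assms by (simp add: Y_alt l_diff r_diff)
  have "T i (Y k) = Y k +\<^sub>F (Y i \<cdot> Y k +\<^sub>F (lam - 1) *\<^sub>F (Y i \<cdot> Q i (Y k)))"
    using assms by (simp add: T_def E_def Q_simps R.r_distr scale_mul)
  moreover have "i - 1 < k \<longleftrightarrow> i \<le> k" using assms by (auto simp: atLeastAtMost_iff)
  moreover have "k < i \<or> k = i \<or> i < k" by auto
  ultimately show ?thesis
    using assms
    by (elim disjE; simp add: lam_ge_def Q_Y XY YX diff_fun)
      (simp_all add: gr_add gr_scale_def gr_zero algebra_simps)
qed

lemma T_mod_iso:
  assumes i: "i \<in> {1..n}"
  shows "restrict (T i) (carrier I) \<in> mod_iso R I I"
proof -
  note [simp del] = atLeastAtMost_iff One_nat_def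
  have "bij_betw (T i) (carrier I) (carrier I)"
    by (rule bij_betw_byWitness[of _ "T_inv i"]) (auto simp: T_T_inv i T_I T_inv_I)
  then show ?thesis
    using i by (auto simp: mod_iso_def mod_hom_def T_simps T_I cong: bij_betw_cong)
qed

lemma group_Aut_I: "group (mod_AutoGroup R I)"
  by (rule group_mod_AutoGroup[OF abelian_group_I]) simp

lemma mod_iso_I:
  assumes "D \<in> mod_iso R I I"
  shows "D \<in> extensional (carrier I)" "f \<in> carrier I \<Longrightarrow> D f \<in> carrier I" "right_linear D"
  using assms by (auto simp: mod_iso_def mod_hom_def semilinear_def PiE_def I_R Pi_iff)

text \<open>The group is free, so any choice of automorphisms for the generators extends to an action. An
  automorphism of the augmentation ideal is determined by its values on the basis.\<close>

lemma ex1_twisted_action: "\<exists>!\<rho>. is_twisted_action n lam \<rho>"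
proof (rule ex_ex1I)
  have carr: "carrier (mod_AutoGroup R I) = mod_iso R I I" by (simp add: mod_AutoGroup_def)
  note [simp del] = atLeastAtMost_iff One_nat_def
  obtain \<rho> where "\<rho> \<in> hom F (mod_AutoGroup R I)" "\<rho> \<in> extensional (carrier F)"
    "\<And>i. i \<in> {1..n} \<Longrightarrow> \<rho> (fgen n i) = restrict (T i) (carrier I)"
    by (rule free_group_universal[OF group_Aut_I, of n "\<lambda>i. restrict (T i) (carrier I)"])
      (auto simp: carr T_mod_iso)
  then show "\<exists>\<rho>. is_twisted_action n lam \<rho>"
    by (intro exI[of _ \<rho>]) (simp add: is_twisted_action_def T_Y)
  fix \<rho> \<rho>' assume r: "is_twisted_action n lam \<rho>" "is_twisted_action n lam \<rho>'"
  then have hom: "\<rho> \<in> hom F (mod_AutoGroup R I)" "\<rho>' \<in> hom F (mod_AutoGroup R I)"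
    and ext: "\<rho> \<in> extensional (carrier F)" "\<rho>' \<in> extensional (carrier F)"
    unfolding is_twisted_action_def by blast+
  have gen: "\<rho> (fgen n i) = \<rho>' (fgen n i)" if i: "i \<in> {1..n}" for i
  proof -
    have iso: "\<rho> (fgen n i) \<in> mod_iso R I I" "\<rho>' (fgen n i) \<in> mod_iso R I I"
      using hom_in_carrier[OF hom(1) fgen_carrier[OF i]] hom_in_carrier[OF hom(2) fgen_carrier[OF i]]
      by (simp_all add: carr)
    show ?thesis
    proof (rule extensionalityI[OF mod_iso_I(1)[OF iso(1)] mod_iso_I(1)[OF iso(2)]])
      fix f assume "f \<in> carrier I"
      then show "\<rho> (fgen n i) f = \<rho>' (fgen n i) f"
        by (rule semilinear_eq[OF mod_iso_I(3)[OF iso(1)] mod_iso_I(3)[OF iso(2)], rotated])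
          (use r i in \<open>simp add: is_twisted_action_def\<close>)
    qed
  qed
  show "\<rho> = \<rho>'"
  proof (rule extensionalityI[OF ext])
    show "\<rho> x = \<rho>' x" if "x \<in> carrier F" for x
      by (rule free_group_hom_eq[OF group_Aut_I hom gen that])
  qed
qed

abbreviation "tw \<equiv> twisted_action n lam"

lemma is_twisted_action_tw: "is_twisted_action n lam tw"
  unfolding twisted_action_def using ex1_twisted_action by (rule theI')

lemma tw_hom: "tw \<in> hom F (mod_AutoGroup R I)"
  using is_twisted_action_tw by (simp add: is_twisted_action_def)

lemma tw_mod_iso: "x \<in> carrier F \<Longrightarrow> tw x \<in> mod_iso R I I"
  using hom_in_carrier[OF tw_hom] by (simp add: mod_AutoGroup_def)

lemma tw_I [simp]: "x \<in> carrier F \<Longrightarrow> f \<in> carrier I \<Longrightarrow> tw x f \<in> carrier I"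
  by (rule mod_iso_I(2)[OF tw_mod_iso])

lemma tw_right_linear: "x \<in> carrier F \<Longrightarrow> right_linear (tw x)"
  by (rule mod_iso_I(3)[OF tw_mod_iso])

lemma tw_mult:
  assumes "x \<in> carrier F" "y \<in> carrier F" "f \<in> carrier I"
  shows "tw (x \<otimes>\<^bsub>F\<^esub> y) f = tw x (tw y f)"
  using hom_mult[OF tw_hom assms(1,2)] Bij_if_mod_iso[OF tw_mod_iso] assms
  by (simp add: mod_AutoGroup_def BijGroup_def compose_def)

lemma tw_one: "f \<in> carrier I \<Longrightarrow> tw \<one>\<^bsub>F\<^esub> f = f"
  using hom_one[OF tw_hom group_free_group group_Aut_I]
  by (simp add: mod_AutoGroup_def BijGroup_def)

lemma tw_inv:
  assumes "x \<in> carrier F" "f \<in> carrier I"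
  shows "tw (inv\<^bsub>F\<^esub> x) (tw x f) = f" "tw x (tw (inv\<^bsub>F\<^esub> x) f) = f"
  using assms by (simp_all add: tw_one flip: tw_mult)

lemma tw_fgen: "i \<in> {1..n} \<Longrightarrow> f \<in> carrier I \<Longrightarrow> tw (fgen n i) f = T i f"
  by (rule semilinear_eq[OF tw_right_linear[OF fgen_carrier] T_right_linear])
    (use is_twisted_action_tw in \<open>simp_all add: is_twisted_action_def T_Y del: atLeastAtMost_iff\<close>)

section \<open>Braid automorphisms intertwine the twisted action\<close>

lemma gr_map_semilinear:
  assumes "s \<in> hom F F"
  shows "f \<in> carrier R \<Longrightarrow> gr_map s f \<in> carrier R"
    "f \<in> carrier I \<Longrightarrow> gr_map s f \<in> carrier I"
    "f \<in> carrier R \<Longrightarrow> g \<in> carrier R \<Longrightarrow> gr_map s (f +\<^sub>F g) = gr_map s f +\<^sub>F gr_map s g"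
    "f \<in> carrier R \<Longrightarrow> g \<in> carrier R \<Longrightarrow> gr_map s (f \<cdot> g) = gr_map s f \<cdot> gr_map s g"
    "f \<in> carrier R \<Longrightarrow> gr_map s (c *\<^sub>F f) = c *\<^sub>F gr_map s f"
    "gr_map s \<one>\<^bsub>R\<^esub> = \<one>\<^bsub>R\<^esub>" "gr_map s \<zero>\<^bsub>R\<^esub> = \<zero>\<^bsub>R\<^esub>"
proof -
  have s: "s \<in> carrier F \<rightarrow> carrier F" using assms by (auto simp: hom_def)
  show carr: "f \<in> carrier R \<Longrightarrow> gr_map s f \<in> carrier R" by (rule gr_map_carrier[OF s])
  show "f \<in> carrier I \<Longrightarrow> gr_map s f \<in> carrier I"
    using carr gr_finsupp[of f F] by (simp add: I_carrier aug_def)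
  show "f \<in> carrier R \<Longrightarrow> g \<in> carrier R \<Longrightarrow> gr_map s (f +\<^sub>F g) = gr_map s f +\<^sub>F gr_map s g"
    unfolding gr_add by (rule gr_map_add) (rule gr_finsupp, assumption)+
  show "f \<in> carrier R \<Longrightarrow> g \<in> carrier R \<Longrightarrow> gr_map s (f \<cdot> g) = gr_map s f \<cdot> gr_map s g"
    by (rule gr_map_mult[OF assms])
  show "f \<in> carrier R \<Longrightarrow> gr_map s (c *\<^sub>F f) = c *\<^sub>F gr_map s f"
    by (rule gr_map_scale[OF gr_finsupp])
  show "gr_map s \<one>\<^bsub>R\<^esub> = \<one>\<^bsub>R\<^esub>"
    using hom_one[OF assms group_free_group group_free_group] by (simp add: gr_one)
  show "gr_map s \<zero>\<^bsub>R\<^esub> = \<zero>\<^bsub>R\<^esub>" by (simp add: gr_zero gr_map_def)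
qed

text \<open>This is the compatibility by which the twisted action of the free group and the action of \<open>G\<close>
  fit together to an action of the semidirect product.\<close>

definition intertwines :: "(nat word set \<Rightarrow> nat word set) \<Rightarrow> bool" where
  "intertwines s \<longleftrightarrow> (\<forall>x\<in>carrier F. \<forall>f\<in>carrier I. gr_map s (tw x f) = tw (s x) (gr_map s f))"

lemma intertwinesI:
  assumes s: "s \<in> hom F F"
    and gen: "\<And>j f. j \<in> {1..n} \<Longrightarrow> f \<in> carrier I \<Longrightarrow>
      gr_map s (T j f) = tw (s (fgen n j)) (gr_map s f)"
  shows "intertwines s"
proof -
  interpret s: group_hom F F s using s by unfold_locales
  note A_I = gr_map_semilinear(2)[OF s]
  have gen': "gr_map s (tw (fgen n j) f) = tw (s (fgen n j)) (gr_map s f)"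
    if "j \<in> {1..n}" "f \<in> carrier I" for j f
    using gen[OF that] tw_fgen[OF that] by simp
  have "gr_map s (tw x f) = tw (s x) (gr_map s f)" if "x \<in> carrier F" "f \<in> carrier I" for x f
    using that
  proof (induction arbitrary: f rule: free_group_induct)
    case one
    then show ?case by (simp add: tw_one A_I)
  next
    case (gen j x)
    have "fgen n j \<in> carrier F" using gen(1) by (rule fgen_carrier)
    then show ?case using gen gen'[OF gen(1)] by (simp add: tw_mult A_I)
  next
    case (inv j x)
    let ?a = "fgen n j"
    have a: "?a \<in> carrier F" using inv(1) by (rule fgen_carrier)
    let ?h = "tw (inv\<^bsub>F\<^esub> ?a) (tw x f)"
    have h: "?h \<in> carrier I" using a inv by simp
    have "tw (s ?a) (gr_map s ?h) = tw (s x) (gr_map s f)"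
      using gen'[OF inv(1) h] inv a by (simp add: tw_inv)
    then have "gr_map s ?h = tw (inv\<^bsub>F\<^esub> (s ?a)) (tw (s x) (gr_map s f))"
      using tw_inv(1)[of "s ?a" "gr_map s ?h"] a h A_I by simp
    then show ?case using inv a by (simp add: tw_mult A_I)
  qed
  then show ?thesis by (simp add: intertwines_def)
qed

text \<open>With \<open>a = x\<^sub>i\<close>, \<open>b = x\<^sub>i\<^sub>+\<^sub>1\<close> and \<open>A\<close> the automorphism induced by \<open>s\<close>, everything
  follows from how \<open>A\<close> moves the maps \<open>Q\<^sub>j\<close>: it commutes with \<open>Q\<^sub>j\<close> for \<open>j \<noteq> i, i + 1\<close>,
  it carries \<open>Q\<^sub>i\<close> to \<open>Q\<^sub>i\<^sub>+\<^sub>1\<close>, and \<open>b A Q\<^sub>i\<^sub>+\<^sub>1 = Q\<^sub>i A + (b - 1) Q\<^sub>i\<^sub>+\<^sub>1 A\<close>. Each of these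
  identities is between semilinear maps and is checked on the basis.\<close>

lemma intertwines_generator:
  assumes i: "i \<in> {1..n - 1}" and s: "s \<in> hom F F"
    and s_i: "s (fgen n i) = fgen n (i + 1)"
    and s_i1: "s (fgen n (i + 1)) = inv\<^bsub>F\<^esub> (fgen n (i + 1)) \<otimes>\<^bsub>F\<^esub> fgen n i \<otimes>\<^bsub>F\<^esub> fgen n (i + 1)"
    and s_j: "\<And>j. j \<in> {1..n} - {i, i + 1} \<Longrightarrow> s (fgen n j) = fgen n j"
  shows "intertwines s"
proof (rule intertwinesI[OF s])
  note [simp del] = atLeastAtMost_iff One_nat_def
  define b where "b = i + 1"
  have ib: "i \<in> {1..n}" "b \<in> {1..n}" "i < b" "\<And>j. j < b \<longleftrightarrow> j \<le> i" "\<And>j. b \<le> j \<longleftrightarrow> i < j"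
    using i by (auto simp: b_def atLeastAtMost_iff)
  let ?xa = "fgen n i" and ?xb = "fgen n b" and ?A = "gr_map s"
  have xab: "?xa \<in> carrier F" "?xb \<in> carrier F" using ib fgen_carrier by blast+
  note A = gr_map_semilinear[OF s]
  have sb: "s ?xb = inv\<^bsub>F\<^esub> ?xb \<otimes>\<^bsub>F\<^esub> ?xa \<otimes>\<^bsub>F\<^esub> ?xb" "s ?xa = ?xb"
    using s_i1 s_i by (simp_all add: b_def)
  have sj: "s (fgen n j) = fgen n j" if "j \<in> {1..n}" "j \<noteq> i" "j \<noteq> b" for j
    using s_j that by (simp add: b_def)
  have A_X: "?A (X j) = X j" if "j \<in> {1..n}" "j \<noteq> i" "j \<noteq> b" for j
    using sj[OF that] by (simp add: xel_def)
  have A_diff: "?A (f -\<^sub>F g) = ?A f -\<^sub>F ?A g" if "f \<in> carrier R" "g \<in> carrier R" for f g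
    using that by (simp add: diff_scale A)
  have A_Y: "?A (Y j) = Y j" if "j \<in> {1..n}" "j \<noteq> i" "j \<noteq> b" for j
    using that by (simp add: Y_alt A_diff A_X A)
  have A_Xa: "?A (X i) = X b" by (simp add: xel_def sb)
  have A_Ya: "?A (Y i) = Y b" using ib by (simp add: Y_alt A_diff A_Xa A)
  define C where "C = ?A (Y b)"
  have A_Xb: "?A (X b) = sing 1 (inv\<^bsub>F\<^esub> ?xb \<otimes>\<^bsub>F\<^esub> ?xa \<otimes>\<^bsub>F\<^esub> ?xb)" by (simp add: xel_def sb)
  have bAXb: "X b \<cdot> ?A (X b) = X i \<cdot> X b"
    unfolding A_Xb using xab by (simp add: xel_def F.m_assoc)
  have bC: "X b \<cdot> C = Y i \<cdot> X b"
    using ib bAXb by (simp add: C_def Y_alt A_diff A r_diff l_diff)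
  have C_I: "C \<in> carrier I" "C \<in> carrier R" using ib by (simp_all add: C_def A)
  \<comment> \<open>\<open>C = b\<^sup>-\<^sup>1 a b - 1\<close> in terms of \<open>a - 1\<close> and \<open>b - 1\<close>, which is what allows to apply \<open>Q j\<close>\<close>
  have C_alt: "C = Y i \<cdot> X b -\<^sub>F Y b \<cdot> C"
    using ib C_I by (simp add: Y_alt[of b] l_diff flip: bC)
  have Q_C: "Q j C = Q j (Y i) \<cdot> X b -\<^sub>F Q j (Y b) \<cdot> C" if "j \<in> {1..n}" for j
    using that ib C_I
    by (subst C_alt) (simp add: right_linear_diff[OF Q_right_linear] Q_simps)
  have QYi: "Q i (Y b) = \<zero>\<^bsub>R\<^esub>" "Q i (Y i) = X i"
    using ib(3) by (simp_all add: Q_Y[OF ib(1)] ib(1,2))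
  have QYb: "Q b (Y i) = Y i" "Q b (Y b) = X b"
    using ib(3) by (simp_all add: Q_Y[OF ib(2)] ib(1,2))
  have comp_semilinear: "semilinear ?A (\<lambda>f. ?A (D f))" "semilinear ?A (\<lambda>f. D (?A f))"
    if D: "right_linear D" for D
    using semilinearD[OF D] by (auto simp: semilinear_def A I_R)
  have AQ: "?A (Q j f) = Q j (?A f)" if "f \<in> carrier I" "j \<in> {1..n}" "j \<noteq> i" "j \<noteq> b" for f j
  proof (rule semilinear_eq[OF comp_semilinear[OF Q_right_linear[OF that(2)]] _ that(1)])
    fix k assume k: "k \<in> {1..n}"
    consider "k = i" | "k = b" | "k \<noteq> i" "k \<noteq> b" by blast
    then show "?A (Q j (Y k)) = Q j (?A (Y k))"
    proof cases
      case 2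
      have "j < i \<or> b < j" using that ib(4)[of j] by auto
      then show ?thesis
      proof
        assume "j < i"
        then have "Q j (Y i) = \<zero>\<^bsub>R\<^esub>" "Q j (Y b) = \<zero>\<^bsub>R\<^esub>"
          using ib(3) by (auto simp: Q_Y[OF that(2) ib(1)] Q_Y[OF that(2) ib(2)])
        then show ?thesis using 2 that ib C_I Q_C[OF that(2)]
          by (simp add: A R.minus_eq flip: C_def)
      next
        assume "b < j"
        then have "Q j (Y i) = Y i" "Q j (Y b) = Y b"
          using ib(3) by (auto simp: Q_Y[OF that(2) ib(1)] Q_Y[OF that(2) ib(2)])
        then have "Q j C = C" using Q_C[OF that(2)] by (simp flip: C_alt)
        then show ?thesis using 2 \<open>Q j (Y b) = Y b\<close> by (simp flip: C_def)
      qed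
    next
      case 1
      have "i < j \<longleftrightarrow> b < j" using ib(5)[of j] that(4) by auto
      then show ?thesis
        using that(3,4)[symmetric] by (simp add: 1 Q_Y[OF that(2)] ib(1,2) A_Ya A)
    next
      case 3
      then show ?thesis using that k by (simp add: Q_Y A_Y A_X A)
    qed
  qed
  have AQa: "?A (Q i f) = Q b (?A f)" if "f \<in> carrier I" for f
  proof (rule semilinear_eq[OF comp_semilinear(1)[OF Q_right_linear[OF ib(1)]]
        comp_semilinear(2)[OF Q_right_linear[OF ib(2)]] _ that])
    fix k assume k: "k \<in> {1..n}"
    consider "k = i" | "k = b" | "k \<noteq> i" "k \<noteq> b" by blast
    then show "?A (Q i (Y k)) = Q b (?A (Y k))"
    proof cases
      case 2
      have "Q b C = \<zero>\<^bsub>R\<^esub>"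
        using Q_C[OF ib(2)] ib(1,2) C_I by (simp add: QYb bC R.minus_eq R.r_neg)
      then show ?thesis by (simp add: 2 QYi A flip: C_def)
    next
      case 1
      then show ?thesis by (simp add: QYi QYb A_Ya A_Xa)
    next
      case 3
      have "k < b \<longleftrightarrow> k < i" using ib(4)[of k] 3 by auto
      then show ?thesis using 3 ib(1,2) k by (simp add: Q_Y A_Y A)
    qed
  qed
  have QbC: "Q b C = \<zero>\<^bsub>R\<^esub>"
    using Q_C[OF ib(2)] ib(1,2) C_I by (simp add: QYb bC R.minus_eq R.r_neg)
  have AQb: "X b \<cdot> ?A (Q b f) = Q i (?A f) +\<^sub>F Y b \<cdot> Q b (?A f)" if "f \<in> carrier I" for f
  proof (rule semilinear_eq[of ?A _ _ f, OF _ _ _ that])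
    show "semilinear ?A (\<lambda>f. X b \<cdot> ?A (Q b f))"
      using ib by (auto simp: semilinear_def A I_R Q_simps R.r_distr R.m_assoc)
    show "semilinear ?A (\<lambda>f. Q i (?A f) +\<^sub>F Y b \<cdot> Q b (?A f))"
      using ib by (auto simp: semilinear_def A I_R Q_simps R.r_distr R.l_distr R.m_assoc R.a_ac)
    fix k assume k: "k \<in> {1..n}"
    have one_plus: "X b \<cdot> g = g +\<^sub>F Y b \<cdot> g" if "g \<in> carrier R" for g
      using that ib by (simp add: Y_alt l_diff) (simp add: diff_fun gr_add)
    have YX: "X b \<cdot> Y b = Y b \<cdot> X b" using ib by (simp add: Y_alt l_diff r_diff)
    consider "k = i" | "k = b" | "k \<noteq> i" "k \<noteq> b" by blast
    then show "X b \<cdot> ?A (Q b (Y k)) = Q i (?A (Y k)) +\<^sub>F Y b \<cdot> Q b (?A (Y k))"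
    proof cases
      case 1
      then show ?thesis using ib(1,2) by (simp add: QYi QYb A_Ya YX)
    next
      case 2
      have "Q i C = X i \<cdot> X b"
        using Q_C[OF ib(1)] ib C_I by (simp add: QYi R.minus_eq)
      then show ?thesis using ib QbC by (simp add: 2 QYb bAXb flip: C_def)
    next
      case 3
      have "k < b \<longleftrightarrow> k < i" using ib(4)[of k] 3 by auto
      then have "Q b (Y k) = Q i (Y k)" and "Q i (Y k) = Y k \<or> Q i (Y k) = \<zero>\<^bsub>R\<^esub>"
        using 3 by (auto simp: Q_Y[OF ib(1) k] Q_Y[OF ib(2) k])
      then show ?thesis
        using 3 ib(1,2) k one_plus[of "Y k"] by (elim disjE) (simp_all add: A_Y A)
    qed
  qed
  have A_E: "?A (E j f) = ?A f +\<^sub>F (lam - 1) *\<^sub>F ?A (Q j f)" if "f \<in> carrier I" "j \<in> {1..n}" for f j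
    using that by (simp add: E_def A Q_simps I_R)
  fix j f assume j: "j \<in> {1..n}" and f: "f \<in> carrier I"
  have A_T: "?A (T j f) = ?A f +\<^sub>F ?A (Y j) \<cdot> ?A (E j f)"
    using j f by (simp add: T_def A E_simps I_R)
  have Af: "?A f \<in> carrier I" "?A f \<in> carrier R" using f by (simp_all add: A I_R)
  consider "j = i" | "j = b" | "j \<noteq> i" "j \<noteq> b" by blast
  then show "?A (T j f) = tw (s (fgen n j)) (?A f)"
  proof cases
    case 1
    show ?thesis
      using ib(1,2) f A_T unfolding 1
      by (simp add: A_E AQa A_Ya sb tw_fgen Af) (simp add: T_def E_def)
  next
    case 3
    then show ?thesis
      using j f by (simp add: A_T A_E AQ A_Y sj tw_fgen Af) (simp add: T_def E_def)
  next
    case 2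
    define g where "g = ?A f"
    define u where "u = ?A (E b f)"
    define e where "e = E b g"
    have g: "g \<in> carrier I" "g \<in> carrier R" using Af by (simp_all add: g_def)
    have u: "u \<in> carrier R" using f ib by (simp add: u_def A E_simps)
    have e: "e \<in> carrier R" using g ib by (simp add: e_def E_simps)
    have Q_g: "Q i g \<in> carrier R" "Q b g \<in> carrier R" using g ib by (simp_all add: Q_simps)
    have ATb: "?A (T b f) = g +\<^sub>F C \<cdot> u"
      using A_T 2 by (simp add: g_def u_def C_def)
    have TbC: "T b C = Y i \<cdot> X b"
    proof -
      have "T b C = C +\<^sub>F Y b \<cdot> C"
        using C_I by (simp add: T_def E_def QbC) (simp add: gr_add gr_zero gr_scale_def)
      also have "\<dots> = X b \<cdot> C"
        using ib C_I by (simp add: Y_alt l_diff) (simp add: diff_fun gr_add)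
      finally show ?thesis using bC by simp
    qed
    \<comment> \<open>the difference of \<open>T b (A (T b f))\<close> and \<open>T i (T b (A f))\<close> is \<open>Y i\<close> times that of the two
      sides\<close>
    have bu: "X b \<cdot> u = E i g +\<^sub>F Y b \<cdot> e"
    proof -
      have "X b \<cdot> u = X b \<cdot> g +\<^sub>F (lam - 1) *\<^sub>F (X b \<cdot> ?A (Q b f))"
        using f ib g by (simp add: u_def A_E A Q_simps R.r_distr scale_mul flip: g_def)
      also have "\<dots> = E i g +\<^sub>F Y b \<cdot> e"
        using f ib g Q_g
        by (simp add: AQb e_def E_def R.r_distr scale_mul l_diff Y_alt flip: g_def)
          (simp add: diff_fun gr_add gr_scale_def algebra_simps)
      finally show ?thesis .
    qed
    have "T b (?A (T b f)) = g +\<^sub>F Y b \<cdot> e +\<^sub>F Y i \<cdot> (X b \<cdot> u)"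
      using ib g C_I u e
      by (simp add: ATb T_simps TbC R.m_assoc) (simp add: T_def e_def)
    also have "\<dots> = g +\<^sub>F Y b \<cdot> e +\<^sub>F (Y i \<cdot> E i g +\<^sub>F Y i \<cdot> (Y b \<cdot> e))"
      using ib g e by (simp add: bu R.r_distr E_simps)
    also have "\<dots> = T i (T b g)"
    proof -
      have "T i (Y b) = Y b +\<^sub>F Y i \<cdot> Y b"
        using ib(1,2) by (simp add: T_def E_def QYi) (simp add: gr_add gr_zero gr_scale_def)
      then have "T i (Y b \<cdot> e) = Y b \<cdot> e +\<^sub>F Y i \<cdot> (Y b \<cdot> e)"
        using ib e by (simp add: T_simps R.l_distr R.m_assoc)
      moreover have "T i g = g +\<^sub>F Y i \<cdot> E i g" by (simp add: T_def)
      moreover have "T b g = g +\<^sub>F Y b \<cdot> e" by (simp add: T_def e_def)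
      ultimately show ?thesis
        using ib g e by (simp add: T_simps) (simp add: gr_add algebra_simps)
    qed
    finally have "tw ?xb (?A (T b f)) = tw ?xa (tw ?xb g)"
      using ib g f by (simp add: tw_fgen T_I A)
    then have "?A (T b f) = tw (inv\<^bsub>F\<^esub> ?xb) (tw ?xa (tw ?xb g))"
      using tw_inv(1)[OF xab(2), of "?A (T b f)"] ib f by (simp add: T_I A)
    then show ?thesis
      using 2 xab g by (simp add: sb tw_mult F.m_assoc g_def)
  qed
qed

text \<open>The automorphisms that intertwine the twisted action with itself are closed under composition
  and inversion, so the generators of the braid group suffice.\<close>

lemma intertwines_artin_hom:
  assumes "\<beta> \<in> carrier (braid_group n)"
  shows "intertwines (artin_hom n \<beta>)"
proof -
  let ?B = "braid_group n" and ?\<theta> = "artin_hom n"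
  interpret B: group ?B by (rule group_braid_group)
  interpret A: group "AutoGroup F" by (rule F.AutoGroup)
  have is_artin: "is_artin_hom n ?\<theta>" by (rule is_artin_hom_artin_hom)
  interpret \<theta>: group_hom ?B "AutoGroup F" ?\<theta>
    using is_artin by unfold_locales (simp add: is_artin_hom_def)
  note [simp del] = \<theta>.hom_mult \<theta>.hom_one \<theta>.hom_inv
  have auto: "?\<theta> \<beta> \<in> auto F" if "\<beta> \<in> carrier ?B" for \<beta>
    using \<theta>.hom_closed[OF that] by (simp add: AutoGroup_def)
  have hom: "?\<theta> \<beta> \<in> hom F F" if "\<beta> \<in> carrier ?B" for \<beta>
    using auto[OF that] by (simp add: auto_def)
  have mult: "?\<theta> (\<beta> \<otimes>\<^bsub>?B\<^esub> \<gamma>) x = ?\<theta> \<beta> (?\<theta> \<gamma> x)"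
    if "\<beta> \<in> carrier ?B" "\<gamma> \<in> carrier ?B" "x \<in> carrier F" for \<beta> \<gamma> x
    using \<theta>.hom_mult[OF that(1,2)] auto[OF that(1)] auto[OF that(2)] that(3)
    by (simp add: AutoGroup_def BijGroup_def auto_def compose_def)
  have one: "?\<theta> \<one>\<^bsub>?B\<^esub> x = x" if "x \<in> carrier F" for x
    using \<theta>.hom_one that by (simp add: AutoGroup_def BijGroup_def)
  have supp: "f x \<noteq> 0 \<Longrightarrow> x \<in> carrier F" if "f \<in> carrier I" for f x
    using that by (auto simp: I_carrier gr_carrier)
  have map_mult: "gr_map (?\<theta> (\<beta> \<otimes>\<^bsub>?B\<^esub> \<gamma>)) f = gr_map (?\<theta> \<beta>) (gr_map (?\<theta> \<gamma>) f)"
    if "\<beta> \<in> carrier ?B" "\<gamma> \<in> carrier ?B" "f \<in> carrier I" for \<beta> \<gamma> f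
    using that by (intro gr_map_comp[symmetric] gr_finsupp[OF I_R] mult) (auto intro: supp)
  have map_one: "gr_map (?\<theta> \<one>\<^bsub>?B\<^esub>) f = f" if "f \<in> carrier I" for f
    using that by (intro gr_map_ident gr_finsupp[OF I_R]) (auto simp: one supp)
  note A_I = gr_map_semilinear(2)[OF hom]
  have closed: "?\<theta> \<beta> x \<in> carrier F" if "\<beta> \<in> carrier ?B" "x \<in> carrier F" for \<beta> x
    using hom_in_carrier[OF hom] that by blast
  have prod: "intertwines (?\<theta> (\<beta> \<otimes>\<^bsub>?B\<^esub> \<gamma>))"
    if "\<beta> \<in> carrier ?B" "\<gamma> \<in> carrier ?B" "intertwines (?\<theta> \<beta>)" "intertwines (?\<theta> \<gamma>)" for \<beta> \<gamma>
    using that by (auto simp: intertwines_def map_mult mult A_I closed)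
  have inverse: "intertwines (?\<theta> (inv\<^bsub>?B\<^esub> \<beta>))"
    if \<beta>: "\<beta> \<in> carrier ?B" and tw: "intertwines (?\<theta> \<beta>)" for \<beta>
    unfolding intertwines_def
  proof (intro ballI)
    fix x f assume x: "x \<in> carrier F" and f: "f \<in> carrier I"
    let ?x = "?\<theta> (inv\<^bsub>?B\<^esub> \<beta>) x" and ?f = "gr_map (?\<theta> (inv\<^bsub>?B\<^esub> \<beta>)) f"
    have xf: "?x \<in> carrier F" "?f \<in> carrier I" using \<beta> x f by (auto simp: closed A_I)
    have "?\<theta> \<beta> ?x = x" "gr_map (?\<theta> \<beta>) ?f = f"
      using mult[of \<beta> "inv\<^bsub>?B\<^esub> \<beta>" x] map_mult[of \<beta> "inv\<^bsub>?B\<^esub> \<beta>" f] \<beta> x f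
      by (simp_all add: one map_one)
    then have "gr_map (?\<theta> \<beta>) (tw ?x ?f) = tw x f"
      using tw xf by (simp add: intertwines_def)
    then show "gr_map (?\<theta> (inv\<^bsub>?B\<^esub> \<beta>)) (tw x f) = tw ?x ?f"
      using map_mult[of "inv\<^bsub>?B\<^esub> \<beta>" \<beta> "tw ?x ?f"] xf \<beta> by (simp add: map_one)
  qed
  have gen_tw: "intertwines (?\<theta> (bgen n i))" if "i \<in> {1..n - 1}" for i
    using is_artin that bgen_carrier[OF that]
    by (intro intertwines_generator[OF that hom]) (simp_all add: is_artin_hom_def)
  have one_tw: "intertwines (?\<theta> \<one>\<^bsub>?B\<^esub>)"
    by (simp add: intertwines_def one map_one)
  from assms show ?thesis
  proof (induction rule: braid_group_induct)
    case (gen i \<beta>)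
    show ?case by (rule prod[OF bgen_carrier[OF gen(1)] gen(2) gen_tw[OF gen(1)] gen(3)])
  next
    case (inv i \<beta>)
    note b = bgen_carrier[OF inv(1)]
    show ?case
      by (rule prod[OF B.inv_closed[OF b] inv(2) inverse[OF b gen_tw[OF inv(1)]] inv(3)])
  qed (rule one_tw)
qed

end

section \<open>The twisted Long-Moody functor\<close>

locale twisted_rep = twisted n lam for n :: nat and lam :: "'k::field" +
  fixes G :: "('g, 'm) monoid_scheme" and \<alpha> :: "'g \<Rightarrow> nat word set \<Rightarrow> nat word set"
  assumes artin: "artin_representation n G \<alpha>"
begin

abbreviation "SD \<equiv> semidirect F G \<alpha>"
abbreviation RG :: "(nat word set \<times> 'g \<Rightarrow> 'k) ring" where "RG \<equiv> kFG n G \<alpha>"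

sublocale G: group G using artin by (simp add: artin_representation_def)

lemma alpha_hom_Auto: "\<alpha> \<in> hom G (AutoGroup F)"
  using artin by (simp add: artin_representation_def)

lemma alpha_auto: "g \<in> carrier G \<Longrightarrow> \<alpha> g \<in> auto F"
  using hom_in_carrier[OF alpha_hom_Auto] by (simp add: AutoGroup_def)

lemma alpha_hom: "g \<in> carrier G \<Longrightarrow> \<alpha> g \<in> hom F F"
  using alpha_auto by (simp add: auto_def)

lemma alpha_closed [simp]: "g \<in> carrier G \<Longrightarrow> x \<in> carrier F \<Longrightarrow> \<alpha> g x \<in> carrier F"
  by (rule hom_in_carrier[OF alpha_hom])

lemma alpha_mult: "g \<in> carrier G \<Longrightarrow> h \<in> carrier G \<Longrightarrow> x \<in> carrier F \<Longrightarrow> \<alpha> (g \<otimes>\<^bsub>G\<^esub> h) x = \<alpha> g (\<alpha> h x)"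
  using hom_mult[OF alpha_hom_Auto, of g h] alpha_auto[of g] alpha_auto[of h]
  by (simp add: AutoGroup_def BijGroup_def auto_def compose_def)

lemma alpha_one: "x \<in> carrier F \<Longrightarrow> \<alpha> \<one>\<^bsub>G\<^esub> x = x"
  using hom_one[OF alpha_hom_Auto G.is_group F.AutoGroup]
  by (simp add: AutoGroup_def BijGroup_def)

lemma alpha_fone: "g \<in> carrier G \<Longrightarrow> \<alpha> g \<one>\<^bsub>F\<^esub> = \<one>\<^bsub>F\<^esub>"
  by (rule hom_one[OF alpha_hom group_free_group group_free_group])

lemma alpha_fmult: "g \<in> carrier G \<Longrightarrow> x \<in> carrier F \<Longrightarrow> y \<in> carrier F \<Longrightarrow>
    \<alpha> g (x \<otimes>\<^bsub>F\<^esub> y) = \<alpha> g x \<otimes>\<^bsub>F\<^esub> \<alpha> g y"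
  by (rule hom_mult[OF alpha_hom])

lemma intertwines_alpha:
  assumes "g \<in> carrier G"
  shows "intertwines (\<alpha> g)"
proof -
  obtain \<beta> where "\<beta> \<in> hom G (braid_group n)" "\<alpha> g = artin_hom n (\<beta> g)"
    using artin assms by (auto simp: artin_representation_def)
  then show ?thesis using intertwines_artin_hom hom_in_carrier assms by metis
qed

lemma SD_simps:
  "carrier SD = carrier F \<times> carrier G" "\<one>\<^bsub>SD\<^esub> = (\<one>\<^bsub>F\<^esub>, \<one>\<^bsub>G\<^esub>)"
  "(x, g) \<otimes>\<^bsub>SD\<^esub> (y, h) = (x \<otimes>\<^bsub>F\<^esub> \<alpha> g y, g \<otimes>\<^bsub>G\<^esub> h)"
  by (simp_all add: semidirect_def)

lemma group_SD: "group SD"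
proof (rule groupI)
  fix p assume "p \<in> carrier SD"
  then obtain x g where p: "p = (x, g)" "x \<in> carrier F" "g \<in> carrier G" by (auto simp: SD_simps)
  have "(\<alpha> (inv\<^bsub>G\<^esub> g) (inv\<^bsub>F\<^esub> x), inv\<^bsub>G\<^esub> g) \<otimes>\<^bsub>SD\<^esub> p = \<one>\<^bsub>SD\<^esub>"
    using p by (simp add: SD_simps alpha_fone flip: alpha_fmult)
  then show "\<exists>q\<in>carrier SD. q \<otimes>\<^bsub>SD\<^esub> p = \<one>\<^bsub>SD\<^esub>"
    using p by (intro bexI[of _ "(\<alpha> (inv\<^bsub>G\<^esub> g) (inv\<^bsub>F\<^esub> x), inv\<^bsub>G\<^esub> g)"]) (auto simp: SD_simps)
qed (auto simp: SD_simps alpha_mult alpha_fmult alpha_one F.m_assoc G.m_assoc)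

lemma ring_RG: "ring RG"
  by (rule ring_group_ring[OF group_SD])

lemma incF_hom: "(\<lambda>x. (x, \<one>\<^bsub>G\<^esub>)) \<in> hom F SD"
  by (auto simp: hom_def SD_simps alpha_one)

lemma incG_hom: "(\<lambda>g. (\<one>\<^bsub>F\<^esub>, g)) \<in> hom G SD"
  by (auto simp: hom_def SD_simps alpha_fone)

lemma incF_ring_hom: "incF G \<in> ring_hom R RG"
  unfolding incF_def by (rule gr_map_ring_hom[OF group_free_group group_SD incF_hom])

lemma incG_ring_hom: "incG n \<in> ring_hom (group_ring G) RG"
  unfolding incG_def by (rule gr_map_ring_hom[OF G.is_group group_SD incG_hom])

lemma incF_closed [simp]: "r \<in> carrier R \<Longrightarrow> incF G r \<in> carrier RG"
  using incF_ring_hom by (auto simp: ring_hom_def)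

lemma single_RG [simp]: "x \<in> carrier F \<Longrightarrow> g \<in> carrier G \<Longrightarrow> gr_single c (x, g) \<in> carrier RG"
  by (rule gr_single_carrier) (simp add: SD_simps)

text \<open>This is what makes \<open>g\<close> semilinear along \<open>\<alpha> g\<close> on \<open>V\<close>. It extends the relation
  \<open>g x = (\<alpha> g x) g\<close> of the semidirect product linearly in \<open>x\<close>.\<close>

lemma single_incF_commute:
  assumes "g \<in> carrier G" "r \<in> carrier R"
  shows "gr_single 1 (\<one>\<^bsub>F\<^esub>, g) \<otimes>\<^bsub>RG\<^esub> incF G r = incF G (gr_map (\<alpha> g) r) \<otimes>\<^bsub>RG\<^esub> gr_single 1 (\<one>\<^bsub>F\<^esub>, g)"
proof -
  have "finsupp r" and supp: "r x \<noteq> 0 \<Longrightarrow> x \<in> carrier F" for x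
    using assms by (auto simp: gr_carrier)
  then show ?thesis
    using assms unfolding incF_def
    by (intro gr_eqI finsupp_mult finsupp_gr_map finsupp_single)
      (auto simp: gr_sum_mult SD_simps alpha_fone alpha_one intro!: gr_sum_cong)
qed

end

locale twisted_module = twisted_rep n lam G \<alpha> + V: left_module RG V
  for n :: nat and lam :: "'k::field" and G :: "('g, 'm) monoid_scheme" and \<alpha>
    and V :: "(nat word set \<times> 'g \<Rightarrow> 'k, 'v) module"
begin

abbreviation "VF \<equiv> restrict_scalars (incF G) V"
abbreviation "L \<equiv> LM_group n G V"
abbreviation elt (infixl \<open>\<otimes>\<^sub>V\<close> 70) where "f \<otimes>\<^sub>V v \<equiv> LM_elt n G V f v"

lemma left_module_VF: "left_module R VF"
  by (rule left_module_restrict_scalars[OF V.left_module_axioms R.ring_axioms incF_ring_hom])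

sublocale VF: left_module R VF by (rule left_module_VF)

sublocale P: tensor_pair R I VF
  by (intro tensor_pair.intro tensor_pair_axioms.intro abelian_group_I VF.M.abelian_group_axioms)
    (simp_all add: V.smult_closed)

lemma L_eq: "tensor_product R I VF = L"
  by (simp add: LM_group_def)

lemma elt_eq: "tensor_elt R I VF f v = f \<otimes>\<^sub>V v"
  by (simp add: LM_elt_def)

lemmas elt_simps [simp] = P.tensor_closed[unfolded L_eq elt_eq restrict_scalars_simps]
lemmas elt_add_left = P.tensor_add_left[unfolded L_eq elt_eq restrict_scalars_simps I_simps]
lemmas elt_add_right = P.tensor_add_right[unfolded L_eq elt_eq restrict_scalars_simps]
lemmas elt_balanced = P.tensor_balanced[unfolded L_eq elt_eq restrict_scalars_simps I_simps]
lemmas elt_zero_left = P.tensor_zero_left[unfolded L_eq elt_eq restrict_scalars_simps I_simps]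
lemmas L_hom_eq = P.tensor_hom_eq[unfolded L_eq elt_eq restrict_scalars_simps]

sublocale L: abelian_group L
  using P.abelian_group_T unfolding L_eq .

lemma group_elt_closed [simp]: "g \<in> carrier G \<Longrightarrow> v \<in> carrier V \<Longrightarrow> gr_single 1 (\<one>\<^bsub>F\<^esub>, g) \<odot>\<^bsub>V\<^esub> v \<in> carrier V"
  by (rule V.smult_closed) simp_all

end

context twisted_rep
begin

text \<open>All maps of tensor products that occur are \<open>D \<otimes> \<phi>\<close> with \<open>D\<close> semilinear along \<open>\<tau>\<close>
  and \<open>\<phi>\<close> semilinear along the same \<open>\<tau>\<close>.\<close>

lemma LM_tensor_map:
  assumes "left_module RG V" "left_module RG W"
    and D: "semilinear \<tau> D" and D_I: "\<And>f. f \<in> carrier I \<Longrightarrow> D f \<in> carrier I"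
    and \<tau>: "\<And>r. r \<in> carrier R \<Longrightarrow> \<tau> r \<in> carrier R"
    and phi: "\<And>v. v \<in> carrier V \<Longrightarrow> \<phi> v \<in> carrier W"
    and add: "\<And>v w. v \<in> carrier V \<Longrightarrow> w \<in> carrier V \<Longrightarrow> \<phi> (v \<oplus>\<^bsub>V\<^esub> w) = \<phi> v \<oplus>\<^bsub>W\<^esub> \<phi> w"
    and smult: "\<And>r v. r \<in> carrier R \<Longrightarrow> v \<in> carrier V \<Longrightarrow>
      \<phi> (incF G r \<odot>\<^bsub>V\<^esub> v) = incF G (\<tau> r) \<odot>\<^bsub>W\<^esub> \<phi> v"
  shows "f \<in> carrier I \<Longrightarrow> v \<in> carrier V \<Longrightarrow>
      LM_tensor_map n G W D \<phi> (LM_elt n G V f v) = LM_elt n G W (D f) (\<phi> v)"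
    and "t \<in> carrier (LM_group n G V) \<Longrightarrow> LM_tensor_map n G W D \<phi> t \<in> carrier (LM_group n G W)"
    and "t \<in> carrier (LM_group n G V) \<Longrightarrow> u \<in> carrier (LM_group n G V) \<Longrightarrow>
      LM_tensor_map n G W D \<phi> (t \<oplus>\<^bsub>LM_group n G V\<^esub> u) =
      LM_tensor_map n G W D \<phi> t \<oplus>\<^bsub>LM_group n G W\<^esub> LM_tensor_map n G W D \<phi> u"
proof -
  interpret V: twisted_module n lam G \<alpha> V
    by (rule twisted_module.intro[OF twisted_rep_axioms assms(1)])
  interpret W: twisted_module n lam G \<alpha> W
    by (rule twisted_module.intro[OF twisted_rep_axioms assms(2)])
  note * = tensor_map_well_defined[OF V.P.tensor_pair_axioms W.P.tensor_pair_axioms,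
      where f = D and g = \<phi>, unfolded V.L_eq W.L_eq V.elt_eq W.elt_eq, folded LM_tensor_map_def,
      unfolded restrict_scalars_simps I_simps]
  have bal: "LM_elt n G W (D (f \<cdot> r)) (\<phi> v) = LM_elt n G W (D f) (\<phi> (incF G r \<odot>\<^bsub>V\<^esub> v))"
    if "f \<in> carrier I" "r \<in> carrier R" "v \<in> carrier V" for f r v
    using that semilinearD(3)[OF D] W.elt_balanced[of "D f" "\<tau> r" "\<phi> v"] by (simp add: D_I \<tau> phi smult)
  note D_add = semilinearD(2)[OF D]
  show "f \<in> carrier I \<Longrightarrow> v \<in> carrier V \<Longrightarrow>
      LM_tensor_map n G W D \<phi> (LM_elt n G V f v) = LM_elt n G W (D f) (\<phi> v)"
    by (rule *(1); (assumption | rule D_I phi D_add add bal))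
  show "t \<in> carrier (LM_group n G V) \<Longrightarrow> LM_tensor_map n G W D \<phi> t \<in> carrier (LM_group n G W)"
    by (rule *(2); (assumption | rule D_I phi D_add add bal))
  show "t \<in> carrier (LM_group n G V) \<Longrightarrow> u \<in> carrier (LM_group n G V) \<Longrightarrow>
      LM_tensor_map n G W D \<phi> (t \<oplus>\<^bsub>LM_group n G V\<^esub> u) =
      LM_tensor_map n G W D \<phi> t \<oplus>\<^bsub>LM_group n G W\<^esub> LM_tensor_map n G W D \<phi> u"
    by (rule *(3); (assumption | rule D_I phi D_add add bal))
qed

lemma right_linear_ident: "right_linear (\<lambda>f. f)"
  by (auto simp: semilinear_def I_R)

lemma right_linear_gr_scale: "right_linear (gr_scale c)"
  unfolding semilinear_def
  by (auto simp: I_R scale_mul) (simp add: gr_add gr_scale_def algebra_simps)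

end

context twisted_module
begin

lemma scalar_props:
  "f \<in> carrier I \<Longrightarrow> v \<in> carrier V \<Longrightarrow> LM_scalar n G V c (f \<otimes>\<^sub>V v) = (c *\<^sub>F f) \<otimes>\<^sub>V v"
  "t \<in> carrier L \<Longrightarrow> LM_scalar n G V c t \<in> carrier L"
  "t \<in> carrier L \<Longrightarrow> u \<in> carrier L \<Longrightarrow>
    LM_scalar n G V c (t \<oplus>\<^bsub>L\<^esub> u) = LM_scalar n G V c t \<oplus>\<^bsub>L\<^esub> LM_scalar n G V c u"
  unfolding LM_scalar_def
  by (rule LM_tensor_map[OF V.left_module_axioms V.left_module_axioms right_linear_gr_scale];
      simp add: I_R)+

lemma actF_props:
  assumes x: "x \<in> carrier F"
  shows "f \<in> carrier I \<Longrightarrow> v \<in> carrier V \<Longrightarrow> LM_actF n G lam V x (f \<otimes>\<^sub>V v) = tw x f \<otimes>\<^sub>V v"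
    "t \<in> carrier L \<Longrightarrow> LM_actF n G lam V x t \<in> carrier L"
    "t \<in> carrier L \<Longrightarrow> u \<in> carrier L \<Longrightarrow>
      LM_actF n G lam V x (t \<oplus>\<^bsub>L\<^esub> u) = LM_actF n G lam V x t \<oplus>\<^bsub>L\<^esub> LM_actF n G lam V x u"
  unfolding LM_actF_def
  by (rule LM_tensor_map[OF V.left_module_axioms V.left_module_axioms tw_right_linear[OF x]];
      simp add: x)+

lemma actG_props:
  assumes g: "g \<in> carrier G"
  shows "f \<in> carrier I \<Longrightarrow> v \<in> carrier V \<Longrightarrow>
      LM_actG n G \<alpha> V g (f \<otimes>\<^sub>V v) = gr_map (\<alpha> g) f \<otimes>\<^sub>V (gr_single 1 (\<one>\<^bsub>F\<^esub>, g) \<odot>\<^bsub>V\<^esub> v)"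
    "t \<in> carrier L \<Longrightarrow> LM_actG n G \<alpha> V g t \<in> carrier L"
    "t \<in> carrier L \<Longrightarrow> u \<in> carrier L \<Longrightarrow>
      LM_actG n G \<alpha> V g (t \<oplus>\<^bsub>L\<^esub> u) = LM_actG n G \<alpha> V g t \<oplus>\<^bsub>L\<^esub> LM_actG n G \<alpha> V g u"
proof -
  note A = gr_map_semilinear[OF alpha_hom[OF g]]
  have D: "semilinear (gr_map (\<alpha> g)) (gr_map (\<alpha> g))"
    by (auto simp: semilinear_def A I_R)
  have smult: "gr_single 1 (\<one>\<^bsub>F\<^esub>, g) \<odot>\<^bsub>V\<^esub> (incF G r \<odot>\<^bsub>V\<^esub> v)
      = incF G (gr_map (\<alpha> g) r) \<odot>\<^bsub>V\<^esub> (gr_single 1 (\<one>\<^bsub>F\<^esub>, g) \<odot>\<^bsub>V\<^esub> v)"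
    if "r \<in> carrier R" "v \<in> carrier V" for r v
    using that g A(1)[OF that(1)] by (simp add: single_incF_commute flip: V.smult_assoc)
  show "f \<in> carrier I \<Longrightarrow> v \<in> carrier V \<Longrightarrow>
      LM_actG n G \<alpha> V g (f \<otimes>\<^sub>V v) = gr_map (\<alpha> g) f \<otimes>\<^sub>V (gr_single 1 (\<one>\<^bsub>F\<^esub>, g) \<odot>\<^bsub>V\<^esub> v)"
    "t \<in> carrier L \<Longrightarrow> LM_actG n G \<alpha> V g t \<in> carrier L"
    "t \<in> carrier L \<Longrightarrow> u \<in> carrier L \<Longrightarrow>
      LM_actG n G \<alpha> V g (t \<oplus>\<^bsub>L\<^esub> u) = LM_actG n G \<alpha> V g t \<oplus>\<^bsub>L\<^esub> LM_actG n G \<alpha> V g u"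
    unfolding LM_actG_def
    by (rule LM_tensor_map[OF V.left_module_axioms V.left_module_axioms D];
        simp add: A g V.smult_r_distr smult)+
qed

abbreviation "scalar \<equiv> LM_scalar n G V"
abbreviation "actF \<equiv> LM_actF n G lam V"
abbreviation "actG \<equiv> LM_actG n G \<alpha> V"

lemma scalar_plus:
  assumes "t \<in> carrier L"
  shows "scalar (c + d) t = scalar c t \<oplus>\<^bsub>L\<^esub> scalar d t"
proof (rule L_hom_eq[where A = L, OF assms])
  fix f v assume "f \<in> carrier I" "v \<in> carrier V"
  moreover have "(c + d) *\<^sub>F f = c *\<^sub>F f +\<^sub>F d *\<^sub>F f"
    by (simp add: gr_add gr_scale_def algebra_simps)
  ultimately show "scalar (c + d) (f \<otimes>\<^sub>V v) = scalar c (f \<otimes>\<^sub>V v) \<oplus>\<^bsub>L\<^esub> scalar d (f \<otimes>\<^sub>V v)"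
    by (simp add: scalar_props elt_add_left)
qed (simp_all add: scalar_props L.a_ac)

lemma scalar_mult: "t \<in> carrier L \<Longrightarrow> scalar (c * d) t = scalar c (scalar d t)"
  by (erule L_hom_eq[where A = L]) (simp_all add: scalar_props)

lemma scalar_one: "t \<in> carrier L \<Longrightarrow> scalar 1 t = t"
  by (erule L_hom_eq[where A = L]) (simp_all add: scalar_props)

lemma actF_mult:
  "x \<in> carrier F \<Longrightarrow> y \<in> carrier F \<Longrightarrow> t \<in> carrier L \<Longrightarrow> actF (x \<otimes>\<^bsub>F\<^esub> y) t = actF x (actF y t)"
  by (rule L_hom_eq[where A = L and t = t]) (simp_all add: actF_props tw_mult)

lemma actF_one: "t \<in> carrier L \<Longrightarrow> actF \<one>\<^bsub>F\<^esub> t = t"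
  by (erule L_hom_eq[where A = L]) (simp_all add: actF_props tw_one)

lemma actF_scalar: "x \<in> carrier F \<Longrightarrow> t \<in> carrier L \<Longrightarrow> actF x (scalar c t) = scalar c (actF x t)"
  by (rule L_hom_eq[where A = L and t = t])
    (simp_all add: actF_props scalar_props right_linear_scale[OF tw_right_linear])

lemma actG_mult:
  assumes "g \<in> carrier G" "h \<in> carrier G" "t \<in> carrier L"
  shows "actG (g \<otimes>\<^bsub>G\<^esub> h) t = actG g (actG h t)"
proof (rule L_hom_eq[where A = L, OF assms(3)])
  fix f v assume f: "f \<in> carrier I" and v: "v \<in> carrier V"
  have "gr_map (\<alpha> (g \<otimes>\<^bsub>G\<^esub> h)) f = gr_map (\<alpha> g) (gr_map (\<alpha> h) f)"
    using f assms by (intro gr_map_comp[symmetric] gr_finsupp[OF I_R] alpha_mult)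
      (auto simp: I_carrier gr_carrier)
  moreover have "gr_single 1 (\<one>\<^bsub>F\<^esub>, g \<otimes>\<^bsub>G\<^esub> h) \<odot>\<^bsub>V\<^esub> v
      = gr_single 1 (\<one>\<^bsub>F\<^esub>, g) \<odot>\<^bsub>V\<^esub> (gr_single 1 (\<one>\<^bsub>F\<^esub>, h) \<odot>\<^bsub>V\<^esub> v)"
    using v assms by (simp add: SD_simps alpha_fone flip: V.smult_assoc)
  ultimately show "actG (g \<otimes>\<^bsub>G\<^esub> h) (f \<otimes>\<^sub>V v) = actG g (actG h (f \<otimes>\<^sub>V v))"
    using f v assms gr_map_semilinear(2)[OF alpha_hom] by (simp add: actG_props)
qed (use assms in \<open>simp_all add: actG_props\<close>)

lemma actG_one:
  assumes "t \<in> carrier L"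
  shows "actG \<one>\<^bsub>G\<^esub> t = t"
proof (rule L_hom_eq[where A = L, OF assms])
  fix f v assume f: "f \<in> carrier I" and v: "v \<in> carrier V"
  have "gr_map (\<alpha> \<one>\<^bsub>G\<^esub>) f = f"
    using f by (intro gr_map_ident gr_finsupp[OF I_R] alpha_one) (auto simp: I_carrier gr_carrier)
  moreover have "gr_single 1 (\<one>\<^bsub>F\<^esub>, \<one>\<^bsub>G\<^esub>) \<odot>\<^bsub>V\<^esub> v = v"
    using V.smult_one[OF v] by (simp add: gr_one SD_simps)
  ultimately show "actG \<one>\<^bsub>G\<^esub> (f \<otimes>\<^sub>V v) = f \<otimes>\<^sub>V v"
    using f v by (simp add: actG_props)
qed (simp_all add: actG_props)

lemma actG_scalar: "g \<in> carrier G \<Longrightarrow> t \<in> carrier L \<Longrightarrow> actG g (scalar c t) = scalar c (actG g t)"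
  by (rule L_hom_eq[where A = L and t = t])
    (simp_all add: actG_props scalar_props gr_map_semilinear[OF alpha_hom] I_R)

lemma actG_actF:
  "g \<in> carrier G \<Longrightarrow> x \<in> carrier F \<Longrightarrow> t \<in> carrier L \<Longrightarrow> actG g (actF x t) = actF (\<alpha> g x) (actG g t)"
  by (rule L_hom_eq[where A = L and t = t])
    (simp_all add: actG_props actF_props gr_map_semilinear[OF alpha_hom]
      intertwines_alpha[unfolded intertwines_def])

abbreviation "actFG \<equiv> (\<lambda>(x, g) t. actF x (actG g t))"

sublocale LG: linear_rep G L scalar actG
  by unfold_locales
    (simp_all add: scalar_props scalar_plus scalar_mult scalar_one actG_props actG_scalar
      actG_mult actG_one)

text \<open>Multiplicativity holds because \<open>actG_actF\<close> exchanges the two factors as in the semidirect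
  product.\<close>

sublocale LFG: linear_rep SD L scalar actFG
proof -
  interpret SD: group SD by (rule group_SD)
  show "linear_rep SD L scalar actFG"
    by unfold_locales
      (auto simp: SD_simps scalar_props scalar_plus scalar_mult scalar_one actG_props actF_props
        actG_scalar actF_scalar actG_mult actG_one actF_mult actF_one actG_actF)
qed

lemma obj_LM: "obj (LM n G \<alpha>) V = with_smult L LG.lact"
  by (simp add: LM_def)

lemma obj_LM_lam: "obj (LM_lam n G \<alpha> lam) V = with_smult L LFG.lact"
  by (simp add: LM_lam_def)

lemma left_module_LM: "left_module (group_ring G) (obj (LM n G \<alpha>) V)"
  unfolding obj_LM by (rule LG.left_module_lact)

lemma left_module_LM_lam: "left_module RG (obj (LM_lam n G \<alpha> lam) V)"
  unfolding obj_LM_lam by (rule LFG.left_module_lact)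

end

context twisted_rep
begin

lemma twisted_moduleI: "left_module RG V \<Longrightarrow> twisted_module n lam G \<alpha> V"
  by (rule twisted_module.intro[OF twisted_rep_axioms])

lemma LM_arr_props:
  assumes "left_module RG V" "left_module RG W" "\<phi> \<in> mod_hom RG V W"
  shows "f \<in> carrier I \<Longrightarrow> v \<in> carrier V \<Longrightarrow> LM_arr n G V W \<phi> (LM_elt n G V f v) = LM_elt n G W f (\<phi> v)"
    and "t \<in> carrier (LM_group n G V) \<Longrightarrow> LM_arr n G V W \<phi> t \<in> carrier (LM_group n G W)"
    and "t \<in> carrier (LM_group n G V) \<Longrightarrow> u \<in> carrier (LM_group n G V) \<Longrightarrow>
      LM_arr n G V W \<phi> (t \<oplus>\<^bsub>LM_group n G V\<^esub> u) =
      LM_arr n G V W \<phi> t \<oplus>\<^bsub>LM_group n G W\<^esub> LM_arr n G V W \<phi> u"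
proof -
  interpret V: twisted_module n lam G \<alpha> V by (rule twisted_moduleI[OF assms(1)])
  note phi = mod_homD[OF assms(3)]
  note * = LM_tensor_map[OF assms(1,2) right_linear_ident, where \<phi> = \<phi>]
  show "f \<in> carrier I \<Longrightarrow> v \<in> carrier V \<Longrightarrow> LM_arr n G V W \<phi> (LM_elt n G V f v) = LM_elt n G W f (\<phi> v)"
    unfolding LM_arr_def by (subst *(1)[symmetric]) (simp_all add: phi)
  show "t \<in> carrier (LM_group n G V) \<Longrightarrow> LM_arr n G V W \<phi> t \<in> carrier (LM_group n G W)"
    unfolding LM_arr_def by (simp add: *(2) phi)
  show "t \<in> carrier (LM_group n G V) \<Longrightarrow> u \<in> carrier (LM_group n G V) \<Longrightarrow>
      LM_arr n G V W \<phi> (t \<oplus>\<^bsub>LM_group n G V\<^esub> u) =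
      LM_arr n G V W \<phi> t \<oplus>\<^bsub>LM_group n G W\<^esub> LM_arr n G V W \<phi> u"
    unfolding LM_arr_def by (simp add: *(3) phi)
qed

lemma LM_arr_commutes:
  assumes "left_module RG V" "left_module RG W" "\<phi> \<in> mod_hom RG V W"
    and "t \<in> carrier (LM_group n G V)"
  shows "LM_arr n G V W \<phi> (LM_scalar n G V c t) = LM_scalar n G W c (LM_arr n G V W \<phi> t)"
    and "x \<in> carrier F \<Longrightarrow>
      LM_arr n G V W \<phi> (LM_actF n G lam V x t) = LM_actF n G lam W x (LM_arr n G V W \<phi> t)"
    and "g \<in> carrier G \<Longrightarrow>
      LM_arr n G V W \<phi> (LM_actG n G \<alpha> V g t) = LM_actG n G \<alpha> W g (LM_arr n G V W \<phi> t)"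
proof -
  interpret V: twisted_module n lam G \<alpha> V by (rule twisted_moduleI[OF assms(1)])
  interpret W: twisted_module n lam G \<alpha> W by (rule twisted_moduleI[OF assms(2)])
  note phi = mod_homD[OF assms(3)]
  note arr = LM_arr_props[OF assms(1-3)]
  show "LM_arr n G V W \<phi> (LM_scalar n G V c t) = LM_scalar n G W c (LM_arr n G V W \<phi> t)"
    by (rule V.L_hom_eq[where A = "LM_group n G W", OF assms(4)])
      (simp_all add: arr V.scalar_props W.scalar_props phi)
  show "LM_arr n G V W \<phi> (LM_actF n G lam V x t) = LM_actF n G lam W x (LM_arr n G V W \<phi> t)"
    if "x \<in> carrier F"
    by (rule V.L_hom_eq[where A = "LM_group n G W", OF assms(4)])
      (simp_all add: arr V.actF_props W.actF_props phi that)
  show "LM_arr n G V W \<phi> (LM_actG n G \<alpha> V g t) = LM_actG n G \<alpha> W g (LM_arr n G V W \<phi> t)"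
    if "g \<in> carrier G"
    by (rule V.L_hom_eq[where A = "LM_group n G W", OF assms(4)])
      (simp_all add: arr V.actG_props W.actG_props phi that gr_map_semilinear[OF alpha_hom])
qed

lemma LM_arr_extensional:
  assumes "left_module RG V" "left_module RG W" "\<phi> \<in> mod_hom RG V W"
  shows "LM_arr n G V W \<phi> \<in> carrier (LM_group n G V) \<rightarrow>\<^sub>E carrier (LM_group n G W)"
  using LM_arr_props(2)[OF assms] by (auto simp: LM_arr_def)

lemma LM_arr_ident:
  assumes "left_module RG V"
  shows "LM_arr n G V V (\<lambda>v\<in>carrier V. v) = (\<lambda>t\<in>carrier (LM_group n G V). t)"
proof -
  interpret V: twisted_module n lam G \<alpha> V by (rule twisted_moduleI[OF assms])
  define i where "i = (\<lambda>v\<in>carrier V. v)"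
  have i: "i v = v" if "v \<in> carrier V" for v using that by (simp add: i_def)
  note arr = LM_arr_props[OF assms assms mod_hom_ident[OF assms], folded i_def]
  have "LM_arr n G V V i t = t" if "t \<in> carrier (LM_group n G V)" for t
    by (rule V.L_hom_eq[where A = "LM_group n G V", OF that]) (simp_all add: arr i)
  then show ?thesis unfolding i_def[symmetric] by (intro ext) (simp add: LM_arr_def)
qed

lemma LM_arr_compose:
  assumes "left_module RG U" "left_module RG V" "left_module RG W"
    and "\<phi> \<in> mod_hom RG U V" "\<psi> \<in> mod_hom RG V W"
  shows "LM_arr n G U W (compose (carrier U) \<psi> \<phi>)
    = compose (carrier (LM_group n G U)) (LM_arr n G V W \<psi>) (LM_arr n G U V \<phi>)"
proof -
  interpret U: twisted_module n lam G \<alpha> U by (rule twisted_moduleI[OF assms(1)])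
  define c where "c = compose (carrier U) \<psi> \<phi>"
  have c: "c v = \<psi> (\<phi> v)" if "v \<in> carrier U" for v using that by (simp add: c_def compose_def)
  note arr = LM_arr_props[OF assms(1,3) mod_hom_compose[OF assms(1,4,5)], folded c_def]
    LM_arr_props[OF assms(1,2,4)] LM_arr_props[OF assms(2,3,5)]
  have "LM_arr n G U W c t = LM_arr n G V W \<psi> (LM_arr n G U V \<phi> t)"
    if "t \<in> carrier (LM_group n G U)" for t
    by (rule U.L_hom_eq[where A = "LM_group n G W", OF that])
      (simp_all add: arr mod_homD[OF assms(4)] c)
  then show ?thesis
    unfolding c_def[symmetric] by (intro ext) (simp add: LM_arr_def[of n G U W] compose_def)
qed

lemma LM_simps:
  "arr (LM n G \<alpha>) V W = LM_arr n G V W" "carrier (obj (LM n G \<alpha>) V) = carrier (LM_group n G V)"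
  by (simp_all add: LM_def)

lemma LM_lam_simps:
  "arr (LM_lam n G \<alpha> lam) V W = LM_arr n G V W"
  "carrier (obj (LM_lam n G \<alpha> lam) V) = carrier (LM_group n G V)"
  by (simp_all add: LM_lam_def)

lemma is_functor_LM:
  "is_functor RG (group_ring G)
     (LM n G \<alpha> :: (_, 'v, 'g \<Rightarrow> 'k, ('k, 'v) lm_elt) mod_functor)"
  unfolding is_functor_def
proof (intro conjI allI impI ballI)
  fix V W :: "(nat word set \<times> 'g \<Rightarrow> 'k, 'v) module" and \<phi>
  assume V: "left_module RG V" and W: "left_module RG W" and phi: "\<phi> \<in> mod_hom RG V W"
  interpret V: twisted_module n lam G \<alpha> V by (rule twisted_moduleI[OF V])
  interpret W: twisted_module n lam G \<alpha> W by (rule twisted_moduleI[OF W])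
  note arr = LM_arr_props[OF V W phi] LM_arr_commutes[OF V W phi]
  have "LM_arr n G V W \<phi> \<in> mod_hom (group_ring G) (obj (LM n G \<alpha>) V) (obj (LM n G \<alpha>) W)"
    by (rule mod_hom_group_ringI[OF V.left_module_LM W.left_module_LM])
      (unfold V.obj_LM W.obj_LM, simp_all add: LM_arr_extensional[OF V W phi] arr V.LG.lact_single
        W.LG.lact_single V.actG_props)
  then show "arr (LM n G \<alpha>) V W \<phi> \<in> mod_hom (group_ring G) (obj (LM n G \<alpha>) V) (obj (LM n G \<alpha>) W)"
    by (simp add: LM_def)
next
  fix V :: "(nat word set \<times> 'g \<Rightarrow> 'k, 'v) module"
  assume V: "left_module RG V"
  interpret V: twisted_module n lam G \<alpha> V by (rule twisted_moduleI[OF V])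
  show "left_module (group_ring G) (obj (LM n G \<alpha>) V)" by (rule V.left_module_LM)
  show "arr (LM n G \<alpha>) V V (\<lambda>v\<in>carrier V. v) = (\<lambda>t\<in>carrier (obj (LM n G \<alpha>) V). t)"
    unfolding LM_simps by (rule LM_arr_ident[OF V])
qed (unfold LM_simps, rule LM_arr_compose)

text \<open>Linearity of \<open>id \<otimes> \<phi>\<close> holds because \<open>\<phi>\<close> commutes with the group elements in the second tensor
  factor, while the twisted action is confined to the first.\<close>

lemma is_functor_LM_lam:
  "is_functor RG RG
     (LM_lam n G \<alpha> lam :: (_, 'v, nat word set \<times> 'g \<Rightarrow> 'k, ('k, 'v) lm_elt) mod_functor)"
  unfolding is_functor_def
proof (intro conjI allI impI ballI)
  fix V W :: "(nat word set \<times> 'g \<Rightarrow> 'k, 'v) module" and \<phi>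
  assume V: "left_module RG V" and W: "left_module RG W" and phi: "\<phi> \<in> mod_hom RG V W"
  interpret V: twisted_module n lam G \<alpha> V by (rule twisted_moduleI[OF V])
  interpret W: twisted_module n lam G \<alpha> W by (rule twisted_moduleI[OF W])
  note arr = LM_arr_props[OF V W phi] LM_arr_commutes[OF V W phi]
  have "LM_arr n G V W \<phi> \<in> mod_hom RG (obj (LM_lam n G \<alpha> lam) V) (obj (LM_lam n G \<alpha> lam) W)"
    by (rule mod_hom_group_ringI[OF V.left_module_LM_lam W.left_module_LM_lam])
      (unfold V.obj_LM_lam W.obj_LM_lam, auto simp: LM_arr_extensional[OF V W phi] arr
        V.LFG.lact_single W.LFG.lact_single V.actG_props V.actF_props SD_simps)
  then show "arr (LM_lam n G \<alpha> lam) V W \<phi> \<in> mod_hom RG (obj (LM_lam n G \<alpha> lam) V) (obj (LM_lam n G \<alpha> lam) W)"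
    by (simp add: LM_lam_def)
next
  fix V :: "(nat word set \<times> 'g \<Rightarrow> 'k, 'v) module"
  assume V: "left_module RG V"
  interpret V: twisted_module n lam G \<alpha> V by (rule twisted_moduleI[OF V])
  show "left_module RG (obj (LM_lam n G \<alpha> lam) V)" by (rule V.left_module_LM_lam)
  show "arr (LM_lam n G \<alpha> lam) V V (\<lambda>v\<in>carrier V. v) = (\<lambda>t\<in>carrier (obj (LM_lam n G \<alpha> lam) V). t)"
    unfolding LM_lam_simps by (rule LM_arr_ident[OF V])
qed (unfold LM_lam_simps, rule LM_arr_compose)

end

text \<open>On the subgroup \<open>G\<close> the two actions on \<open>I \<otimes> V\<close> agree, so the identity maps are an
  isomorphism of functors.\<close>

lemma (in twisted_rep) Res_LM_lam_isomorphic_LM: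
  "nat_isomorphic RG (group_ring G) (Res (incG n) \<circ>\<^sub>F LM_lam n G \<alpha> lam)
     (LM n G \<alpha> :: (_, 'v, 'g \<Rightarrow> 'k, ('k, 'v) lm_elt) mod_functor)"
  unfolding nat_isomorphic_def
proof (intro conjI)
  let ?S = "group_ring G :: ('g \<Rightarrow> 'k) ring"
  let ?H = "Res (incG n) \<circ>\<^sub>F LM_lam n G \<alpha> lam ::
    (_, 'v, 'g \<Rightarrow> 'k, ('k, 'v) lm_elt) mod_functor"
  show H: "is_functor RG ?S ?H"
    by (rule is_functor_comp[OF is_functor_LM_lam])
      (rule is_functor_Res[OF ring_group_ring[OF G.is_group] incG_ring_hom])
  let ?id = "\<lambda>V. \<lambda>t\<in>carrier (LM_group n G V). t"
  show "\<exists>\<eta>. (\<forall>V. left_module RG V \<longrightarrow> \<eta> V \<in> mod_iso ?S (obj ?H V) (obj (LM n G \<alpha>) V)) \<and>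
      (\<forall>V W. left_module RG V \<longrightarrow> left_module RG W \<longrightarrow> (\<forall>\<phi>\<in>mod_hom RG V W.
        compose (carrier (obj ?H V)) (\<eta> W) (arr ?H V W \<phi>) =
        compose (carrier (obj ?H V)) (arr (LM n G \<alpha>) V W \<phi>) (\<eta> V)))"
  proof (intro exI[of _ ?id] conjI allI impI ballI)
    fix V :: "(nat word set \<times> 'g \<Rightarrow> 'k, 'v) module"
    assume V: "left_module RG V"
    interpret V: twisted_module n lam G \<alpha> V by (rule twisted_moduleI[OF V])
    have objH: "obj ?H V = restrict_scalars (incG n) (with_smult V.L V.LFG.lact)"
      by (simp add: functor_comp_def Res_def V.obj_LM_lam)
    have mH: "left_module ?S (obj ?H V)" using H V by (simp add: is_functor_def)
    have "?id V \<in> mod_hom ?S (obj ?H V) (obj (LM n G \<alpha>) V)"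
      by (rule mod_hom_group_ringI[OF mH V.left_module_LM])
        (unfold objH V.obj_LM, simp_all add: incG_def V.LG.lact_single V.LFG.lact_single SD_simps
          V.actF_one V.actG_props V.scalar_props)
    then show "?id V \<in> mod_iso ?S (obj ?H V) (obj (LM n G \<alpha>) V)"
      by (auto simp: mod_iso_def objH V.obj_LM bij_betw_def inj_on_def)
  next
    fix V W :: "(nat word set \<times> 'g \<Rightarrow> 'k, 'v) module" and \<phi>
    assume V: "left_module RG V" and W: "left_module RG W" and phi: "\<phi> \<in> mod_hom RG V W"
    show "compose (carrier (obj ?H V)) (?id W) (arr ?H V W \<phi>) =
        compose (carrier (obj ?H V)) (arr (LM n G \<alpha>) V W \<phi>) (?id V)"
      using LM_arr_props(2)[OF V W phi]
      by (intro ext) (auto simp: compose_def functor_comp_def Res_def LM_lam_def LM_def)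
  qed
qed (rule is_functor_LM)

section \<open>The Dettweiler-Reiter convolution\<close>

context twisted
begin

text \<open>The coefficient of \<open>Y j\<close> in the right basis, that is, the Fox derivative with respect to
  \<open>x\<^sub>j\<close>.\<close>

definition fox :: "nat \<Rightarrow> (nat word set \<Rightarrow> 'k) \<Rightarrow> nat word set \<Rightarrow> 'k" where
  "fox j = extend_gens (\<lambda>k. if k = j then \<one>\<^bsub>R\<^esub> else \<zero>\<^bsub>R\<^esub>)"

lemma fox_right_linear: "right_linear (fox j)"
  and fox_Y: "k \<in> {1..n} \<Longrightarrow> fox j (Y k) = (if k = j then \<one>\<^bsub>R\<^esub> else \<zero>\<^bsub>R\<^esub>)"
  unfolding fox_def by (rule extend_gens; simp del: atLeastAtMost_iff)+

lemmas fox_simps = semilinearD[OF fox_right_linear]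

text \<open>The \<open>i\<close>-th row of the matrix of \<open>T i\<close> is the block row of the convolution.\<close>

lemma conv_entry_eq:
  assumes "i \<in> {1..n}" "k \<in> {1..n}"
  shows "(if i = k then \<one>\<^bsub>R\<^esub> else \<zero>\<^bsub>R\<^esub>) +\<^sub>F E i (Y k) = conv_entry n lam i k"
proof -
  consider "k < i" | "k = i" | "i < k" by linarith
  then show ?thesis
  proof cases
    case 1
    then show ?thesis using assms
      by (simp add: E_def Q_Y conv_entry_def del: atLeastAtMost_iff One_nat_def)
        (auto simp: gr_add gr_scale_def algebra_simps)
  next
    case 2
    then show ?thesis using assms(1)
      by (simp add: E_Y conv_entry_def del: atLeastAtMost_iff One_nat_def)
        (auto simp: diff_fun gr_add)
  next
    case 3
    then show ?thesis using assms
      by (simp add: E_def Q_Y conv_entry_def del: atLeastAtMost_iff One_nat_def)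
        (auto simp: gr_add gr_scale_def gr_zero)
  qed
qed

lemma conv_entry_closed:
  assumes "i \<in> {1..n}" "k \<in> {1..n}"
  shows "conv_entry n lam i k \<in> carrier R"
  using assms by (auto simp: conv_entry_def simp del: atLeastAtMost_iff)

end

lemma power_group_simps:
  "carrier (power_group n V) = {1..n} \<rightarrow>\<^sub>E carrier V"
  "v \<oplus>\<^bsub>power_group n V\<^esub> w = (\<lambda>j\<in>{1..n}. v j \<oplus>\<^bsub>V\<^esub> w j)"
  "\<zero>\<^bsub>power_group n V\<^esub> = (\<lambda>j\<in>{1..n}. \<zero>\<^bsub>V\<^esub>)"
  by (simp_all add: power_group_def)

lemma abelian_group_power_group:
  assumes "abelian_group V"
  shows "abelian_group (power_group n V)"
proof -
  interpret V: abelian_group V by fact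
  show ?thesis
  proof (rule abelian_groupI)
    fix v assume v: "v \<in> carrier (power_group n V)"
    then have "(\<lambda>j\<in>{1..n}. \<ominus>\<^bsub>V\<^esub> v j) \<oplus>\<^bsub>power_group n V\<^esub> v = \<zero>\<^bsub>power_group n V\<^esub>"
      by (auto simp: power_group_simps fun_eq_iff V.l_neg PiE_def Pi_iff)
    moreover have "(\<lambda>j\<in>{1..n}. \<ominus>\<^bsub>V\<^esub> v j) \<in> carrier (power_group n V)"
      using v by (auto simp: power_group_simps)
    ultimately show "\<exists>w\<in>carrier (power_group n V). w \<oplus>\<^bsub>power_group n V\<^esub> v = \<zero>\<^bsub>power_group n V\<^esub>"
      by blast
    show "\<zero>\<^bsub>power_group n V\<^esub> \<oplus>\<^bsub>power_group n V\<^esub> v = v"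
      using v by (auto simp: power_group_simps fun_eq_iff PiE_def Pi_iff extensional_def)
  qed (auto simp: power_group_simps fun_eq_iff PiE_def Pi_iff V.a_ac)
qed

locale trivial_rep = twisted_rep n lam G \<alpha>
  for n :: nat and lam :: "'k::field" and G :: "('g, 'm) monoid_scheme" and \<alpha> +
  assumes trivial: "carrier G = {\<one>\<^bsub>G\<^esub>}"
begin

lemma fst_ring_hom: "gr_map fst \<in> ring_hom RG R"
  by (rule gr_map_ring_hom[OF group_SD group_free_group])
    (auto simp: hom_def SD_simps trivial alpha_one)

lemma fst_incF: "r \<in> carrier R \<Longrightarrow> gr_map fst (incF G r) = r"
  unfolding incF_def by (subst gr_map_comp[where h = "\<lambda>x. x"]) (auto simp: gr_finsupp intro: gr_map_ident)

abbreviation inflate :: "(nat word set \<Rightarrow> 'k, 'v) module \<Rightarrow> (nat word set \<times> 'g \<Rightarrow> 'k, 'v) module" where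
  "inflate \<equiv> restrict_scalars (gr_map fst)"

lemma left_module_inflate: "left_module R V \<Longrightarrow> left_module RG (inflate V)"
  by (rule left_module_restrict_scalars[OF _ ring_RG fst_ring_hom])

end

locale conv_module = trivial_rep n lam G \<alpha> + W: left_module R W
  for n :: nat and lam :: "'k::field" and G :: "('g, 'm) monoid_scheme" and \<alpha>
    and W :: "(nat word set \<Rightarrow> 'k, 'v) module"
begin

sublocale twisted_module n lam G \<alpha> "inflate W"
  by (rule twisted_moduleI[OF left_module_inflate[OF W.left_module_axioms]])

abbreviation "PG \<equiv> power_group n W"
abbreviation elt_W (infixl \<open>\<otimes>\<^sub>W\<close> 70) where "f \<otimes>\<^sub>W v \<equiv> LM_elt n G (inflate W) f v"

sublocale PG: abelian_group PG
  by (rule abelian_group_power_group[OF W.M.abelian_group_axioms])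

lemma elt_balanced':
  "f \<in> carrier I \<Longrightarrow> r \<in> carrier R \<Longrightarrow> v \<in> carrier W \<Longrightarrow> (f \<cdot> r) \<otimes>\<^sub>W v = f \<otimes>\<^sub>W (r \<odot>\<^bsub>W\<^esub> v)"
  using elt_balanced[of f r v] by (simp add: fst_incF)

text \<open>The tensor product is generated by the elements \<open>(x\<^sub>k - 1) \<otimes> w\<close>, so all maps out of it are
  compared on these.\<close>

lemma L_gens_hom_eq:
  assumes t: "t \<in> carrier L" and A: "abelian_group A"
    and h: "\<And>t. t \<in> carrier L \<Longrightarrow> h t \<in> carrier A" "\<And>t. t \<in> carrier L \<Longrightarrow> h' t \<in> carrier A"
    and add: "\<And>t u. t \<in> carrier L \<Longrightarrow> u \<in> carrier L \<Longrightarrow> h (t \<oplus>\<^bsub>L\<^esub> u) = h t \<oplus>\<^bsub>A\<^esub> h u"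
      "\<And>t u. t \<in> carrier L \<Longrightarrow> u \<in> carrier L \<Longrightarrow> h' (t \<oplus>\<^bsub>L\<^esub> u) = h' t \<oplus>\<^bsub>A\<^esub> h' u"
    and gens: "\<And>k w. k \<in> {1..n} \<Longrightarrow> w \<in> carrier W \<Longrightarrow> h (Y k \<otimes>\<^sub>W w) = h' (Y k \<otimes>\<^sub>W w)"
  shows "h t = h' t"
proof (rule L_hom_eq[where A = A, OF t add])
  interpret A: abelian_group A by fact
  have zero: "h \<zero>\<^bsub>L\<^esub> = h' \<zero>\<^bsub>L\<^esub>"
    using add(1)[of "\<zero>\<^bsub>L\<^esub>" "\<zero>\<^bsub>L\<^esub>"] add(2)[of "\<zero>\<^bsub>L\<^esub>" "\<zero>\<^bsub>L\<^esub>"] h[of "\<zero>\<^bsub>L\<^esub>"] by simp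
  fix f v assume "f \<in> carrier I" and v: "v \<in> carrier (inflate W)"
  then show "h (f \<otimes>\<^sub>W v) = h' (f \<otimes>\<^sub>W v)"
  proof (induction rule: aug_ideal_induct)
    case zero
    then show ?case using \<open>h \<zero>\<^bsub>L\<^esub> = h' \<zero>\<^bsub>L\<^esub>\<close> elt_zero_left by simp
  next
    case (gen k r)
    then show ?case
      using gens[of k "r \<odot>\<^bsub>W\<^esub> v"] elt_balanced'[of "Y k" r v] W.smult_closed[of r v] by simp
  next
    case (add f g)
    then show ?case using elt_add_left[of f g v] by (simp add: assms(5,6))
  qed
qed assumption+

definition unit_vec :: "nat \<Rightarrow> 'v \<Rightarrow> nat \<Rightarrow> 'v" where
  "unit_vec k w = (\<lambda>j\<in>{1..n}. if k = j then w else \<zero>\<^bsub>W\<^esub>)"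

lemma ex_coords:
  "\<exists>h. (\<forall>t\<in>carrier L. h t \<in> carrier PG) \<and>
     (\<forall>t\<in>carrier L. \<forall>u\<in>carrier L. h (t \<oplus>\<^bsub>L\<^esub> u) = h t \<oplus>\<^bsub>PG\<^esub> h u) \<and>
     (\<forall>f\<in>carrier I. \<forall>v\<in>carrier W. h (f \<otimes>\<^sub>W v) = (\<lambda>j\<in>{1..n}. fox j f \<odot>\<^bsub>W\<^esub> v))"
proof -
  obtain h where
    "\<And>t. t \<in> carrier (tensor_product R I VF) \<Longrightarrow> h t \<in> carrier PG"
    "\<And>t u. t \<in> carrier (tensor_product R I VF) \<Longrightarrow> u \<in> carrier (tensor_product R I VF) \<Longrightarrow>
       h (t \<oplus>\<^bsub>tensor_product R I VF\<^esub> u) = h t \<oplus>\<^bsub>PG\<^esub> h u"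
    "\<And>f v. f \<in> carrier I \<Longrightarrow> v \<in> carrier VF \<Longrightarrow>
       h (tensor_elt R I VF f v) = (\<lambda>j\<in>{1..n}. fox j f \<odot>\<^bsub>W\<^esub> v)"
    by (rule P.tensor_lift[OF PG.abelian_group_axioms, of "\<lambda>f v. \<lambda>j\<in>{1..n}. fox j f \<odot>\<^bsub>W\<^esub> v"])
      (auto simp: power_group_simps fun_eq_iff fox_simps W.smult_closed W.smult_l_distr
        W.smult_r_distr W.smult_assoc fst_incF)
  then show ?thesis unfolding L_eq elt_eq by (intro exI[of _ h]) simp
qed

text \<open>The isomorphism \<open>I \<otimes> V \<cong> V\<^sup>n\<close> given by the basis \<open>Y 1, \<dots>, Y n\<close>; its inverse is \<open>of_coords\<close>
  below.\<close>

definition coords :: "('k, 'v) lm_elt \<Rightarrow> nat \<Rightarrow> 'v" where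
  "coords = (SOME h. (\<forall>t\<in>carrier L. h t \<in> carrier PG) \<and>
     (\<forall>t\<in>carrier L. \<forall>u\<in>carrier L. h (t \<oplus>\<^bsub>L\<^esub> u) = h t \<oplus>\<^bsub>PG\<^esub> h u) \<and>
     (\<forall>f\<in>carrier I. \<forall>v\<in>carrier W. h (f \<otimes>\<^sub>W v) = (\<lambda>j\<in>{1..n}. fox j f \<odot>\<^bsub>W\<^esub> v)))"

lemma coords_props:
  "t \<in> carrier L \<Longrightarrow> coords t \<in> carrier PG"
  "t \<in> carrier L \<Longrightarrow> u \<in> carrier L \<Longrightarrow> coords (t \<oplus>\<^bsub>L\<^esub> u) = coords t \<oplus>\<^bsub>PG\<^esub> coords u"
  "f \<in> carrier I \<Longrightarrow> v \<in> carrier W \<Longrightarrow> coords (f \<otimes>\<^sub>W v) = (\<lambda>j\<in>{1..n}. fox j f \<odot>\<^bsub>W\<^esub> v)"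
  using someI_ex[OF ex_coords, folded coords_def] by blast+

lemma coords_Y: "k \<in> {1..n} \<Longrightarrow> w \<in> carrier W \<Longrightarrow> coords (Y k \<otimes>\<^sub>W w) = unit_vec k w"
  by (auto simp: coords_props unit_vec_def fun_eq_iff fox_Y W.smult_one W.smult_zero_left
      simp del: atLeastAtMost_iff One_nat_def)

definition of_coords :: "(nat \<Rightarrow> 'v) \<Rightarrow> ('k, 'v) lm_elt" where
  "of_coords v = (\<Oplus>\<^bsub>L\<^esub>j\<in>{1..n}. Y j \<otimes>\<^sub>W v j)"

lemma elt_W_closed: "j \<in> {1..n} \<Longrightarrow> w \<in> carrier W \<Longrightarrow> Y j \<otimes>\<^sub>W w \<in> carrier L"
  by (simp del: atLeastAtMost_iff One_nat_def)

lemma of_coords_closed: "v \<in> carrier PG \<Longrightarrow> of_coords v \<in> carrier L"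
  unfolding of_coords_def power_group_simps by (rule L.finsum_closed) (auto intro!: elt_W_closed)

lemma of_coords_add:
  assumes "v \<in> carrier PG" "w \<in> carrier PG"
  shows "of_coords (v \<oplus>\<^bsub>PG\<^esub> w) = of_coords v \<oplus>\<^bsub>L\<^esub> of_coords w"
proof -
  have vw: "v j \<in> carrier W" "w j \<in> carrier W" if "j \<in> {1..n}" for j
    using assms that unfolding power_group_simps by auto
  have "of_coords (v \<oplus>\<^bsub>PG\<^esub> w) = (\<Oplus>\<^bsub>L\<^esub>j\<in>{1..n}. Y j \<otimes>\<^sub>W v j \<oplus>\<^bsub>L\<^esub> Y j \<otimes>\<^sub>W w j)"
    unfolding of_coords_def
  proof (rule L.finsum_cong')
    fix j assume j: "j \<in> {1..n}"
    then show "Y j \<otimes>\<^sub>W (v \<oplus>\<^bsub>PG\<^esub> w) j = Y j \<otimes>\<^sub>W v j \<oplus>\<^bsub>L\<^esub> Y j \<otimes>\<^sub>W w j"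
      using elt_add_right[OF Y_I[OF j], of "v j" "w j"] vw[OF j]
      by (simp add: power_group_simps del: atLeastAtMost_iff One_nat_def)
  qed (auto intro!: elt_W_closed vw L.a_closed)
  also have "\<dots> = of_coords v \<oplus>\<^bsub>L\<^esub> of_coords w"
    unfolding of_coords_def by (rule L.finsum_addf) (auto intro!: elt_W_closed vw)
  finally show ?thesis .
qed

lemma elt_zero_right: "f \<in> carrier I \<Longrightarrow> f \<otimes>\<^sub>W \<zero>\<^bsub>W\<^esub> = \<zero>\<^bsub>L\<^esub>"
  using P.tensor_zero_right[of f] by (simp add: L_eq elt_eq)

lemma of_coords_unit_vec:
  assumes "k \<in> {1..n}" "w \<in> carrier W"
  shows "of_coords (unit_vec k w) = Y k \<otimes>\<^sub>W w"
proof -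
  have "of_coords (unit_vec k w) = (\<Oplus>\<^bsub>L\<^esub>j\<in>{1..n}. if k = j then Y j \<otimes>\<^sub>W w else \<zero>\<^bsub>L\<^esub>)"
    unfolding of_coords_def unit_vec_def using assms
    by (intro L.finsum_cong')
      (auto simp: elt_zero_right elt_W_closed simp del: atLeastAtMost_iff One_nat_def)
  also have "\<dots> = Y k \<otimes>\<^sub>W w"
    using assms by (intro L.finsum_singleton) (auto intro!: elt_W_closed)
  finally show ?thesis .
qed

lemma of_coords_coords: "t \<in> carrier L \<Longrightarrow> of_coords (coords t) = t"
  by (rule L_gens_hom_eq[where A = L and t = t, OF _ L.abelian_group_axioms])
    (simp_all add: coords_props(1,2) of_coords_closed of_coords_add coords_Y of_coords_unit_vec
      del: atLeastAtMost_iff One_nat_def)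

lemma coords_of_coords:
  assumes "v \<in> carrier PG"
  shows "coords (of_coords v) = v"
proof -
  have v: "v j \<in> carrier W" if "j \<in> {1..n}" for j
    using assms that unfolding power_group_simps by auto
  have zero: "coords \<zero>\<^bsub>L\<^esub> = \<zero>\<^bsub>PG\<^esub>"
    using coords_props(2)[of "\<zero>\<^bsub>L\<^esub>" "\<zero>\<^bsub>L\<^esub>"] coords_props(1)[of "\<zero>\<^bsub>L\<^esub>"] by simp
  have "finite S \<Longrightarrow> S \<subseteq> {1..n} \<Longrightarrow> coords (\<Oplus>\<^bsub>L\<^esub>j\<in>S. Y j \<otimes>\<^sub>W v j)
      = (\<lambda>j\<in>{1..n}. if j \<in> S then v j else \<zero>\<^bsub>W\<^esub>)" for S
  proof (induction S rule: finite_induct)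
    case empty
    then show ?case by (simp add: zero power_group_simps)
  next
    case (insert k S)
    have k: "k \<in> {1..n}" and S: "S \<subseteq> {1..n}" using insert.prems by auto
    have fin: "(\<lambda>j. Y j \<otimes>\<^sub>W v j) \<in> S \<rightarrow> carrier L" using S by (auto intro!: elt_W_closed v)
    have "coords (\<Oplus>\<^bsub>L\<^esub>j\<in>insert k S. Y j \<otimes>\<^sub>W v j)
        = unit_vec k (v k) \<oplus>\<^bsub>PG\<^esub> coords (\<Oplus>\<^bsub>L\<^esub>j\<in>S. Y j \<otimes>\<^sub>W v j)"
      using insert.hyps fin k elt_W_closed[OF k v[OF k]]
      by (simp add: coords_props(2) coords_Y v del: atLeastAtMost_iff One_nat_def)
    then show ?case
      unfolding insert.IH[OF S] using insert.hyps(2) S v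
      by (auto simp: power_group_simps unit_vec_def fun_eq_iff subset_iff)
  qed
  from this[of "{1..n}"] have "coords (of_coords v) = (\<lambda>j\<in>{1..n}. v j)"
    by (simp add: of_coords_def cong: restrict_cong)
  also have "\<dots> = v"
    using assms by (auto simp: power_group_simps PiE_def extensional_restrict)
  finally show ?thesis .
qed

lemma coords_scalar: "t \<in> carrier L \<Longrightarrow> coords (scalar c t) = power_scalar n W c (coords t)"
proof (rule L_hom_eq[where A = PG and t = t])
  fix f v assume "f \<in> carrier I" "v \<in> carrier (inflate W)"
  then show "coords (scalar c (f \<otimes>\<^sub>W v)) = power_scalar n W c (coords (f \<otimes>\<^sub>W v))"
    by (auto simp: scalar_props coords_props power_scalar_def fun_eq_iff fox_simps
        right_linear_scale[OF fox_right_linear] gr_scale_eq_mult[OF group_free_group]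
        simp flip: W.smult_assoc)
next
  show "power_scalar n W c (coords (t \<oplus>\<^bsub>L\<^esub> u)) =
      power_scalar n W c (coords t) \<oplus>\<^bsub>PG\<^esub> power_scalar n W c (coords u)"
    if "t \<in> carrier L" "u \<in> carrier L" for t u
    using coords_props(1)[OF that(1)] coords_props(1)[OF that(2)]
    by (auto simp: coords_props(2)[OF that] power_scalar_def power_group_simps fun_eq_iff
        W.smult_r_distr PiE_def Pi_iff)
qed (simp_all add: scalar_props coords_props)

lemma conv_matrix_closed:
  assumes i: "i \<in> {1..n}" and v: "v \<in> carrier PG"
  shows "conv_matrix n lam W i v \<in> carrier PG"
proof -
  have "v j \<in> carrier W" if "j \<in> {1..n}" for j using v that unfolding power_group_simps by auto
  then have "(\<Oplus>\<^bsub>W\<^esub>j\<in>{1..n}. conv_entry n lam i j \<odot>\<^bsub>W\<^esub> v j) \<in> carrier W"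
    using i by (intro W.finsum_closed) (auto intro!: W.smult_closed conv_entry_closed)
  then show ?thesis using v by (auto simp: conv_matrix_def power_group_simps)
qed

lemma conv_matrix_add:
  assumes i: "i \<in> {1..n}" and v: "v \<in> carrier PG" and w: "w \<in> carrier PG"
  shows "conv_matrix n lam W i (v \<oplus>\<^bsub>PG\<^esub> w) = conv_matrix n lam W i v \<oplus>\<^bsub>PG\<^esub> conv_matrix n lam W i w"
proof -
  let ?e = "conv_entry n lam i"
  have vw: "v j \<in> carrier W" "w j \<in> carrier W" if "j \<in> {1..n}" for j
    using v w that unfolding power_group_simps by auto
  have e: "?e j \<in> carrier R" if "j \<in> {1..n}" for j
    using i that by (rule conv_entry_closed)
  have "(\<Oplus>\<^bsub>W\<^esub>j\<in>{1..n}. ?e j \<odot>\<^bsub>W\<^esub> (v \<oplus>\<^bsub>PG\<^esub> w) j)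
      = (\<Oplus>\<^bsub>W\<^esub>j\<in>{1..n}. ?e j \<odot>\<^bsub>W\<^esub> v j \<oplus>\<^bsub>W\<^esub> ?e j \<odot>\<^bsub>W\<^esub> w j)"
    by (rule W.finsum_cong')
      (auto simp: power_group_simps vw e W.smult_r_distr W.smult_closed
        simp del: atLeastAtMost_iff One_nat_def)
  also have "\<dots> = (\<Oplus>\<^bsub>W\<^esub>j\<in>{1..n}. ?e j \<odot>\<^bsub>W\<^esub> v j) \<oplus>\<^bsub>W\<^esub> (\<Oplus>\<^bsub>W\<^esub>j\<in>{1..n}. ?e j \<odot>\<^bsub>W\<^esub> w j)"
    by (rule W.finsum_addf) (auto intro!: W.smult_closed vw e)
  finally have "(\<Oplus>\<^bsub>W\<^esub>j\<in>{1..n}. ?e j \<odot>\<^bsub>W\<^esub> (v \<oplus>\<^bsub>PG\<^esub> w) j) = \<dots>" .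
  then show ?thesis
    using v w PG.a_closed[OF v w]
    by (auto simp: conv_matrix_def power_group_simps(2) fun_eq_iff)
qed

lemma unit_vec_closed: "k \<in> {1..n} \<Longrightarrow> w \<in> carrier W \<Longrightarrow> unit_vec k w \<in> carrier PG"
  by (auto simp: unit_vec_def power_group_simps)

text \<open>The block matrix of the convolution is the matrix of \<open>T i\<close> with respect to the right basis
  \<open>Y 1, \<dots>, Y n\<close>.\<close>

lemma coords_actF_fgen:
  assumes i: "i \<in> {1..n}" and t: "t \<in> carrier L"
  shows "coords (actF (fgen n i) t) = conv_matrix n lam W i (coords t)"
proof (rule L_gens_hom_eq[where A = PG and t = t, OF t PG.abelian_group_axioms])
  note [simp del] = atLeastAtMost_iff One_nat_def
  fix k w assume k: "k \<in> {1..n}" and w: "w \<in> carrier W"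
  let ?e = "conv_entry n lam i"
  have fox_T: "fox l (T i (Y k)) = (if l = i then ?e k else if k = l then \<one>\<^bsub>R\<^esub> else \<zero>\<^bsub>R\<^esub>)"
    if "l \<in> {1..n}" for l
    using i k that conv_entry_eq[OF i k, symmetric]
    by (auto simp: T_def fox_simps fox_Y E_simps)
  have "coords (actF (fgen n i) (Y k \<otimes>\<^sub>W w)) = (\<lambda>l\<in>{1..n}. fox l (T i (Y k)) \<odot>\<^bsub>W\<^esub> w)"
    using i k w by (simp add: actF_props tw_fgen coords_props(3) T_I)
  also have "\<dots> = (\<lambda>l\<in>{1..n}. if l = i then ?e k \<odot>\<^bsub>W\<^esub> w else if k = l then w else \<zero>\<^bsub>W\<^esub>)"
    by (rule restrict_ext) (simp add: fox_T w W.smult_one W.smult_zero_left)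
  finally have lhs: "coords (actF (fgen n i) (Y k \<otimes>\<^sub>W w)) =
      (\<lambda>l\<in>{1..n}. if l = i then ?e k \<odot>\<^bsub>W\<^esub> w else if k = l then w else \<zero>\<^bsub>W\<^esub>)" .
  have "(\<Oplus>\<^bsub>W\<^esub>j\<in>{1..n}. ?e j \<odot>\<^bsub>W\<^esub> unit_vec k w j) =
      (\<Oplus>\<^bsub>W\<^esub>j\<in>{1..n}. if k = j then ?e j \<odot>\<^bsub>W\<^esub> w else \<zero>\<^bsub>W\<^esub>)"
    using i w by (intro W.finsum_cong')
      (auto simp: unit_vec_def W.smult_zero_right W.smult_closed conv_entry_closed)
  also have "\<dots> = ?e k \<odot>\<^bsub>W\<^esub> w"
    using i k w by (intro W.finsum_singleton) (auto intro!: W.smult_closed conv_entry_closed)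
  finally show "coords (actF (fgen n i) (Y k \<otimes>\<^sub>W w)) =
      conv_matrix n lam W i (coords (Y k \<otimes>\<^sub>W w))"
    unfolding lhs coords_Y[OF k w] using unit_vec_closed[OF k w]
    by (auto simp: conv_matrix_def fun_eq_iff) (auto simp: unit_vec_def)
qed (use i fgen_carrier[OF i] in \<open>simp_all add: actF_props coords_props(1,2) conv_matrix_closed
      conv_matrix_add del: atLeastAtMost_iff One_nat_def\<close>)

text \<open>The convolution is specified by its values on generators only. Conjugating the twisted action by
  \<open>coords\<close> gives a homomorphism with these values, and in particular the block matrices are
  invertible.\<close>

definition transported :: "nat word set \<Rightarrow> (nat \<Rightarrow> 'v) \<Rightarrow> nat \<Rightarrow> 'v" where
  "transported = (\<lambda>x\<in>carrier F. \<lambda>v\<in>carrier PG. coords (actF x (of_coords v)))"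

lemma transported_hom: "transported \<in> hom F (BijGroup (carrier PG))"
proof -
  have inv: "coords (actF (inv\<^bsub>F\<^esub> x) (of_coords (coords (actF x (of_coords v))))) = v"
    "coords (actF x (of_coords (coords (actF (inv\<^bsub>F\<^esub> x) (of_coords v))))) = v"
    if "x \<in> carrier F" "v \<in> carrier PG" for x v
    using that by (simp_all add: of_coords_coords actF_props of_coords_closed coords_of_coords
        actF_one flip: actF_mult)
  have Bij: "transported x \<in> Bij (carrier PG)" if x: "x \<in> carrier F" for x
  proof -
    have "bij_betw (\<lambda>v. coords (actF x (of_coords v))) (carrier PG) (carrier PG)"
      by (rule bij_betw_byWitness[of _ "\<lambda>v. coords (actF (inv\<^bsub>F\<^esub> x) (of_coords v))"])
        (auto simp: inv x coords_props actF_props of_coords_closed)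
    then show ?thesis by (simp add: Bij_def transported_def x cong: bij_betw_cong)
  qed
  have "transported (x \<otimes>\<^bsub>F\<^esub> y) = compose (carrier PG) (transported x) (transported y)"
    if "x \<in> carrier F" "y \<in> carrier F" for x y
    using that by (intro ext)
      (auto simp: transported_def compose_def actF_mult of_coords_closed of_coords_coords
        actF_props coords_props)
  then show ?thesis using Bij by (simp add: hom_def BijGroup_def)
qed

lemma conv_rep_eq: "conv_rep n lam W = transported"
proof -
  have gens: "transported (fgen n i) = conv_matrix n lam W i" if i: "i \<in> {1..n}" for i
  proof (rule extensionalityI[where A = "carrier PG"])
    show "transported (fgen n i) v = conv_matrix n lam W i v" if v: "v \<in> carrier PG" for v
      using v fgen_carrier[OF i] coords_actF_fgen[OF i of_coords_closed[OF v]]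
      by (simp add: transported_def coords_of_coords)
  qed (use fgen_carrier[OF i] in \<open>simp_all add: transported_def conv_matrix_def\<close>)
  show ?thesis
    unfolding conv_rep_def
  proof (rule the_equality)
    show "transported \<in> hom F (BijGroup (carrier PG)) \<and> transported \<in> extensional (carrier F) \<and>
        (\<forall>i\<in>{1..n}. transported (fgen n i) = conv_matrix n lam W i)"
      using transported_hom gens by (auto simp: transported_def)
    fix \<rho> assume \<rho>: "\<rho> \<in> hom F (BijGroup (carrier PG)) \<and> \<rho> \<in> extensional (carrier F) \<and>
        (\<forall>i\<in>{1..n}. \<rho> (fgen n i) = conv_matrix n lam W i)"
    show "\<rho> = transported"
    proof (rule extensionalityI[where A = "carrier F"])
      fix x assume x: "x \<in> carrier F"
      show "\<rho> x = transported x"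
        by (rule free_group_hom_eq[OF group_BijGroup conjunct1[OF \<rho>] transported_hom _ x])
          (use \<rho> gens in simp)
    qed (use \<rho> in \<open>simp_all add: transported_def\<close>)
  qed
qed

lemma coords_actF:
  assumes "x \<in> carrier F" "t \<in> carrier L"
  shows "coords (actF x t) = conv_rep n lam W x (coords t)"
  using assms by (simp add: conv_rep_eq transported_def coords_props of_coords_coords)

lemma PG_cases:
  assumes "v \<in> carrier PG"
  obtains t where "t \<in> carrier L" "v = coords t"
  using coords_of_coords[OF assms] of_coords_closed[OF assms] by metis

sublocale LP: linear_rep F PG "power_scalar n W" "conv_rep n lam W"
proof unfold_locales
  fix v w c d x y
  assume v: "v \<in> carrier PG"
  then obtain t where t: "t \<in> carrier L" "v = coords t" by (rule PG_cases)
  show "power_scalar n W c v \<in> carrier PG"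
    using t by (simp add: scalar_props coords_props flip: coords_scalar)
  show "power_scalar n W (c + d) v = power_scalar n W c v \<oplus>\<^bsub>PG\<^esub> power_scalar n W d v"
    using t by (simp add: scalar_props scalar_plus flip: coords_scalar coords_props(2))
  show "power_scalar n W (c * d) v = power_scalar n W c (power_scalar n W d v)"
    using t by (simp add: scalar_props scalar_mult flip: coords_scalar)
  show "power_scalar n W 1 v = v"
    using t by (simp add: scalar_one flip: coords_scalar)
  show "conv_rep n lam W \<one>\<^bsub>F\<^esub> v = v"
    using t by (simp add: actF_one flip: coords_actF)
  { assume x: "x \<in> carrier F"
    show "conv_rep n lam W x v \<in> carrier PG"
      using t x by (simp add: actF_props coords_props flip: coords_actF)
    show "conv_rep n lam W x (power_scalar n W c v) = power_scalar n W c (conv_rep n lam W x v)"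
      using t x by (simp add: actF_props scalar_props actF_scalar flip: coords_actF coords_scalar)
    show "conv_rep n lam W (x \<otimes>\<^bsub>F\<^esub> y) v = conv_rep n lam W x (conv_rep n lam W y v)"
      if "y \<in> carrier F"
      using t x that by (simp add: actF_props actF_mult flip: coords_actF) }
  assume "w \<in> carrier PG"
  then obtain u where u: "u \<in> carrier L" "w = coords u" by (rule PG_cases)
  show "power_scalar n W c (v \<oplus>\<^bsub>PG\<^esub> w) = power_scalar n W c v \<oplus>\<^bsub>PG\<^esub> power_scalar n W c w"
    using t u by (simp add: scalar_props flip: coords_scalar coords_props(2))
  show "conv_rep n lam W x (v \<oplus>\<^bsub>PG\<^esub> w) = conv_rep n lam W x v \<oplus>\<^bsub>PG\<^esub> conv_rep n lam W x w"
    if "x \<in> carrier F"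
    using t u that by (simp add: actF_props flip: coords_actF coords_props(2))
qed

lemma obj_Conv: "obj (Conv n lam) W = with_smult PG LP.lact"
  by (simp add: Conv_def)

lemma left_module_Conv: "left_module R (obj (Conv n lam) W)"
  unfolding obj_Conv by (rule LP.left_module_lact)

end

context trivial_rep
begin

lemma conv_moduleI: "left_module R V \<Longrightarrow> conv_module n lam G \<alpha> V"
  by (rule conv_module.intro[OF trivial_rep_axioms])

lemma mod_hom_inflate: "\<phi> \<in> mod_hom R V W \<Longrightarrow> \<phi> \<in> mod_hom RG (inflate V) (inflate W)"
  using fst_ring_hom by (auto simp: mod_hom_def ring_hom_def)

lemma arr_Conv: "arr (Conv n lam) V W \<phi> = (\<lambda>v\<in>carrier (power_group n V). \<lambda>j\<in>{1..n}. \<phi> (v j))"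
  by (simp add: Conv_def)

text \<open>Maps of modules act on the second tensor factor and hence on each coordinate.\<close>

lemma coords_natural:
  assumes "left_module R V" "left_module R W" "\<phi> \<in> mod_hom R V W"
    and "t \<in> carrier (LM_group n G (inflate V))"
  shows "conv_module.coords n G W (LM_arr n G (inflate V) (inflate W) \<phi> t)
    = arr (Conv n lam) V W \<phi> (conv_module.coords n G V t)"
proof -
  interpret V: conv_module n lam G \<alpha> V by (rule conv_moduleI[OF assms(1)])
  interpret W: conv_module n lam G \<alpha> W by (rule conv_moduleI[OF assms(2)])
  note phi = mod_homD[OF assms(3)]
  note arr = LM_arr_props[OF left_module_inflate[OF assms(1)] left_module_inflate[OF assms(2)]
      mod_hom_inflate[OF assms(3)]]
  show ?thesis
  proof (rule V.L_hom_eq[where A = W.PG and t = t, OF assms(4)])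
    fix f v assume fv: "f \<in> carrier I" "v \<in> carrier (inflate V)"
    then show "W.coords (LM_arr n G (inflate V) (inflate W) \<phi> (LM_elt n G (inflate V) f v))
       = arr (Conv n lam) V W \<phi> (V.coords (LM_elt n G (inflate V) f v))"
      using V.coords_props(1)[OF V.elt_simps[OF fv]]
      by (auto simp: arr arr_Conv V.coords_props W.coords_props phi fun_eq_iff fox_simps)
  next
    fix t u assume tu: "t \<in> carrier V.L" "u \<in> carrier V.L"
    show "W.coords (LM_arr n G (inflate V) (inflate W) \<phi> (t \<oplus>\<^bsub>V.L\<^esub> u)) =
        W.coords (LM_arr n G (inflate V) (inflate W) \<phi> t) \<oplus>\<^bsub>W.PG\<^esub>
        W.coords (LM_arr n G (inflate V) (inflate W) \<phi> u)"
      using tu by (simp add: arr W.coords_props)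
    have "V.coords t \<in> carrier V.PG" "V.coords u \<in> carrier V.PG"
      "V.coords t \<oplus>\<^bsub>V.PG\<^esub> V.coords u \<in> carrier V.PG"
      using V.coords_props(1) tu by auto
    then show "arr (Conv n lam) V W \<phi> (V.coords (t \<oplus>\<^bsub>V.L\<^esub> u)) =
        arr (Conv n lam) V W \<phi> (V.coords t) \<oplus>\<^bsub>W.PG\<^esub> arr (Conv n lam) V W \<phi> (V.coords u)"
      unfolding V.coords_props(2)[OF tu] arr_Conv
      by (auto simp: power_group_simps fun_eq_iff phi PiE_def Pi_iff)
  qed
qed

text \<open>A word in the generators acts on \<open>V\<^sup>n\<close> through a product of block matrices. That coordinatewise
  maps commute with it is seen in \<open>I \<otimes> V\<close>, where they are \<open>id \<otimes> \<phi>\<close>.\<close>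

lemma is_functor_Conv:
  "is_functor R R (Conv n lam :: (_, 'v, nat word set \<Rightarrow> 'k, nat \<Rightarrow> 'v) mod_functor)"
  unfolding is_functor_def
proof (intro conjI allI impI ballI)
  fix V :: "(nat word set \<Rightarrow> 'k, 'v) module"
  assume V: "left_module R V"
  interpret V: conv_module n lam G \<alpha> V by (rule conv_moduleI[OF V])
  show "left_module R (obj (Conv n lam) V)" by (rule V.left_module_Conv)
  show "arr (Conv n lam) V V (\<lambda>v\<in>carrier V. v) = (\<lambda>w\<in>carrier (obj (Conv n lam) V). w)"
    by (intro ext) (auto simp: arr_Conv V.obj_Conv power_group_simps PiE_def Pi_iff extensional_def)
next
  fix V W :: "(nat word set \<Rightarrow> 'k, 'v) module" and \<phi>
  assume V: "left_module R V" and W: "left_module R W" and phi: "\<phi> \<in> mod_hom R V W"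
  interpret V: conv_module n lam G \<alpha> V by (rule conv_moduleI[OF V])
  interpret W: conv_module n lam G \<alpha> W by (rule conv_moduleI[OF W])
  let ?c = "arr (Conv n lam) V W \<phi>" and ?a = "LM_arr n G (inflate V) (inflate W) \<phi>"
  note a = LM_arr_props(2)[OF left_module_inflate[OF V] left_module_inflate[OF W] mod_hom_inflate[OF phi]]
    LM_arr_commutes[OF left_module_inflate[OF V] left_module_inflate[OF W] mod_hom_inflate[OF phi]]
  note nat = coords_natural[OF V W phi]
  show "?c \<in> mod_hom R (obj (Conv n lam) V) (obj (Conv n lam) W)"
  proof (rule mod_hom_group_ringI[OF V.left_module_Conv W.left_module_Conv])
    show "?c \<in> carrier (obj (Conv n lam) V) \<rightarrow>\<^sub>E carrier (obj (Conv n lam) W)"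
      using mod_homD(2)[OF phi]
      by (auto simp: V.obj_Conv W.obj_Conv arr_Conv power_group_simps PiE_iff)
    show "?c (x \<oplus>\<^bsub>obj (Conv n lam) V\<^esub> y) = ?c x \<oplus>\<^bsub>obj (Conv n lam) W\<^esub> ?c y"
      if "x \<in> carrier (obj (Conv n lam) V)" "y \<in> carrier (obj (Conv n lam) V)" for x y
      using that V.PG.a_closed[of x y] mod_homD(3)[OF phi]
      by (auto simp: V.obj_Conv W.obj_Conv arr_Conv power_group_simps fun_eq_iff PiE_def Pi_iff)
    fix c x v assume x: "x \<in> carrier F" and "v \<in> carrier (obj (Conv n lam) V)"
    then obtain t where t: "t \<in> carrier V.L" "v = V.coords t"
      by (auto simp: V.obj_Conv elim: V.PG_cases)
    have "?c (power_scalar n V c (conv_rep n lam V x v)) = power_scalar n W c (conv_rep n lam W x (?c v))"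
      using t x a by (simp add: nat[symmetric] V.actF_props V.scalar_props W.actF_props
          flip: V.coords_actF V.coords_scalar W.coords_actF W.coords_scalar)
    moreover have "v \<in> carrier V.PG" "?c v \<in> carrier W.PG"
      using t x a V.coords_props(1)[OF t(1)] W.coords_props(1)[OF a(1)[OF t(1)]]
      by (simp_all add: nat)
    ultimately show "?c (gr_single c x \<odot>\<^bsub>obj (Conv n lam) V\<^esub> v)
        = gr_single c x \<odot>\<^bsub>obj (Conv n lam) W\<^esub> ?c v"
      using x by (simp add: V.obj_Conv W.obj_Conv V.LP.lact_single W.LP.lact_single)
  qed
next
  fix U V W :: "(nat word set \<Rightarrow> 'k, 'v) module" and \<phi> \<psi>
  assume U: "left_module R U" and phi: "\<phi> \<in> mod_hom R U V" "\<psi> \<in> mod_hom R V W"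
  interpret U: conv_module n lam G \<alpha> U by (rule conv_moduleI[OF U])
  show "arr (Conv n lam) U W (compose (carrier U) \<psi> \<phi>) =
      compose (carrier (obj (Conv n lam) U)) (arr (Conv n lam) V W \<psi>) (arr (Conv n lam) U V \<phi>)"
    using mod_homD(2)[OF phi(1)]
    by (intro ext) (auto simp: arr_Conv U.obj_Conv power_group_simps compose_def PiE_def Pi_iff
        fun_eq_iff)
qed

lemma Res_LM_lam_isomorphic_Conv:
  "nat_isomorphic R R (Res (incF G) \<circ>\<^sub>F LM_lam n G \<alpha> lam \<circ>\<^sub>F Res (gr_map fst))
     (Conv n lam :: (_, 'v, nat word set \<Rightarrow> 'k, nat \<Rightarrow> 'v) mod_functor)"
  unfolding nat_isomorphic_def
proof (intro conjI)
  let ?H = "Res (incF G) \<circ>\<^sub>F LM_lam n G \<alpha> lam \<circ>\<^sub>F Res (gr_map fst) ::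
    (_, 'v, nat word set \<Rightarrow> 'k, ('k, 'v) lm_elt) mod_functor"
  show H: "is_functor R R ?H"
    by (rule is_functor_comp[OF is_functor_comp[OF is_functor_Res[OF ring_RG fst_ring_hom]
            is_functor_LM_lam] is_functor_Res[OF R.ring_axioms incF_ring_hom]])
  let ?\<eta> = "\<lambda>V. restrict (conv_module.coords n G V) (carrier (LM_group n G (inflate V)))"
  have arrH: "arr ?H V W \<phi> = LM_arr n G (inflate V) (inflate W) \<phi>" for V W \<phi>
    by (simp add: functor_comp_def Res_def LM_lam_def)
  have carrH: "carrier (obj ?H V) = carrier (LM_group n G (inflate V))" for V
    by (simp add: functor_comp_def Res_def LM_lam_def)
  show "\<exists>\<eta>. (\<forall>V. left_module R V \<longrightarrow> \<eta> V \<in> mod_iso R (obj ?H V) (obj (Conv n lam) V)) \<and>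
      (\<forall>V W. left_module R V \<longrightarrow> left_module R W \<longrightarrow> (\<forall>\<phi>\<in>mod_hom R V W.
        compose (carrier (obj ?H V)) (\<eta> W) (arr ?H V W \<phi>) =
        compose (carrier (obj ?H V)) (arr (Conv n lam) V W \<phi>) (\<eta> V)))"
  proof (intro exI[of _ ?\<eta>] conjI allI impI ballI)
    fix V :: "(nat word set \<Rightarrow> 'k, 'v) module"
    assume V: "left_module R V"
    interpret V: conv_module n lam G \<alpha> V by (rule conv_moduleI[OF V])
    have objH: "obj ?H V = restrict_scalars (incF G) (with_smult V.L V.LFG.lact)"
      by (simp add: functor_comp_def Res_def V.obj_LM_lam)
    have mH: "left_module R (obj ?H V)" using H V by (simp add: is_functor_def)
    have "?\<eta> V \<in> mod_hom R (obj ?H V) (obj (Conv n lam) V)"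
      by (rule mod_hom_group_ringI[OF mH V.left_module_Conv])
        (unfold objH V.obj_Conv, auto simp: incF_def V.LP.lact_single V.LFG.lact_single SD_simps
          V.actG_one V.actF_props V.scalar_props V.coords_props V.coords_actF V.coords_scalar)
    moreover have "bij_betw (?\<eta> V) (carrier V.L) (carrier V.PG)"
      unfolding bij_betw_restrict_eq
      by (rule bij_betw_byWitness[of _ V.of_coords])
        (auto simp: V.of_coords_coords V.coords_of_coords V.coords_props V.of_coords_closed)
    ultimately show "?\<eta> V \<in> mod_iso R (obj ?H V) (obj (Conv n lam) V)"
      unfolding mod_iso_def objH V.obj_Conv restrict_scalars_simps with_smult_simps by blast
  next
    fix V W :: "(nat word set \<Rightarrow> 'k, 'v) module" and \<phi>
    assume V: "left_module R V" and W: "left_module R W" and phi: "\<phi> \<in> mod_hom R V W"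
    show "compose (carrier (obj ?H V)) (?\<eta> W) (arr ?H V W \<phi>) =
        compose (carrier (obj ?H V)) (arr (Conv n lam) V W \<phi>) (?\<eta> V)"
      using LM_arr_props(2)[OF left_module_inflate[OF V] left_module_inflate[OF W] mod_hom_inflate[OF phi]]
      by (intro ext) (auto simp: compose_def carrH arrH coords_natural[OF V W phi])
  qed
qed (rule is_functor_Conv)

end

section \<open>The twisted Long-Moody functor and its specializations\<close>

lemma (in twisted_module) LM_lam_on_tensors:
  assumes "f \<in> carrier I" "v \<in> carrier V"
  shows "gr_single c \<one>\<^bsub>SD\<^esub> \<odot>\<^bsub>obj (LM_lam n G \<alpha> lam) V\<^esub> (f \<otimes>\<^sub>V v) = (c *\<^sub>F f) \<otimes>\<^sub>V v"
    and "x \<in> carrier F \<Longrightarrow> gr_single 1 (x, \<one>\<^bsub>G\<^esub>) \<odot>\<^bsub>obj (LM_lam n G \<alpha> lam) V\<^esub> (f \<otimes>\<^sub>V v) = tw x f \<otimes>\<^sub>V v"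
    and "g \<in> carrier G \<Longrightarrow> gr_single 1 (\<one>\<^bsub>F\<^esub>, g) \<odot>\<^bsub>obj (LM_lam n G \<alpha> lam) V\<^esub> (f \<otimes>\<^sub>V v)
      = gr_map (\<alpha> g) f \<otimes>\<^sub>V (gr_single 1 (\<one>\<^bsub>F\<^esub>, g) \<odot>\<^bsub>V\<^esub> v)"
proof -
  have t: "f \<otimes>\<^sub>V v \<in> carrier L" using assms by simp
  note single = obj_LM_lam LFG.lact_single SD_simps t
  show "gr_single c \<one>\<^bsub>SD\<^esub> \<odot>\<^bsub>obj (LM_lam n G \<alpha> lam) V\<^esub> (f \<otimes>\<^sub>V v) = (c *\<^sub>F f) \<otimes>\<^sub>V v"
    using assms by (simp add: single actG_one actF_one scalar_props)
  show "gr_single 1 (x, \<one>\<^bsub>G\<^esub>) \<odot>\<^bsub>obj (LM_lam n G \<alpha> lam) V\<^esub> (f \<otimes>\<^sub>V v) = tw x f \<otimes>\<^sub>V v"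
    if "x \<in> carrier F"
    using assms that by (simp add: single actG_one scalar_one actF_props)
  show "gr_single 1 (\<one>\<^bsub>F\<^esub>, g) \<odot>\<^bsub>obj (LM_lam n G \<alpha> lam) V\<^esub> (f \<otimes>\<^sub>V v)
      = gr_map (\<alpha> g) f \<otimes>\<^sub>V (gr_single 1 (\<one>\<^bsub>F\<^esub>, g) \<odot>\<^bsub>V\<^esub> v)" if "g \<in> carrier G"
    using assms that gr_map_semilinear(2)[OF alpha_hom[OF that]]
    by (simp add: single actF_one scalar_one actG_props)
qed

theorem theorem0p1:
  fixes lam :: "'k::field"
    and n :: nat
    and G :: "('g, 'm) monoid_scheme"
    and \<alpha> :: "'g \<Rightarrow> nat word set \<Rightarrow> nat word set"
  assumes "n \<ge> 2"
    and "lam \<noteq> 0"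
    and "artin_representation n G \<alpha>"
  shows
    \<comment> \<open>the action on the augmentation ideal, and the action and the morphism map on the
      tensor product, are well defined\<close>
    "(\<exists>!\<rho>. is_twisted_action n lam \<rho>) \<and>
     (\<forall>V :: (nat word set \<times> 'g \<Rightarrow> 'k, 'v) module. left_module (kFG n G \<alpha>) V \<longrightarrow>
        (\<forall>f\<in>carrier (aug_ideal n). \<forall>v\<in>carrier V.
          (\<forall>c. gr_single c \<one>\<^bsub>semidirect (free_group n) G \<alpha>\<^esub> \<odot>\<^bsub>obj (LM_lam n G \<alpha> lam) V\<^esub> LM_elt n G V f v
             = LM_elt n G V (gr_scale c f) v) \<and>
          (\<forall>x\<in>carrier (free_group n).
             gr_single 1 (x, \<one>\<^bsub>G\<^esub>) \<odot>\<^bsub>obj (LM_lam n G \<alpha> lam) V\<^esub> LM_elt n G V f v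
             = LM_elt n G V (twisted_action n lam x f) v) \<and>
          (\<forall>g\<in>carrier G.
             gr_single 1 (\<one>\<^bsub>free_group n\<^esub>, g) \<odot>\<^bsub>obj (LM_lam n G \<alpha> lam) V\<^esub> LM_elt n G V f v
             = LM_elt n G V (gr_map (\<alpha> g) f) (gr_single 1 (\<one>\<^bsub>free_group n\<^esub>, g) \<odot>\<^bsub>V\<^esub> v)) \<and>
          (\<forall>W. left_module (kFG n G \<alpha>) W \<longrightarrow> (\<forall>\<phi>\<in>mod_hom (kFG n G \<alpha>) V W.
             arr (LM_lam n G \<alpha> lam) V W \<phi> (LM_elt n G V f v) = LM_elt n G W f (\<phi> v))))) \<and>
     is_functor (kFG n G \<alpha>) (kFG n G \<alpha>)
       (LM_lam n G \<alpha> lam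
         :: (_, 'v, nat word set \<times> 'g \<Rightarrow> 'k, ('k, 'v) lm_elt) mod_functor) \<and>
     \<comment> \<open>(1)\<close>
     nat_isomorphic (kFG n (braid_group n) (artin_hom n)) (group_ring (braid_group n))
       (Res (incG n) \<circ>\<^sub>F LM_lam n (braid_group n) (artin_hom n) lam)
       (LM n (braid_group n) (artin_hom n)
         :: (_, 'v, nat word set \<Rightarrow> 'k, ('k, 'v) lm_elt) mod_functor) \<and>
     \<comment> \<open>(2): the identification of the two groups is the restriction along the mutually inverse
       isomorphisms between them\<close>
     (carrier G = {\<one>\<^bsub>G\<^esub>} \<longrightarrow>
       nat_isomorphic (kF n) (kF n)
         (Res (incF G) \<circ>\<^sub>F LM_lam n G \<alpha> lam \<circ>\<^sub>F Res (gr_map fst))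
         (Conv n lam :: (_, 'v, nat word set \<Rightarrow> 'k, nat \<Rightarrow> 'v) mod_functor))"
proof -
  interpret twisted_rep n lam G \<alpha>
    using assms by unfold_locales
  interpret braid: twisted_rep n lam "braid_group n" "artin_hom n"
    by unfold_locales (rule artin_representation_braid_group)
  show ?thesis
  proof (intro conjI allI impI ballI)
    show "\<exists>!\<rho>. is_twisted_action n lam \<rho>" by (rule ex1_twisted_action)
    show "is_functor RG RG
       (LM_lam n G \<alpha> lam :: (_, 'v, nat word set \<times> 'g \<Rightarrow> 'k, ('k, 'v) lm_elt) mod_functor)"
      by (rule is_functor_LM_lam)
    show "nat_isomorphic (kFG n (braid_group n) (artin_hom n)) (group_ring (braid_group n))
       (Res (incG n) \<circ>\<^sub>F LM_lam n (braid_group n) (artin_hom n) lam)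
       (LM n (braid_group n) (artin_hom n)
         :: (_, 'v, nat word set \<Rightarrow> 'k, ('k, 'v) lm_elt) mod_functor)"
      by (rule braid.Res_LM_lam_isomorphic_LM)
    show "nat_isomorphic R R (Res (incF G) \<circ>\<^sub>F LM_lam n G \<alpha> lam \<circ>\<^sub>F Res (gr_map fst))
         (Conv n lam :: (_, 'v, nat word set \<Rightarrow> 'k, nat \<Rightarrow> 'v) mod_functor)"
      if "carrier G = {\<one>\<^bsub>G\<^esub>}"
    proof -
      interpret trivial_rep n lam G \<alpha> using that by unfold_locales
      show ?thesis by (rule Res_LM_lam_isomorphic_Conv)
    qed
  next
    fix V :: "(nat word set \<times> 'g \<Rightarrow> 'k, 'v) module" and f v
    assume V: "left_module RG V" and fv: "f \<in> carrier I" "v \<in> carrier V"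
    interpret V: twisted_module n lam G \<alpha> V by (rule twisted_moduleI[OF V])
    show "gr_single c \<one>\<^bsub>SD\<^esub> \<odot>\<^bsub>obj (LM_lam n G \<alpha> lam) V\<^esub> LM_elt n G V f v
        = LM_elt n G V (gr_scale c f) v" for c
      by (rule V.LM_lam_on_tensors(1)[OF fv])
    show "gr_single 1 (x, \<one>\<^bsub>G\<^esub>) \<odot>\<^bsub>obj (LM_lam n G \<alpha> lam) V\<^esub> LM_elt n G V f v
        = LM_elt n G V (tw x f) v" if "x \<in> carrier F" for x
      by (rule V.LM_lam_on_tensors(2)[OF fv that])
    show "gr_single 1 (\<one>\<^bsub>F\<^esub>, g) \<odot>\<^bsub>obj (LM_lam n G \<alpha> lam) V\<^esub> LM_elt n G V f v
        = LM_elt n G V (gr_map (\<alpha> g) f) (gr_single 1 (\<one>\<^bsub>F\<^esub>, g) \<odot>\<^bsub>V\<^esub> v)" if "g \<in> carrier G" for g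
      by (rule V.LM_lam_on_tensors(3)[OF fv that])
    show "arr (LM_lam n G \<alpha> lam) V W \<phi> (LM_elt n G V f v) = LM_elt n G W f (\<phi> v)"
      if "left_module RG W" "\<phi> \<in> mod_hom RG V W" for W \<phi>
      unfolding LM_lam_simps by (rule LM_arr_props(1)[OF V that fv])
  qed
qed

end
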